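(* Let $t\in\mathbb{R}$, let $U$ be an open interval of $\mathbb{R}$ with $t\in U$, let $X$ be the random field on $U^2$ of the context (finite or $\sigma$-finite measure space case), $Y(s)=X(s,s)$ its diagonal, and let $\eta\in(0,c)$. Assume: (1) The function $v\mapsto f(s,v,x)$ is differentiable for all $(v,s)\in U^2$ and almost all $x\in E$; its derivative (with respect to the second argument) is denoted $f'_v$. (2) In the finite measure space case: there exists $\delta>\frac dc-1$ such that $\sup_{s\in U}\int_E\big[\sup_{w\in U}|f(s,w,x)|^{\alpha(w)}\big]^{1+\delta}\,\hat m(dx)<\infty$, and there exists $\delta>\frac dc-1$ such that $\sup_{s\in U}\int_E\big[\sup_{w\in U}|f'_v(s,w,x)|^{\alpha(w)}\big]^{1+\delta}\,\hat m(dx)<\infty$. In the $\sigma$-finite case: there exists $\delta>\frac dc-1$ such that $\sup_{s\in U}\int_E\big[\sup_{w\in U}|f(s,w,x)|^{\alpha(w)}\big]^{1+\delta}\rho(x)^{\delta}\,m(dx)<\infty$; there exists $\delta>\frac dc-1$ such that $\sup_{s\in U}\int_E\big[\sup_{w\in U}|f'_v(s,w,x)|^{\alpha(w)}\big]^{1+\delta}\rho(x)^{\delta}\,m(dx)<\infty$; and there exists $\delta>\frac dc-1$ such that $\sup_{s\in U}\int_E\big[\sup_{w\in U}|f(s,w,x)\log\rho(x)|^{\alpha(w)}\big]^{1+\delta}\rho(x)^{\delta}\,m(dx)<\infty$. (3) There is a $C^1$ function $h:U\to(h_-,h_+)\subset(0,1)$ such that the process $s\mapsto X(s,t)$ is $h(t)$-localisable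 at $t$, with local form $X'_t(\cdot,t)$. (4) With the same function $h$, there exist $\varepsilon_0>0$ and $K>0$ such that for all $0<r<\varepsilon_0$, $\frac{1}{r^{h(t)\alpha(t)}}\int_E|f(t+r,t,x)-f(t,t,x)|^{\alpha(t)}\,m(dx)\le K$. Then, as $\varepsilon\to0^+$, $$\mathsf{E}\big[|Y(t+\varepsilon)-Y(t)|^{\eta}\big]\sim\varepsilon^{\eta h(t)}\,\mathsf{E}\big[|Y'_t(1)|^{\eta}\big],$$ where $Y'_t$ is the local form of $Y$ at $t$.
   Context: Setting. $U\subset\mathbb{R}$ is an open interval; $\alpha:U\to[c,d]\subset(0,2)$ is $C^1$; $b:U\to\mathbb{R}$ is $C^1$ and bounded. For a measure space $(E,\mathcal{E},m)$, $\mathcal{F}_\alpha(E,\mathcal{E},m)$ is the set of measurable $g:E\to\mathbb{R}$ with $\int_E|g|^\alpha dm<\infty$. For all $(t,u)\in U^2$, $f(t,u,\cdot)\in\mathcal{F}_{\alpha(u)}(E,\mathcal{E},m)$. $(\Gamma_i)_{i\ge1}$ are the arrival times of a Poisson process with unit rate; $(V_i)_{i\ge1}$ are i.i.d. with law $\hat m$ on $E$; $(\gamma_i)_{i\ge1}$ are i.i.d. with $P(\gamma_i=1)=P(\gamma_i=-1)=1/2$; the three sequences are independent. $C_\eta=\big(\int_0^\infty x^{-\eta}\sin x\,dx\big)^{-1}$. Finite case: $m$ is finite, $\hat m=m/m(E)$, and $X(t,u)=b(u)\,m(E)^{1/\alpha(u)}C_{\alpha(u)}^{1/\alpha(u)}\sum_{i\ge1}\gamma_i\Gamma_i^{-1/\alpha(u)}f(t,u,V_i)$.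 $\sigma$-finite case: $m$ is $\sigma$-finite, $\rho:E\to\mathbb{R}_+$ is such that $\hat m(dx)=\frac1{\rho(x)}m(dx)$ is a probability measure, and $X(t,u)=b(u)\,C_{\alpha(u)}^{1/\alpha(u)}\sum_{i\ge1}\gamma_i\Gamma_i^{-1/\alpha(u)}\rho(V_i)^{1/\alpha(u)}f(t,u,V_i)$. Localisability. A process $Z$ is $h$-localisable at $u$ with local form $Z'_u$ if $Z'_u$ is a non-trivial process and $\frac{Z(u+rt)-Z(u)}{r^h}\to Z'_u(t)$ (as processes in $t$) in finite-dimensional distributions as $r\to0^+$. (Under the hypotheses of the statement, $Y$ is known to be $h(t)$-localisable at $t$, so $Y'_t$ is well defined.) The notation $A\sim B$ means that the ratio tends to $1$.
   Formalization: The relation ∼ is asserted only when Y'_t(1) is not almost surely zero (otherwise the ratio has denominator 0); in every case ε^{-ηh(t)}E[|Y(t+ε)-Y(t)|^η] is shown to converge to E[|Y'_t(1)|^η]. *)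

theory Defs
  imports "HOL-Probability.Probability" "HOL-Library.Landau_Symbols"
begin

section \<open>Random inputs of the series representation\<close>

text \<open>Poisson process of unit rate, given by its i.i.d. exponential inter-arrival times.
  Sequences are indexed from 0, so \<open>\<Gamma> i\<close> is the \<open>(i+1)\<close>-st arrival time.\<close>

definition unit_poisson_arrivals :: "'w measure \<Rightarrow> (nat \<Rightarrow> 'w \<Rightarrow> real) \<Rightarrow> bool" where
  "unit_poisson_arrivals M \<Gamma> \<longleftrightarrow>
     (let gap = (\<lambda>i \<omega>. \<Gamma> i \<omega> - (if i = 0 then 0 else \<Gamma> (i - 1) \<omega>)) in
        prob_space.indep_vars M (\<lambda>_. borel) gap UNIV \<and>
        (\<forall>i. distributed M lborel (gap i) (\<lambda>x. ennreal (exponential_density 1 x))))"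

definition iid_with_law :: "'w measure \<Rightarrow> 'e measure \<Rightarrow> (nat \<Rightarrow> 'w \<Rightarrow> 'e) \<Rightarrow> bool" where
  "iid_with_law M \<mu> V \<longleftrightarrow>
     prob_space.indep_vars M (\<lambda>_. \<mu>) V UNIV \<and> (\<forall>i. distr M \<mu> (V i) = \<mu>)"

definition iid_signs :: "'w measure \<Rightarrow> (nat \<Rightarrow> 'w \<Rightarrow> real) \<Rightarrow> bool" where
  "iid_signs M \<gamma> \<longleftrightarrow>
     prob_space.indep_vars M (\<lambda>_. borel) \<gamma> UNIV \<and>
     (\<forall>i. measure M {\<omega> \<in> space M. \<gamma> i \<omega> = 1} = 1 / 2 \<and>
          measure M {\<omega> \<in> space M. \<gamma> i \<omega> = -1} = 1 / 2)"

text \<open>The \<open>\<sigma>\<close>-algebra generated by a whole sequence of random variables.\<close>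

definition seq_events :: "'w measure \<Rightarrow> 'a measure \<Rightarrow> (nat \<Rightarrow> 'w \<Rightarrow> 'a) \<Rightarrow> 'w set set" where
  "seq_events M N S = sigma_sets (space M) {S i -` A \<inter> space M | i A. A \<in> sets N}"

text \<open>Mutual independence of the three sequences is independence of the generated
  \<open>\<sigma>\<close>-algebras, because \<open>indep_vars\<close> requires a common value type.\<close>

definition lepage_inputs ::
  "'w measure \<Rightarrow> 'e measure \<Rightarrow> (nat \<Rightarrow> 'w \<Rightarrow> real) \<Rightarrow> (nat \<Rightarrow> 'w \<Rightarrow> 'e) \<Rightarrow> (nat \<Rightarrow> 'w \<Rightarrow> real) \<Rightarrow> bool"
where
  "lepage_inputs M mhat \<Gamma> V \<gamma> \<longleftrightarrow>
     prob_space M \<and> unit_poisson_arrivals M \<Gamma> \<and> iid_with_law M mhat V \<and> iid_signs M \<gamma> \<and>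
     prob_space.indep_sets M
       (\<lambda>k. [seq_events M borel \<Gamma>, seq_events M mhat V, seq_events M borel \<gamma>] ! k) {..<3}"


section \<open>The random field\<close>

definition F_space :: "real \<Rightarrow> 'e measure \<Rightarrow> ('e \<Rightarrow> real) set" where
  "F_space a m =
     {g \<in> borel_measurable m. (\<integral>\<^sup>+x. ennreal (\<bar>g x\<bar> powr a) \<partial>m) < \<infinity>}"

text \<open>The integral converges only conditionally at infinity when \<open>a \<le> 1\<close>;
  the Henstock-Kurzweil integral over the half-line is then the improper integral,
  whereas the Lebesgue integral would be undefined.\<close>

definition stable_const :: "real \<Rightarrow> real" where
  "stable_const a = inverse (integral {0<..} (\<lambda>x. x powr (- a) * sin x))"

text \<open>In both cases the series converges almost surely, but not absolutely when \<open>1 \<le> \<alpha> u\<close>;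
  \<open>suminf\<close> is the limit of the partial sums.\<close>

definition field_finite ::
  "'e measure \<Rightarrow> (real \<Rightarrow> real) \<Rightarrow> (real \<Rightarrow> real) \<Rightarrow> (real \<Rightarrow> real \<Rightarrow> 'e \<Rightarrow> real) \<Rightarrow>
   (nat \<Rightarrow> 'w \<Rightarrow> real) \<Rightarrow> (nat \<Rightarrow> 'w \<Rightarrow> 'e) \<Rightarrow> (nat \<Rightarrow> 'w \<Rightarrow> real) \<Rightarrow> real \<Rightarrow> real \<Rightarrow> 'w \<Rightarrow> real"
where
  "field_finite m \<alpha> b f \<Gamma> V \<gamma> s u \<omega> =
     b u * measure m (space m) powr (1 / \<alpha> u) * stable_const (\<alpha> u) powr (1 / \<alpha> u) *
     (\<Sum>i. \<gamma> i \<omega> * \<Gamma> i \<omega> powr (- 1 / \<alpha> u) * f s u (V i \<omega>))"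

definition field_sigma_finite ::
  "('e \<Rightarrow> real) \<Rightarrow> (real \<Rightarrow> real) \<Rightarrow> (real \<Rightarrow> real) \<Rightarrow> (real \<Rightarrow> real \<Rightarrow> 'e \<Rightarrow> real) \<Rightarrow>
   (nat \<Rightarrow> 'w \<Rightarrow> real) \<Rightarrow> (nat \<Rightarrow> 'w \<Rightarrow> 'e) \<Rightarrow> (nat \<Rightarrow> 'w \<Rightarrow> real) \<Rightarrow> real \<Rightarrow> real \<Rightarrow> 'w \<Rightarrow> real"
where
  "field_sigma_finite \<rho> \<alpha> b f \<Gamma> V \<gamma> s u \<omega> =
     b u * stable_const (\<alpha> u) powr (1 / \<alpha> u) *
     (\<Sum>i. \<gamma> i \<omega> * \<Gamma> i \<omega> powr (- 1 / \<alpha> u) * \<rho> (V i \<omega>) powr (1 / \<alpha> u) * f s u (V i \<omega>))"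


section \<open>Integrability conditions uniform in the second argument\<close>

text \<open>Real powers on \<open>[0, \<infinity>]\<close>; only used with positive exponents.\<close>

definition ennreal_powr :: "ennreal \<Rightarrow> real \<Rightarrow> ennreal" where
  "ennreal_powr x p = (if x = \<infinity> then \<infinity> else ennreal (enn2real x powr p))"

definition sup_cond_finite ::
  "real set \<Rightarrow> (real \<Rightarrow> real) \<Rightarrow> real \<Rightarrow> real \<Rightarrow> 'e measure \<Rightarrow> (real \<Rightarrow> real \<Rightarrow> 'e \<Rightarrow> real) \<Rightarrow> bool"
where
  "sup_cond_finite U \<alpha> c d mhat g \<longleftrightarrow>
     (\<exists>\<delta>. \<delta> > d / c - 1 \<and>
        (SUP s\<in>U. \<integral>\<^sup>+x. ennreal_powr (SUP w\<in>U. ennreal (\<bar>g s w x\<bar> powr \<alpha> w)) (1 + \<delta>) \<partial>mhat) < \<infinity>)"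

definition sup_cond_sigma_finite ::
  "real set \<Rightarrow> (real \<Rightarrow> real) \<Rightarrow> real \<Rightarrow> real \<Rightarrow> 'e measure \<Rightarrow> ('e \<Rightarrow> real) \<Rightarrow>
   (real \<Rightarrow> real \<Rightarrow> 'e \<Rightarrow> real) \<Rightarrow> bool"
where
  "sup_cond_sigma_finite U \<alpha> c d m \<rho> g \<longleftrightarrow>
     (\<exists>\<delta>. \<delta> > d / c - 1 \<and>
        (SUP s\<in>U. \<integral>\<^sup>+x. ennreal_powr (SUP w\<in>U. ennreal (\<bar>g s w x\<bar> powr \<alpha> w)) (1 + \<delta>)
                         * ennreal (\<rho> x powr \<delta>) \<partial>m) < \<infinity>)"


section \<open>Localisability\<close>

text \<open>Convergence of finite-dimensional distributions, along a filter \<open>F\<close>, of processes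
  \<open>Z r\<close> on \<open>M\<close> to a process \<open>Z'\<close> on \<open>M'\<close>: weak convergence of the laws of
  \<open>(Z r (ts 0), \<dots>, Z r (ts (n - 1)))\<close>. Vectors of length \<open>n\<close> are embedded in
  \<open>nat \<Rightarrow> real\<close> (product topology) by padding with 0, so that bounded continuous \<open>g\<close>
  yield exactly the bounded continuous test functions of \<open>n\<close> real variables.\<close>

definition fdd_tendsto ::
  "'w measure \<Rightarrow> ('r \<Rightarrow> real \<Rightarrow> 'w \<Rightarrow> real) \<Rightarrow> 'v measure \<Rightarrow> (real \<Rightarrow> 'v \<Rightarrow> real) \<Rightarrow> 'r filter \<Rightarrow> bool"
where
  "fdd_tendsto M Z M' Z' F \<longleftrightarrow>
     (\<forall>(n::nat) (ts::nat \<Rightarrow> real) (g::(nat \<Rightarrow> real) \<Rightarrow> real).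
        continuous_on UNIV g \<and> bounded (range g) \<longrightarrow>
        ((\<lambda>r. \<integral>\<omega>. g (\<lambda>i. if i < n then Z r (ts i) \<omega> else 0) \<partial>M)
           \<longlongrightarrow> (\<integral>\<omega>. g (\<lambda>i. if i < n then Z' (ts i) \<omega> else 0) \<partial>M')) F)"

text \<open>\<open>Z\<close> is \<open>h\<close>-localisable at \<open>u\<close> with local form \<open>Z'\<close>, which may live on another
  probability space. Non-trivial means: not almost surely zero at every time.\<close>

definition localisable_with ::
  "'w measure \<Rightarrow> (real \<Rightarrow> 'w \<Rightarrow> real) \<Rightarrow> real \<Rightarrow> real \<Rightarrow> 'v measure \<Rightarrow> (real \<Rightarrow> 'v \<Rightarrow> real) \<Rightarrow> bool"
where
  "localisable_with M Z u h M' Z' \<longleftrightarrow>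
     prob_space M' \<and> (\<forall>s. Z' s \<in> borel_measurable M') \<and>
     (\<exists>s. \<not> (AE \<omega> in M'. Z' s \<omega> = 0)) \<and>
     fdd_tendsto M (\<lambda>r s \<omega>. (Z (u + r * s) \<omega> - Z u \<omega>) / r powr h) M' Z' (at_right 0)"

end

theory Submission
  imports Defs
begin

text \<open>Localisability gives convergence in distribution of the normalised increment of \<open>Y\<close>, so the
  moments of order \<open>\<eta>\<close> converge as soon as the increments \<open>(Y (t + \<epsilon>) - Y t) / \<epsilon> powr h t\<close> have tails
  \<open>O(l powr - q)\<close> uniformly in \<open>\<epsilon>\<close>, for some \<open>q > \<eta>\<close>.
  Given the weights, a random series with signs \<open>\<gamma> i\<close> has tail at \<open>l\<close> at most
  \<open>\<Sum>i. min 1 ((w i / l)\<^sup>2)\<close>; averaging over the Poisson points with Campbell's formula,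
  a series with weights \<open>T (\<Gamma> i, V i)\<close> has tail at most \<open>\<integral>\<integral> min 1 ((T (x, v) / l)\<^sup>2) dx dmhat\<close>.
  The increment \<open>Y u - Y t\<close> splits into the variation of the prefactor \<open>b u * C u\<close>, which is
  Lipschitz; the variation of the second argument of the kernel, controlled by the mean value theorem
  and the conditions on the suprema; and the increment of \<open>s \<mapsto> X s t\<close>, controlled by condition (4).
  The finite case is the \<open>\<sigma>\<close>-finite one with constant \<open>\<rho>\<close>.\<close>

section \<open>Random sign series\<close>

text \<open>Stable series have infinite variance, so second moments help only after truncation:
  hence the bound by \<open>min 1\<close>, which costs nothing because probabilities are at most 1.
  The other obstacle is the varying index: differentiating \<open>x powr (-1 / \<alpha> w)\<close>
  in \<open>w\<close> produces \<open>ln x\<close>, and the index ranges over \<open>{c..d}\<close>.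
  Both effects are absorbed by two fixed powers, \<open>x powr (-\<beta>1)\<close> for small
  \<open>x\<close> and \<open>x powr (-\<beta>2)\<close> for large \<open>x\<close>. The exponent
  \<open>\<beta>1 = 1 / q\<close> with \<open>\<eta> < q < c\<close> sets the tail order
  \<open>q\<close>; the exponent \<open>\<beta>2\<close> must exceed \<open>1 / 2\<close> for square
  integrability at infinity and lie below \<open>1 / d\<close>. Integrating over the marks then
  needs the power \<open>1 / (c * \<beta>2)\<close> of the suprema, and
  \<open>\<delta> > d / c - 1\<close> is exactly what allows this power to be at most
  \<open>1 + \<delta>\<close>. The weight \<open>\<rho>\<close> is raised to
  \<open>1 / \<alpha> w\<close> too, whence the logarithmic condition. As \<open>h t < 1\<close>, a
  term of size \<open>\<epsilon>\<close> stays bounded after division by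
  \<open>\<epsilon> powr h t\<close>, so a Lipschitz estimate is enough for the first two
  pieces.\<close>

lemma (in prob_space) kolmogorov_maximal_inequality:
  fixes X :: "nat \<Rightarrow> 'a \<Rightarrow> real"
  assumes indep: "indep_vars (\<lambda>_. borel) X UNIV"
    and bnd: "\<And>i. AE \<omega> in M. \<bar>X i \<omega>\<bar> \<le> B i"
    and mean: "\<And>i. expectation (X i) = 0"
    and e: "0 < e"
  shows "prob {\<omega>\<in>space M. \<exists>k\<in>{m..n}. e \<le> \<bar>\<Sum>i=m..<k. X i \<omega>\<bar>}
    \<le> expectation (\<lambda>\<omega>. (\<Sum>i=m..<n. X i \<omega>)^2) / e^2"
proof -
  have [measurable]: "random_variable borel (X i)" for i
    using indep by (auto simp: indep_vars_def)
  define S where "S k \<omega> = (\<Sum>i=m..<k. X i \<omega>)" for k \<omega>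
  \<comment> \<open>\<open>T k\<close> is the event that \<open>k\<close> is the first index from
    \<open>m\<close> on at which the partial sum reaches level \<open>e\<close>. These events are
    disjoint, and each is determined by the variables before index \<open>k\<close>.\<close>
  define T where "T k = {\<omega>\<in>space M. e \<le> \<bar>S k \<omega>\<bar> \<and> (\<forall>j\<in>{m..<k}. \<bar>S j \<omega>\<bar> < e)}" for k
  have [measurable]: "random_variable borel (S k)" for k
    unfolding S_def by measurable
  have [measurable]: "T k \<in> events" for k
    unfolding T_def by measurable
  have AEb: "AE \<omega> in M. \<forall>i. \<bar>X i \<omega>\<bar> \<le> B i"
    using bnd by (simp add: AE_all_countable)
  have Bb: "\<bar>\<Sum>i\<in>A. X i \<omega>\<bar> \<le> (\<Sum>i\<in>A. B i)" if "\<forall>i. \<bar>X i \<omega>\<bar> \<le> B i" for A \<omega>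
    using that by (intro order_trans[OF sum_abs] sum_mono) auto
  have intX: "integrable M (X i)" for i
    by (rule integrable_const_bound[where B="B i"]) (use bnd in auto)
  have intsq: "integrable M (\<lambda>\<omega>. (\<Sum>i=m..<n. X i \<omega>)^2)"
  proof (rule integrable_const_bound[where B="(\<Sum>i=m..<n. B i)^2"])
    show "AE \<omega> in M. norm ((\<Sum>i = m..<n. X i \<omega>)\<^sup>2) \<le> (\<Sum>i = m..<n. B i)\<^sup>2"
      using AEb by eventually_elim (auto simp: abs_le_square_iff[symmetric] intro: order_trans[OF Bb] )
  qed measurable
  have intT: "integrable M (indicat_real (T k))" for k
    by (intro integrable_real_indicator) (auto simp: less_top[symmetric])
  let ?X = "\<lambda>k \<omega>. (indicator (T k) \<omega> * S k \<omega>) * (S n \<omega> - S k \<omega>)"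
  \<comment> \<open>Past and future separate here:
    \<open>indicator (T k) \<omega> * S k \<omega>\<close> is a function of the variables with index
    below \<open>k\<close>, and \<open>S n \<omega> - S k \<omega>\<close> of those from
    \<open>k\<close> on, which have mean zero. Almost sure boundedness gives integrability of both
    factors.\<close>
  have cross: "integrable M (?X k) \<and>
     expectation (?X k) = 0" if "m \<le> k" "k \<le> n" for k
  proof -
    \<comment> \<open>The past factor as a function of the coordinate vector, so that independence
      of disjoint blocks of coordinates applies.\<close>
    define Y1 where "Y1 z = (if e \<le> \<bar>\<Sum>i=m..<k. z i\<bar> \<and> (\<forall>j\<in>{m..<k}. \<bar>\<Sum>i=m..<j. z i\<bar> < e) then \<Sum>i=m..<k. z i else 0)"
      for z :: "nat \<Rightarrow> real"
    define Y2 where "Y2 z = (\<Sum>i=k..<n. z i)" for z :: "nat \<Rightarrow> real"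
    let ?R = "\<lambda>\<omega>. restrict (\<lambda>i. X i \<omega>) {m..<k}"
    have m1: "Y1 \<in> measurable (PiM {m..<k} (\<lambda>_. borel)) borel"
    proof -
      have s: "(\<lambda>z. \<Sum>i=m..<j. z i) \<in> borel_measurable (PiM {m..<k} (\<lambda>_. borel :: real measure))" if "j \<le> k" for j
        using that by (intro borel_measurable_sum measurable_component_singleton) auto
      have [measurable]: "Measurable.pred (PiM {m..<k} (\<lambda>_. borel :: real measure)) (\<lambda>z. \<bar>\<Sum>i=m..<j. z i\<bar> < e)" if "j \<in> {m..<k}" for j
      proof -
        have [measurable]: "(\<lambda>z. \<Sum>i=m..<j. z i) \<in> borel_measurable (PiM {m..<k} (\<lambda>_. borel :: real measure))"
          using s[of j] that by auto
        show ?thesis by measurable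
      qed
      note [measurable] = s[OF order_refl]
      show ?thesis unfolding Y1_def by measurable
    qed
    have m2: "Y2 \<in> measurable (PiM {k..<n} (\<lambda>_. borel)) borel"
      unfolding Y2_def by (intro borel_measurable_sum measurable_component_singleton) auto
    have "indep_var borel (Y1 \<circ> ?R) borel (Y2 \<circ> (\<lambda>\<omega>. restrict (\<lambda>i. X i \<omega>) {k..<n}))"
      by (rule indep_var_compose[OF indep_var_restrict[OF indep] m1 m2]) auto
    also have "Y2 \<circ> (\<lambda>\<omega>. restrict (\<lambda>i. X i \<omega>) {k..<n}) = (\<lambda>\<omega>. \<Sum>i=k..<n. X i \<omega>)"
      by (auto simp: fun_eq_iff Y2_def)
    finally have ind: "indep_var borel (Y1 \<circ> ?R) borel (\<lambda>\<omega>. \<Sum>i=k..<n. X i \<omega>)" .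
    have eq1: "(Y1 \<circ> ?R) \<omega> = indicator (T k) \<omega> * S k \<omega>" if "\<omega> \<in> space M" for \<omega>
    proof -
      have "(\<Sum>i=m..<j. restrict (\<lambda>i. X i \<omega>) {m..<k} i) = S j \<omega>" if "j \<le> k" for j
        unfolding S_def using that by (intro sum.cong) auto
      then show ?thesis using \<open>\<omega> \<in> space M\<close> by (auto simp: Y1_def T_def)
    qed
    have i1: "integrable M (\<lambda>\<omega>. indicator (T k) \<omega> * S k \<omega>)"
    proof (rule integrable_const_bound[where B="(\<Sum>i=m..<k. B i)"])
      show "AE \<omega> in M. norm (indicator (T k) \<omega> * S k \<omega>) \<le> (\<Sum>i = m..<k. B i)"
        using AEb
      proof eventually_elim
        case (elim \<omega>)
        from Bb[OF elim, of "{m..<k}"] show ?case by (auto simp: indicator_def S_def)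
      qed
    qed measurable
    have i1': "integrable M (Y1 \<circ> ?R)"
      using i1 by (subst Bochner_Integration.integrable_cong[OF refl eq1]) auto
    have i2: "integrable M (\<lambda>\<omega>. \<Sum>i=k..<n. X i \<omega>)" using intX by auto
    have e2: "S n \<omega> - S k \<omega> = (\<Sum>i=k..<n. X i \<omega>)" for \<omega>
      unfolding S_def using that sum.atLeastLessThan_concat[of m k n "\<lambda>i. X i \<omega>"] by simp
    have z: "expectation (\<lambda>\<omega>. \<Sum>i=k..<n. X i \<omega>) = 0"
      using intX mean by simp
    have I: "integrable M (\<lambda>\<omega>. (Y1 \<circ> ?R) \<omega> * (\<Sum>i=k..<n. X i \<omega>))"
      using indep_var_integrable[OF ind i1' i2] .
    have J: "expectation (\<lambda>\<omega>. (Y1 \<circ> ?R) \<omega> * (\<Sum>i=k..<n. X i \<omega>)) = 0"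
      using indep_var_lebesgue_integral[OF ind i1' i2] z by simp
    show ?thesis
      unfolding e2 using I J eq1[unfolded comp_def]
      by (simp cong: Bochner_Integration.integrable_cong Bochner_Integration.integral_cong)
  qed
  have intC: "integrable M (\<lambda>\<omega>. \<Sum>k=m..n. ?X k \<omega>)"
    using cross by (intro Bochner_Integration.integrable_sum) auto
  have intC2: "integrable M (\<lambda>\<omega>. 2 * (\<Sum>k=m..n. ?X k \<omega>))"
    using intC by (rule integrable_mult_right)
  have T1: "{\<omega>\<in>space M. \<exists>k\<in>{m..n}. e \<le> \<bar>S k \<omega>\<bar>} \<subseteq> (\<Union>k\<in>{m..n}. T k)"
  proof safe
    fix \<omega> k assume "\<omega> \<in> space M" and k: "k \<in> {m..n}" "e \<le> \<bar>S k \<omega>\<bar>"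
    define k0 where "k0 = (LEAST k. m \<le> k \<and> e \<le> \<bar>S k \<omega>\<bar>)"
    have "m \<le> k0 \<and> e \<le> \<bar>S k0 \<omega>\<bar>" unfolding k0_def by (rule LeastI[of _ k]) (use k in auto)
    moreover have "k0 \<le> k" unfolding k0_def by (rule Least_le) (use k in auto)
    moreover have "\<bar>S j \<omega>\<bar> < e" if "m \<le> j" "j < k0" for j
      using not_less_Least[of j "\<lambda>k. m \<le> k \<and> e \<le> \<bar>S k \<omega>\<bar>"] that by (auto simp: k0_def)
    ultimately show "\<omega> \<in> (\<Union>k\<in>{m..n}. T k)"
      using k \<open>\<omega> \<in> space M\<close> by (auto simp: T_def intro!: bexI[of _ k0])
  qed
  \<comment> \<open>Expand the square of \<open>S n = S k + (S n - S k)\<close> and use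
    \<open>e^2 \<le> (S k \<omega>)^2\<close> on the only \<open>T k\<close> that contains
    \<open>\<omega>\<close>; outside all of them both sums vanish.\<close>
  have pw: "e^2 * (\<Sum>k=m..n. indicator (T k) \<omega>) \<le>
      (S n \<omega>)^2 - 2 * (\<Sum>k=m..n. ?X k \<omega>)" for \<omega>
  proof (cases "\<exists>k\<in>{m..n}. \<omega> \<in> T k")
    case False
    then show ?thesis by simp
  next
    case True
    then obtain k where k: "k \<in> {m..n}" "\<omega> \<in> T k" by auto
    have uniq: "\<omega> \<notin> T j" if "j \<noteq> k" "j \<in> {m..n}" for j
    proof
      assume j: "\<omega> \<in> T j"
      show False
      proof (cases "j < k")
        case True
        then have "\<bar>S j \<omega>\<bar> < e" using k that by (auto simp: T_def)
        then show False using j by (auto simp: T_def)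
      next
        case False
        then have "\<bar>S k \<omega>\<bar> < e" using j k that by (auto simp: T_def)
        then show False using k by (auto simp: T_def)
      qed
    qed
    have s1: "(\<Sum>k=m..n. indicator (T k) \<omega> :: real) = 1"
      using k uniq by (subst sum.remove[of _ k]) (auto intro!: sum.neutral simp: indicator_def)
    have s2: "(\<Sum>k=m..n. ?X k \<omega>) = S k \<omega> * (S n \<omega> - S k \<omega>)"
      using k uniq by (subst sum.remove[of _ k]) (auto intro!: sum.neutral simp: indicator_def)
    have "e^2 \<le> (S k \<omega>)^2" using k e by (auto simp: T_def abs_le_square_iff[symmetric])
    also have "\<dots> \<le> (S k \<omega>)^2 + (S n \<omega> - S k \<omega>)^2" by simp
    also have "\<dots> = (S n \<omega>)^2 - 2 * (S k \<omega> * (S n \<omega> - S k \<omega>))"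
      by (simp add: power2_eq_square algebra_simps)
    finally show ?thesis unfolding s1 s2 by simp
  qed
  have "e^2 * prob {\<omega>\<in>space M. \<exists>k\<in>{m..n}. e \<le> \<bar>S k \<omega>\<bar>} \<le> e^2 * prob (\<Union>k\<in>{m..n}. T k)"
    using T1 by (intro mult_left_mono finite_measure_mono) auto
  also have "\<dots> \<le> e^2 * (\<Sum>k=m..n. prob (T k))"
    by (intro mult_left_mono finite_measure_subadditive_finite) auto
  also have "\<dots> = expectation (\<lambda>\<omega>. e^2 * (\<Sum>k=m..n. indicator (T k) \<omega>))"
    using intT by simp
  also have "\<dots> \<le> expectation (\<lambda>\<omega>. (S n \<omega>)^2 - 2 * (\<Sum>k=m..n. ?X k \<omega>))"
    using intsq[folded S_def] intC2 intT
    by (intro integral_mono pw Bochner_Integration.integrable_diff) auto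
  also have "\<dots> = expectation (\<lambda>\<omega>. (S n \<omega>)^2)"
    using intsq[folded S_def] intC2 cross by (subst Bochner_Integration.integral_diff) auto
  finally show ?thesis
    using e by (simp add: S_def[symmetric] field_simps)
qed


text \<open>Only the masses at 1 and -1 are given. They add up to 1, so no other value has positive
  probability, and \<open>g\<close> agrees almost surely with a difference of two
  indicators.\<close>

lemma (in prob_space) fair_sign:
  fixes g :: "'a \<Rightarrow> real"
  assumes [measurable]: "random_variable borel g"
    and g: "prob {\<omega>\<in>space M. g \<omega> = 1} = 1/2" "prob {\<omega>\<in>space M. g \<omega> = -1} = 1/2"
  shows AE_fair_sign: "AE \<omega> in M. \<bar>g \<omega>\<bar> = 1" and expectation_fair_sign: "expectation g = 0"
proof -
  have "prob {\<omega>\<in>space M. \<bar>g \<omega>\<bar> = 1} = prob ({\<omega>\<in>space M. g \<omega> = 1} \<union> {\<omega>\<in>space M. g \<omega> = -1})"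
    by (intro arg_cong[where f=prob]) (auto simp: abs_if split: if_splits)
  also have "\<dots> = 1"
    by (subst finite_measure_Union) (auto simp: g less_top[symmetric] intro!: integrable_real_indicator)
  finally show AE: "AE \<omega> in M. \<bar>g \<omega>\<bar> = 1"
    by (subst (asm) prob_Collect_eq_1) auto
  have "expectation g = expectation (\<lambda>\<omega>. indicator {\<omega>\<in>space M. g \<omega> = 1} \<omega> - indicator {\<omega>\<in>space M. g \<omega> = -1} \<omega>)"
    using AE by (intro integral_cong_AE) (auto simp: indicator_def abs_if split: if_splits)
  also have "\<dots> = 0"
    by (subst Bochner_Integration.integral_diff) (auto simp: g less_top[symmetric] intro!: integrable_real_indicator)
  finally show "expectation g = 0" .
qed

locale rademacher = prob_space +
  fixes \<gamma> :: "nat \<Rightarrow> 'a \<Rightarrow> real"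
  assumes indep_signs: "indep_vars (\<lambda>_. borel) \<gamma> UNIV"
    and sign_prob: "\<And>i. prob {\<omega>\<in>space M. \<gamma> i \<omega> = 1} = 1/2" "\<And>i. prob {\<omega>\<in>space M. \<gamma> i \<omega> = -1} = 1/2"
begin

lemma measurable_sign[measurable]: "random_variable borel (\<gamma> i)"
  using indep_signs by (auto simp: indep_vars_def)

lemma sign_AE: "AE \<omega> in M. \<bar>\<gamma> i \<omega>\<bar> = 1"
  and sign_expectation: "expectation (\<gamma> i) = 0"
  using AE_fair_sign[OF _ sign_prob] expectation_fair_sign[OF _ sign_prob] by auto

text \<open>Orthogonality: each new term is centred and independent of the preceding sum, so the
  cross term drops, and its square is almost surely the constant
  \<open>(w n)\<^sup>2\<close>.\<close>

lemma second_moment: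
  "integrable M (\<lambda>\<omega>. (\<Sum>i=m..<n. \<gamma> i \<omega> * w i)\<^sup>2) \<and>
   expectation (\<lambda>\<omega>. (\<Sum>i=m..<n. \<gamma> i \<omega> * w i)\<^sup>2) = (\<Sum>i=m..<n. (w i)\<^sup>2)"
proof (induction n)
  case (Suc n)
  show ?case
  proof (cases "m \<le> n")
    case True
    let ?S = "\<lambda>\<omega>. \<Sum>i=m..<n. \<gamma> i \<omega> * w i"
    have iv: "indep_vars (\<lambda>_. borel) (\<lambda>i \<omega>. \<gamma> i \<omega> * w i) (insert n {m..<n})"
      by (rule indep_vars_subset[OF indep_vars_compose2[OF indep_signs, of "\<lambda>i x. x * w i"]]) auto
    have ind: "indep_var borel (\<lambda>\<omega>. \<gamma> n \<omega> * w n) borel ?S"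
      by (rule indep_vars_sum[OF _ _ iv]) auto
    have int: "integrable M (\<lambda>\<omega>. \<gamma> i \<omega> * w i)" for i
      using sign_AE[of i] by (intro integrable_const_bound[where B="\<bar>w i\<bar>"]) (auto simp: abs_mult)
    have S: "integrable M ?S" using int by auto
    have c0: "integrable M (\<lambda>\<omega>. (\<gamma> n \<omega> * w n) * ?S \<omega>)"
      by (rule indep_var_integrable[OF ind int S])
    have c1: "expectation (\<lambda>\<omega>. (\<gamma> n \<omega> * w n) * ?S \<omega>) = 0"
      using indep_var_lebesgue_integral[OF ind int S] sign_expectation by simp
    have sq: "AE \<omega> in M. (\<gamma> n \<omega> * w n)\<^sup>2 = (w n)\<^sup>2"
      using sign_AE[of n] by eventually_elim (simp add: power_mult_distrib abs_square_eq_1)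
    have q0: "integrable M (\<lambda>\<omega>. (\<gamma> n \<omega> * w n)\<^sup>2)"
      by (subst integrable_cong_AE[OF _ _ sq]) auto
    have q1: "expectation (\<lambda>\<omega>. (\<gamma> n \<omega> * w n)\<^sup>2) = (w n)\<^sup>2"
      by (subst integral_cong_AE[OF _ _ sq]) (auto simp: prob_space)
    have eq: "(\<Sum>i=m..<Suc n. \<gamma> i \<omega> * w i)\<^sup>2 = (?S \<omega>)\<^sup>2 + 2 * ((\<gamma> n \<omega> * w n) * ?S \<omega>) + (\<gamma> n \<omega> * w n)\<^sup>2" for \<omega>
      using True by (simp add: power2_eq_square algebra_simps)
    show ?thesis
      unfolding eq using Suc.IH c0 c1 q0 q1 True by (simp add: sum.atLeastLessThan_Suc)
  qed simp
qed simp

text \<open>Enlarging the second moment to the full tail sum makes the maximal inequality uniform in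
  \<open>n\<close>, and \<open>n\<close> may tend to infinity along increasing events. The start
  \<open>m\<close> stays free for the Cauchy criterion.\<close>

lemma maximal_tail:
  assumes w: "summable (\<lambda>i. (w i)\<^sup>2)" and e: "0 < e"
  shows "prob {\<omega>\<in>space M. \<exists>k\<ge>m. e \<le> \<bar>\<Sum>i=m..<k. \<gamma> i \<omega> * w i\<bar>} \<le> (\<Sum>i. (w (i + m))\<^sup>2) / e\<^sup>2"
proof -
  define A where "A n = {\<omega>\<in>space M. \<exists>k\<in>{m..n}. e \<le> \<bar>\<Sum>i=m..<k. \<gamma> i \<omega> * w i\<bar>}" for n
  have [measurable]: "A n \<in> events" for n unfolding A_def by measurable
  have w': "summable (\<lambda>i. (w (i + m))\<^sup>2)" using w by (subst summable_iff_shift)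
  have iv: "indep_vars (\<lambda>_. borel) (\<lambda>i \<omega>. \<gamma> i \<omega> * w i) UNIV"
    by (rule indep_vars_compose2[OF indep_signs, of "\<lambda>i x. x * w i"]) auto
  have le: "prob (A n) \<le> (\<Sum>i. (w (i + m))\<^sup>2) / e\<^sup>2" for n
  proof -
    have "prob (A n) \<le> expectation (\<lambda>\<omega>. (\<Sum>i=m..<n. \<gamma> i \<omega> * w i)^2) / e^2"
      unfolding A_def
    proof (rule kolmogorov_maximal_inequality[OF iv _ _ e])
      show "AE \<omega> in M. \<bar>\<gamma> i \<omega> * w i\<bar> \<le> \<bar>w i\<bar>" for i
        using sign_AE[of i] by eventually_elim (simp add: abs_mult)
    qed (simp add: sign_expectation)
    also have "\<dots> = (\<Sum>i=m..<n. (w i)\<^sup>2) / e^2" using second_moment by simp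
    also have "(\<Sum>i=m..<n. (w i)\<^sup>2) = (\<Sum>i<n-m. (w (i + m))\<^sup>2)"
      by (rule sum.reindex_bij_witness[of _ "\<lambda>i. i + m" "\<lambda>i. i - m"]) auto
    also have "\<dots> \<le> (\<Sum>i. (w (i + m))\<^sup>2)" using w' by (intro sum_le_suminf) auto
    finally show ?thesis by (simp add: divide_right_mono)
  qed
  have "(\<lambda>n. prob (A n)) \<longlonglongrightarrow> prob (\<Union>n. A n)"
  proof (rule finite_Lim_measure_incseq)
    show "incseq A" unfolding incseq_def A_def by (auto intro!: bexI)
  qed auto
  moreover have "(\<Union>n. A n) = {\<omega>\<in>space M. \<exists>k\<ge>m. e \<le> \<bar>\<Sum>i=m..<k. \<gamma> i \<omega> * w i\<bar>}"
    unfolding A_def by force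
  ultimately show ?thesis
    using le LIMSEQ_le_const2[of "\<lambda>n. prob (A n)"] by auto
qed

lemma AE_summable:
  assumes w: "summable (\<lambda>i. (w i)\<^sup>2)"
  shows "AE \<omega> in M. summable (\<lambda>i. \<gamma> i \<omega> * w i)"
proof -
  have "AE \<omega> in M. \<exists>m. \<forall>k\<ge>m. \<bar>\<Sum>i=m..<k. \<gamma> i \<omega> * w i\<bar> < 1 / real (Suc j)" for j
  proof -
    define e where "e = 1 / real (Suc j)"
    have e: "0 < e" by (simp add: e_def)
    \<comment> \<open>\<open>N\<close> collects the outcomes whose partial sums move by at least
      \<open>e\<close> after every start \<open>m\<close>. Its probability is below a multiple of
      every tail sum of squares, hence zero.\<close>
    define N where "N = {\<omega>\<in>space M. \<forall>m. \<exists>k\<ge>m. e \<le> \<bar>\<Sum>i=m..<k. \<gamma> i \<omega> * w i\<bar>}"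
    have [measurable]: "N \<in> events" unfolding N_def by measurable
    have "prob N \<le> (\<Sum>i. (w (i + m))\<^sup>2) / e\<^sup>2" for m
      by (rule order_trans[OF finite_measure_mono maximal_tail[OF w e]]) (auto simp: N_def)
    moreover have "(\<lambda>m. (\<Sum>i. (w (i + m))\<^sup>2) / e\<^sup>2) \<longlonglongrightarrow> 0 / e\<^sup>2"
      by (intro tendsto_divide suminf_exist_split2 w tendsto_const) (use e in auto)
    ultimately have "prob N \<le> 0"
      using LIMSEQ_le_const[of _ "0 / e\<^sup>2" "prob N"] by auto
    then have "prob N = 0" by (simp add: measure_le_0_iff)
    then have "AE \<omega> in M. \<omega> \<notin> N"
      by (subst prob_eq_0[symmetric]) auto
    with AE_space show ?thesis
    proof eventually_elim
      case (elim \<omega>)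
      then obtain m where "\<forall>k\<ge>m. \<not> e \<le> \<bar>\<Sum>i=m..<k. \<gamma> i \<omega> * w i\<bar>"
        unfolding N_def by blast
      then show ?case unfolding e_def not_le by blast
    qed
  qed
  then have "AE \<omega> in M. \<forall>j. \<exists>m. \<forall>k\<ge>m. \<bar>\<Sum>i=m..<k. \<gamma> i \<omega> * w i\<bar> < 1 / real (Suc j)"
    by (simp add: AE_all_countable)
  then show ?thesis
  proof eventually_elim
    case (elim \<omega>)
    show ?case
      unfolding summable_Cauchy
    proof (intro allI impI)
      fix e :: real assume "0 < e"
      then obtain j where j: "1 / real (Suc j) < e / 2"
        using nat_approx_posE[of "e/2"] by auto
      obtain m where m: "\<And>k. k \<ge> m \<Longrightarrow> \<bar>\<Sum>i=m..<k. \<gamma> i \<omega> * w i\<bar> < 1 / real (Suc j)"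
        using elim by blast
      have "norm (\<Sum>i=k..<n. \<gamma> i \<omega> * w i) < e" if "k \<ge> m" for k n
      proof (cases "k \<le> n")
        case True
        have "(\<Sum>i=k..<n. \<gamma> i \<omega> * w i) = (\<Sum>i=m..<n. \<gamma> i \<omega> * w i) - (\<Sum>i=m..<k. \<gamma> i \<omega> * w i)"
          using sum.atLeastLessThan_concat[of m k n "\<lambda>i. \<gamma> i \<omega> * w i"] that True by simp
        then show ?thesis
          using m[of k] m[of n] that True j by simp
      qed (use \<open>0 < e\<close> in simp)
      then show "\<exists>N. \<forall>m\<ge>N. \<forall>n. norm (\<Sum>i=m..<n. \<gamma> i \<omega> * w i) < e" by blast
    qed
  qed
qed

text \<open>Almost surely the limit exceeds \<open>l\<close> only if some partial sum reaches
  \<open>l\<close>, so the maximal inequality started at index 0 applies.\<close>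

lemma suminf_tail:
  assumes w: "summable (\<lambda>i. (w i)\<^sup>2)" and l: "0 < l"
  shows "prob {\<omega>\<in>space M. l < \<bar>\<Sum>i. \<gamma> i \<omega> * w i\<bar>} \<le> (\<Sum>i. (w i)\<^sup>2) / l\<^sup>2"
proof -
  have "AE \<omega> in M. l < \<bar>\<Sum>i. \<gamma> i \<omega> * w i\<bar> \<longrightarrow> (\<exists>k\<ge>0. l \<le> \<bar>\<Sum>i=0..<k. \<gamma> i \<omega> * w i\<bar>)"
    using AE_summable[OF w]
  proof eventually_elim
    case (elim \<omega>)
    then have "(\<lambda>k. \<bar>\<Sum>i<k. \<gamma> i \<omega> * w i\<bar>) \<longlonglongrightarrow> \<bar>\<Sum>i. \<gamma> i \<omega> * w i\<bar>"
      by (intro tendsto_rabs summable_LIMSEQ)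
    then show ?case
      by (auto simp: atLeast0LessThan dest!: order_tendstoD(1) eventually_happens intro: less_imp_le)
  qed
  then have "prob {\<omega>\<in>space M. l < \<bar>\<Sum>i. \<gamma> i \<omega> * w i\<bar>} \<le> prob {\<omega>\<in>space M. \<exists>k\<ge>0. l \<le> \<bar>\<Sum>i=0..<k. \<gamma> i \<omega> * w i\<bar>}"
    by (intro finite_measure_mono_AE) auto
  also have "\<dots> \<le> (\<Sum>i. (w i)\<^sup>2) / l\<^sup>2" using maximal_tail[OF w l, of 0] by simp
  finally show ?thesis .
qed

end

text \<open>Convergence forces \<open>min 1 (a i)\<close> to tend to 0, so the truncation is
  inactive from some index on.\<close>

lemma summable_of_suminf_min_one:
  fixes a :: "nat \<Rightarrow> real"
  assumes a: "\<And>i. 0 \<le> a i" and fin: "(\<Sum>i. ennreal (min 1 (a i))) < \<infinity>"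
  shows "summable a"
proof -
  have s: "summable (\<lambda>i. min 1 (a i))"
    using fin a by (intro summable_suminf_not_top) auto
  have "eventually (\<lambda>i. min 1 (a i) < 1) sequentially"
    using summable_LIMSEQ_zero[OF s] by (rule order_tendstoD) simp
  then have "eventually (\<lambda>i. min 1 (a i) = a i) sequentially"
    by eventually_elim auto
  from summable_cong[OF this] s show ?thesis by simp
qed

context rademacher
begin

lemma AE_summable_min:
  assumes "(\<Sum>i. ennreal (min 1 ((w i)\<^sup>2))) < \<infinity>"
  shows "AE \<omega> in M. summable (\<lambda>i. \<gamma> i \<omega> * w i)"
  by (rule AE_summable[OF summable_of_suminf_min_one[OF _ assms]]) auto

text \<open>No random variable is truncated: either the right side is at least 1 and the bound is
  trivial, or every term is below 1, the minimum does nothing, and the bound is the second moment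
  estimate. This form stays finite after averaging over heavy-tailed weights.\<close>

lemma suminf_tail_min:
  assumes l: "0 < l"
  shows "emeasure M {\<omega>\<in>space M. l < \<bar>\<Sum>i. \<gamma> i \<omega> * w i\<bar>} \<le> (\<Sum>i. ennreal (min 1 ((w i)\<^sup>2 / l\<^sup>2)))"
proof (cases "(\<Sum>i. ennreal (min 1 ((w i)\<^sup>2 / l\<^sup>2))) \<ge> 1")
  case True
  then show ?thesis by (rule order_trans[OF measure_le_1])
next
  case False
  then have s: "summable (\<lambda>i. (w i)\<^sup>2 / l\<^sup>2)"
    by (intro summable_of_suminf_min_one) (auto simp: not_le elim: less_trans)
  then have s': "summable (\<lambda>i. (w i)\<^sup>2)" using l by (simp add: summable_divide_iff)
  have "(w i)\<^sup>2 / l\<^sup>2 < 1" for i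
  proof (rule ccontr)
    assume "\<not> (w i)\<^sup>2 / l\<^sup>2 < 1"
    then have "ennreal (min 1 ((w i)\<^sup>2 / l\<^sup>2)) = 1" by (simp add: min_def)
    moreover have "sum f {i} \<le> suminf f" for f :: "nat \<Rightarrow> ennreal"
      by (rule sum_le_suminf) auto
    ultimately have "1 \<le> (\<Sum>i. ennreal (min 1 ((w i)\<^sup>2 / l\<^sup>2)))"
      by (metis (no_types, lifting) sum.empty sum.insert add.right_neutral empty_iff finite.emptyI)
    then show False using False by blast
  qed
  then have eq: "min 1 ((w i)\<^sup>2 / l\<^sup>2) = (w i)\<^sup>2 / l\<^sup>2" for i by (simp add: less_imp_le min_absorb2)
  have "emeasure M {\<omega>\<in>space M. l < \<bar>\<Sum>i. \<gamma> i \<omega> * w i\<bar>} \<le> ennreal ((\<Sum>i. (w i)\<^sup>2) / l\<^sup>2)"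
    unfolding emeasure_eq_measure by (rule ennreal_leI[OF suminf_tail[OF s' l]])
  also have "(\<Sum>i. (w i)\<^sup>2) / l\<^sup>2 = (\<Sum>i. (w i)\<^sup>2 / l\<^sup>2)" by (rule suminf_divide[OF s', symmetric])
  also have "ennreal \<dots> = (\<Sum>i. ennreal ((w i)\<^sup>2 / l\<^sup>2))"
    using s by (intro suminf_ennreal2[symmetric]) auto
  finally show ?thesis by (simp add: eq)
qed

end

section \<open>LePage series\<close>

lemma seq_eventsI: "A \<in> sets N \<Longrightarrow> S i -` A \<inter> space M \<in> seq_events M N S"
  unfolding seq_events_def by (rule sigma_sets.Basic) blast

lemma pred_summable[measurable (raw)]:
  fixes f :: "nat \<Rightarrow> 'a \<Rightarrow> real"
  assumes [measurable]: "\<And>i. f i \<in> borel_measurable M"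
  shows "Measurable.pred M (\<lambda>x. summable (\<lambda>i. f i x))"
  unfolding summable_iff_convergent Cauchy_convergent_iff[symmetric] pred_def
  by (rule sets_Collect_Cauchy) measurable

context rademacher
begin

text \<open>Conditioning on the weights without conditional expectations: independence makes the
  joint law of the weight and sign sequences a product, so the probability of a jointly measurable
  event is the average over its sections.\<close>

lemma emeasure_fubini_signs:
  assumes [measurable]: "\<And>i. random_variable borel (W i)"
    and ind: "indep_var (PiM UNIV (\<lambda>_. borel)) (\<lambda>\<omega> i. W i \<omega>) (PiM UNIV (\<lambda>_. borel)) (\<lambda>\<omega> i. \<gamma> i \<omega>)"
    and Q[measurable]: "Measurable.pred (PiM UNIV (\<lambda>_. borel) \<Otimes>\<^sub>M PiM UNIV (\<lambda>_. borel))
       (\<lambda>p. Q (fst p :: nat \<Rightarrow> real) (snd p :: nat \<Rightarrow> real))"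
  shows "emeasure M {\<omega>\<in>space M. Q (\<lambda>i. W i \<omega>) (\<lambda>i. \<gamma> i \<omega>)} =
    (\<integral>\<^sup>+\<omega>. emeasure M {\<omega>'\<in>space M. Q (\<lambda>i. W i \<omega>) (\<lambda>i. \<gamma> i \<omega>')} \<partial>M)"
proof -
  let ?P = "PiM UNIV (\<lambda>_. borel) :: (nat \<Rightarrow> real) measure"
  let ?W = "\<lambda>\<omega> i. W i \<omega>" and ?G = "\<lambda>\<omega> i. \<gamma> i \<omega>"
  let ?A = "{p\<in>space (?P \<Otimes>\<^sub>M ?P). Q (fst p) (snd p)}"
  have W[measurable]: "?W \<in> measurable M ?P" and G[measurable]: "?G \<in> measurable M ?P"
    using ind by (auto simp: indep_var_distribution_eq)
  interpret N: prob_space "distr M ?P ?G" by (rule prob_space_distr) simp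
  have eq: "distr M ?P ?W \<Otimes>\<^sub>M distr M ?P ?G = distr M (?P \<Otimes>\<^sub>M ?P) (\<lambda>x. (?W x, ?G x))"
    using ind by (simp add: indep_var_distribution_eq)
  have A: "?A \<in> sets (?P \<Otimes>\<^sub>M ?P)" using Q unfolding pred_def .
  have "emeasure M {\<omega>\<in>space M. Q (?W \<omega>) (?G \<omega>)} = emeasure (distr M (?P \<Otimes>\<^sub>M ?P) (\<lambda>x. (?W x, ?G x))) ?A"
    by (subst emeasure_distr[OF _ A]) (auto intro!: arg_cong[where f="emeasure M"] simp: space_pair_measure space_PiM)
  also have "\<dots> = emeasure (distr M ?P ?W \<Otimes>\<^sub>M distr M ?P ?G) ?A" by (simp add: eq)
  also have "\<dots> = (\<integral>\<^sup>+w. emeasure (distr M ?P ?G) (Pair w -` ?A) \<partial>distr M ?P ?W)"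
    by (rule N.emeasure_pair_measure_alt) (use A in \<open>simp cong: sets_pair_measure_cong\<close>)
  also have "\<dots> = (\<integral>\<^sup>+\<omega>. emeasure (distr M ?P ?G) (Pair (?W \<omega>) -` ?A) \<partial>M)"
    by (rule nn_integral_distr[OF W]) (use N.measurable_emeasure_Pair[of ?A ?P] A in \<open>simp cong: sets_pair_measure_cong\<close>)
  also have "\<dots> = (\<integral>\<^sup>+\<omega>. emeasure M {\<omega>'\<in>space M. Q (?W \<omega>) (?G \<omega>')} \<partial>M)"
  proof (rule nn_integral_cong)
    fix \<omega> assume "\<omega> \<in> space M"
    have "Pair (?W \<omega>) -` ?A \<in> sets ?P" by (rule sets_Pair1[OF A])
    then show "emeasure (distr M ?P ?G) (Pair (?W \<omega>) -` ?A) = emeasure M {\<omega>'\<in>space M. Q (?W \<omega>) (?G \<omega>')}"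
      by (subst emeasure_distr) (auto intro!: arg_cong[where f="emeasure M"] simp: space_pair_measure space_PiM)
  qed
  finally show ?thesis .
qed

context
  fixes W :: "nat \<Rightarrow> 'a \<Rightarrow> real"
  assumes W[measurable]: "\<And>i. random_variable borel (W i)"
    and ind: "indep_var (PiM UNIV (\<lambda>_. borel)) (\<lambda>\<omega> i. W i \<omega>) (PiM UNIV (\<lambda>_. borel)) (\<lambda>\<omega> i. \<gamma> i \<omega>)"
begin

lemma measurable_coordinates[measurable]:
  "(\<lambda>p. fst p i) \<in> borel_measurable (PiM UNIV (\<lambda>_. borel :: real measure) \<Otimes>\<^sub>M PiM UNIV (\<lambda>_. borel :: real measure))"
  "(\<lambda>p. snd p i) \<in> borel_measurable (PiM UNIV (\<lambda>_. borel :: real measure) \<Otimes>\<^sub>M PiM UNIV (\<lambda>_. borel :: real measure))"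
  by (rule measurable_compose[OF measurable_fst measurable_component_singleton], simp)
     (rule measurable_compose[OF measurable_snd measurable_component_singleton], simp)

text \<open>For almost every fixed weight sequence the truncated sum of squares is finite, so the
  corresponding section of the divergence event is null.\<close>

lemma AE_summable_random_weights:
  assumes fin: "(\<integral>\<^sup>+\<omega>. (\<Sum>i. ennreal (min 1 ((W i \<omega>)\<^sup>2))) \<partial>M) < \<infinity>"
  shows "AE \<omega> in M. summable (\<lambda>i. \<gamma> i \<omega> * W i \<omega>)"
proof -
  let ?e = "emeasure M {\<omega>\<in>space M. \<not> summable (\<lambda>i. \<gamma> i \<omega> * W i \<omega>)}"
  have "?e =
    (\<integral>\<^sup>+\<omega>. emeasure M {\<omega>'\<in>space M. \<not> summable (\<lambda>i. \<gamma> i \<omega>' * W i \<omega>)} \<partial>M)"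
    by (rule emeasure_fubini_signs[OF W ind, of "\<lambda>w z. \<not> summable (\<lambda>i. z i * w i)"])
       (intro pred_intros_logic pred_summable borel_measurable_times measurable_coordinates)
  also have "\<dots> = (\<integral>\<^sup>+\<omega>. 0 \<partial>M)"
  proof (rule nn_integral_cong_AE)
    have "AE \<omega> in M. (\<Sum>i. ennreal (min 1 ((W i \<omega>)\<^sup>2))) \<noteq> \<infinity>"
      using fin by (intro nn_integral_PInf_AE) auto
    then show "AE \<omega> in M. emeasure M {\<omega>'\<in>space M. \<not> summable (\<lambda>i. \<gamma> i \<omega>' * W i \<omega>)} = 0"
    proof eventually_elim
      case (elim \<omega>)
      have [measurable]: "Measurable.pred M (\<lambda>\<omega>'. summable (\<lambda>i. \<gamma> i \<omega>' * W i \<omega>))"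
        by measurable
      have "AE \<omega>' in M. summable (\<lambda>i. \<gamma> i \<omega>' * W i \<omega>)"
        using elim by (intro AE_summable_min) (auto simp: less_top)
      then show ?case
        by (subst (asm) AE_iff_measurable[OF _ refl]) auto
    qed
  qed
  finally have "?e = 0" by simp
  moreover have [measurable]: "Measurable.pred M (\<lambda>\<omega>. summable (\<lambda>i. \<gamma> i \<omega> * W i \<omega>))"
    by measurable
  ultimately show ?thesis
    by (subst AE_iff_measurable[OF _ refl]) auto
qed

lemma suminf_tail_random_weights:
  assumes l: "0 < l"
  shows "emeasure M {\<omega>\<in>space M. l < \<bar>\<Sum>i. \<gamma> i \<omega> * W i \<omega>\<bar>} \<le>
    (\<integral>\<^sup>+\<omega>. (\<Sum>i. ennreal (min 1 ((W i \<omega>)\<^sup>2 / l\<^sup>2))) \<partial>M)"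
proof -
  have "emeasure M {\<omega>\<in>space M. l < \<bar>\<Sum>i. \<gamma> i \<omega> * W i \<omega>\<bar>} =
    (\<integral>\<^sup>+\<omega>. emeasure M {\<omega>'\<in>space M. l < \<bar>\<Sum>i. \<gamma> i \<omega>' * W i \<omega>\<bar>} \<partial>M)"
    by (rule emeasure_fubini_signs[OF W ind, of "\<lambda>w z. l < \<bar>\<Sum>i. z i * w i\<bar>"]) measurable
  also have "\<dots> \<le> (\<integral>\<^sup>+\<omega>. (\<Sum>i. ennreal (min 1 ((W i \<omega>)\<^sup>2 / l\<^sup>2))) \<partial>M)"
    by (intro nn_integral_mono suminf_tail_min[OF l])
  finally show ?thesis .
qed

end
end

section \<open>Poisson arrivals, marks and Campbell's formula\<close>

locale lepage =
  fixes M :: "'w measure" and mhat :: "'e measure"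
    and \<Gamma> :: "nat \<Rightarrow> 'w \<Rightarrow> real" and V :: "nat \<Rightarrow> 'w \<Rightarrow> 'e" and \<gamma> :: "nat \<Rightarrow> 'w \<Rightarrow> real"
  assumes inputs: "lepage_inputs M mhat \<Gamma> V \<gamma>"

sublocale lepage \<subseteq> prob_space M
  using inputs by (simp add: lepage_inputs_def)

sublocale lepage \<subseteq> rademacher M \<gamma>
  using inputs by unfold_locales (simp_all add: lepage_inputs_def iid_signs_def)

context lepage
begin

lemma measurable_V[measurable]: "V i \<in> measurable M mhat"
  and distr_V: "distr M mhat (V i) = mhat"
  using inputs by (auto simp: lepage_inputs_def iid_with_law_def indep_vars_def)

lemma prob_space_mhat: "prob_space mhat"
  using prob_space_distr[OF measurable_V[of 0]] by (simp add: distr_V)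

lemma arrival_distributed: "distributed M lborel (\<Gamma> i) (\<lambda>x. ennreal (erlang_density i 1 x))"
proof -
  define gap where "gap i \<omega> = \<Gamma> i \<omega> - (if i = 0 then 0 else \<Gamma> (i - 1) \<omega>)" for i \<omega>
  have gap: "indep_vars (\<lambda>_. borel) gap UNIV"
      "\<And>i. distributed M lborel (gap i) (\<lambda>x. ennreal (exponential_density 1 x))"
    using inputs unfolding lepage_inputs_def unit_poisson_arrivals_def Let_def gap_def[abs_def] by auto
  \<comment> \<open>The gaps up to index \<open>i\<close> are \<open>i + 1\<close> exponential
    variables whose sum telescopes to \<open>\<Gamma> i\<close>, so the Erlang shape index is
    \<open>card {..i} - 1 = i\<close>.\<close>
  have "distributed M lborel (\<lambda>\<omega>. \<Sum>j\<in>{..i}. gap j \<omega>) (erlang_density (card {..i} - 1) 1)"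
    by (rule exponential_distributed_sum[OF _ _ _ gap(2) indep_vars_subset[OF gap(1)]]) auto
  moreover have "(\<Sum>j\<in>{..i}. gap j \<omega>) = \<Gamma> i \<omega>" for \<omega>
    by (induction i) (auto simp: gap_def)
  ultimately show ?thesis by simp
qed

lemma measurable_arrival[measurable]: "random_variable borel (\<Gamma> i)"
  using distributed_measurable[OF arrival_distributed[of i]] by simp

abbreviation "input_events k \<equiv> [seq_events M borel \<Gamma>, seq_events M mhat V, seq_events M borel \<gamma>] ! k"

lemma indep_events: "indep_sets input_events {..<3}"
  using inputs by (simp add: lepage_inputs_def)

text \<open>\<open>indep_var\<close> requires both variables to have the same type, hence the statement via the joint law.\<close>

lemma distr_arrival_mark:
  "distr M (borel \<Otimes>\<^sub>M mhat) (\<lambda>\<omega>. (\<Gamma> i \<omega>, V i \<omega>)) = distr M borel (\<Gamma> i) \<Otimes>\<^sub>M mhat"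
proof -
  interpret mh: prob_space mhat by (rule prob_space_mhat)
  interpret D: prob_space "distr M borel (\<Gamma> i)" by (rule prob_space_distr) simp
  show ?thesis
  proof (rule pair_measure_eqI[symmetric])
    fix A B assume A: "A \<in> sets (distr M borel (\<Gamma> i))" and B: "B \<in> sets mhat"
    have [measurable]: "A \<in> sets borel" "B \<in> sets mhat" using A B by auto
    let ?a = "\<Gamma> i -` A \<inter> space M" and ?b = "V i -` B \<inter> space M"
    have "?a \<in> input_events 0" using seq_eventsI[of A borel] by simp
    moreover have "?b \<in> input_events 1" using B seq_eventsI[of B mhat] by simp
    ultimately have ab: "prob (?a \<inter> ?b) = prob ?a * prob ?b"
      using indep_setsD[OF indep_events, of "{0,1}" "\<lambda>k. if k = 0 then ?a else ?b"] by (auto simp: Int_ac)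
    have "emeasure (distr M borel (\<Gamma> i)) A * emeasure mhat B = emeasure M ?a * emeasure (distr M mhat (V i)) B"
      by (simp add: emeasure_distr distr_V)
    also have "\<dots> = emeasure M ?a * emeasure M ?b" by (simp add: emeasure_distr)
    also have "\<dots> = emeasure M (?a \<inter> ?b)"
      by (simp add: emeasure_eq_measure ab ennreal_mult)
    also have "?a \<inter> ?b = (\<lambda>\<omega>. (\<Gamma> i \<omega>, V i \<omega>)) -` (A \<times> B) \<inter> space M" by auto
    finally show "emeasure (distr M borel (\<Gamma> i)) A * emeasure mhat B =
        emeasure (distr M (borel \<Otimes>\<^sub>M mhat) (\<lambda>\<omega>. (\<Gamma> i \<omega>, V i \<omega>))) (A \<times> B)"
      by (simp add: emeasure_distr)
  qed (auto cong: sets_pair_measure_cong intro: D.sigma_finite_measure_axioms mh.sigma_finite_measure_axioms)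
qed

lemma nn_integral_arrival_mark:
  assumes F[measurable]: "F \<in> borel_measurable (borel \<Otimes>\<^sub>M mhat)"
  shows "(\<integral>\<^sup>+\<omega>. F (\<Gamma> i \<omega>, V i \<omega>) \<partial>M) = (\<integral>\<^sup>+v. \<integral>\<^sup>+x. ennreal (erlang_density i 1 x) * F (x, v) \<partial>lborel \<partial>mhat)"
proof -
  interpret mh: prob_space mhat by (rule prob_space_mhat)
  let ?D = "density lborel (\<lambda>x. ennreal (erlang_density i 1 x))"
  have D: "distr M lborel (\<Gamma> i) = ?D" by (rule distributed_distr_eq_density[OF arrival_distributed])
  have D': "distr M borel (\<Gamma> i) = ?D" unfolding D[symmetric] by (rule distr_cong) auto
  interpret D: prob_space ?D
    unfolding D[symmetric] by (rule prob_space_distr) simp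
  interpret P: pair_sigma_finite ?D mhat ..
  interpret P2: pair_sigma_finite lborel mhat ..
  have F': "F \<in> borel_measurable (?D \<Otimes>\<^sub>M mhat)"
    using F by (subst measurable_cong_sets[of _ "borel \<Otimes>\<^sub>M mhat"]) (auto cong: sets_pair_measure_cong)
  have "(\<integral>\<^sup>+\<omega>. F (\<Gamma> i \<omega>, V i \<omega>) \<partial>M) = (\<integral>\<^sup>+p. F p \<partial>distr M (borel \<Otimes>\<^sub>M mhat) (\<lambda>\<omega>. (\<Gamma> i \<omega>, V i \<omega>)))"
    by (subst nn_integral_distr) auto
  also have "distr M (borel \<Otimes>\<^sub>M mhat) (\<lambda>\<omega>. (\<Gamma> i \<omega>, V i \<omega>)) = ?D \<Otimes>\<^sub>M mhat"
    by (simp add: distr_arrival_mark D')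
  also have "(\<integral>\<^sup>+p. F p \<partial>(?D \<Otimes>\<^sub>M mhat)) = (\<integral>\<^sup>+v. \<integral>\<^sup>+x. F (x, v) \<partial>?D \<partial>mhat)"
    using P.nn_integral_snd[of "\<lambda>(x,y). F (x,y)"] F' by simp
  also have "\<dots> = (\<integral>\<^sup>+v. \<integral>\<^sup>+x. ennreal (erlang_density i 1 x) * F (x, v) \<partial>lborel \<partial>mhat)"
    by (intro nn_integral_cong nn_integral_density) (auto)
  finally show ?thesis .
qed

text \<open>The densities \<open>x ^ i / fact i * exp (-x)\<close> are Poisson weights and sum to 1:
  the arrival times have Lebesgue measure on the half-line as intensity.\<close>

lemma suminf_erlang_density: "(\<Sum>i. ennreal (erlang_density i 1 x)) = indicator {0..} x"
proof (cases "x < 0")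
  case False
  have "(\<lambda>i. x ^ i /\<^sub>R fact i) sums exp x" by (rule exp_converges)
  then have "(\<lambda>i. x ^ i / fact i * exp (-x)) sums (exp x * exp (-x))"
    by (intro sums_mult2) (simp add: field_simps)
  then have "(\<lambda>i. erlang_density i 1 x) sums 1"
    using False by (simp add: erlang_density_def exp_minus_inverse)
  then show ?thesis
    using False by (subst suminf_ennreal2) (auto simp: sums_iff)
qed (simp add: erlang_density_def)

text \<open>The expectation of a sum involves only the law of each single pair
  \<open>(\<Gamma> i, V i)\<close>; adding up these one-point laws gives the intensity.\<close>

lemma campbell:
  assumes F[measurable]: "F \<in> borel_measurable (borel \<Otimes>\<^sub>M mhat)"
  shows "(\<integral>\<^sup>+\<omega>. (\<Sum>i. F (\<Gamma> i \<omega>, V i \<omega>)) \<partial>M) = (\<integral>\<^sup>+v. \<integral>\<^sup>+x. indicator {0..} x * F (x, v) \<partial>lborel \<partial>mhat)"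
proof -
  interpret P2: sigma_finite_measure lborel by (rule sigma_finite_lborel)
  interpret mh: prob_space mhat by (rule prob_space_mhat)
  interpret P2: pair_sigma_finite mhat lborel ..
  have m: "(\<lambda>v. \<integral>\<^sup>+x. ennreal (erlang_density i 1 x) * F (x, v) \<partial>lborel) \<in> borel_measurable mhat" for i
    by measurable
  have "(\<integral>\<^sup>+\<omega>. (\<Sum>i. F (\<Gamma> i \<omega>, V i \<omega>)) \<partial>M) = (\<Sum>i. \<integral>\<^sup>+\<omega>. F (\<Gamma> i \<omega>, V i \<omega>) \<partial>M)"
    by (rule nn_integral_suminf) measurable
  also have "\<dots> = (\<integral>\<^sup>+v. (\<Sum>i. \<integral>\<^sup>+x. ennreal (erlang_density i 1 x) * F (x, v) \<partial>lborel) \<partial>mhat)"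
    unfolding nn_integral_arrival_mark[OF F] using m by (rule nn_integral_suminf[symmetric])
  also have "\<dots> = (\<integral>\<^sup>+v. \<integral>\<^sup>+x. (\<Sum>i. ennreal (erlang_density i 1 x) * F (x, v)) \<partial>lborel \<partial>mhat)"
    by (intro nn_integral_cong nn_integral_suminf[symmetric]) auto
  also have "\<dots> = (\<integral>\<^sup>+v. \<integral>\<^sup>+x. indicator {0..} x * F (x, v) \<partial>lborel \<partial>mhat)"
    by (simp add: ennreal_suminf_multc suminf_erlang_density)
  finally show ?thesis .
qed

text \<open>The three independent \<sigma>-algebras are grouped two against one. Independence passes
  to the weight sequence because it is measurable for the \<sigma>-algebra generated by arrivals and
  marks together.\<close>

lemma indep_var_weights_signs:
  assumes T[measurable]: "T \<in> borel_measurable (borel \<Otimes>\<^sub>M mhat)"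
  shows "indep_var (PiM UNIV (\<lambda>_. borel)) (\<lambda>\<omega> i. T (\<Gamma> i \<omega>, V i \<omega>) :: real) (PiM UNIV (\<lambda>_. borel)) (\<lambda>\<omega> i. \<gamma> i \<omega>)"
proof -
  let ?I = "case_bool {0,1} {2::nat}"
  let ?S = "\<lambda>j. sigma_sets (space M) (\<Union>i\<in>?I j. input_events i)"
  let ?P = "PiM UNIV (\<lambda>_. borel) :: (nat \<Rightarrow> real) measure"
  have sub: "input_events k \<subseteq> Pow (space M)" if "k < 3" for k
  proof -
    have "input_events k \<subseteq> events" using indep_events that unfolding indep_sets_def by blast
    then show ?thesis using sets.space_closed by blast
  qed
  have "indep_sets ?S UNIV"
  proof (rule indep_sets_collect_sigma)
    show "indep_sets input_events (\<Union>j\<in>UNIV. ?I j)"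
      by (rule indep_sets_mono_index[OF _ indep_events]) (auto split: bool.splits)
    show "disjoint_family_on ?I UNIV"
      by (auto simp: disjoint_family_on_def split: bool.splits)
    have st: "Int_stable (sigma_sets (space M) A)" if "A \<subseteq> Pow (space M)" for A
    proof -
      interpret sigma_algebra "space M" "sigma_sets (space M) A" by (rule sigma_algebra_sigma_sets[OF that])
      show ?thesis by (auto simp: Int_stable_def)
    qed
    have "Int_stable (input_events 0)" "Int_stable (input_events 1)" "Int_stable (input_events 2)"
      unfolding seq_events_def by (auto intro!: st)
    then show "Int_stable (input_events i)" if "i \<in> ?I j" for i j
      using that by (auto split: bool.splits)
  qed
  moreover have "?S = case_bool (?S True) (?S False)"
    by (auto simp: fun_eq_iff split: bool.splits)
  ultimately have ind: "indep_set (?S True) (?S False)"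
    unfolding indep_set_def by metis
  \<comment> \<open>\<open>MG\<close> and \<open>MS\<close> carry the space of \<open>M\<close> with
    only the events of one group each, so measurability of the two sequences turns into inclusion of
    the \<sigma>-algebras that they generate.\<close>
  define MG where "MG = sigma (space M) (\<Union>i\<in>?I True. input_events i)"
  define MS where "MS = sigma (space M) (\<Union>i\<in>?I False. input_events i)"
  have sp: "(\<Union>i\<in>?I True. input_events i) \<subseteq> Pow (space M)" "(\<Union>i\<in>?I False. input_events i) \<subseteq> Pow (space M)"
    using sub[of 0] sub[of 1] sub[of 2] by auto
  have MG: "sets MG = ?S True" "space MG = space M" and MS: "sets MS = ?S False" "space MS = space M"
    using sp by (auto simp: MG_def MS_def)
  have [measurable]: "\<Gamma> i \<in> borel_measurable MG" for i
  proof (rule measurableI)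
    fix A :: "real set" assume "A \<in> sets borel"
    then have "\<Gamma> i -` A \<inter> space M \<in> input_events 0" using seq_eventsI[of A borel] by simp
    then show "\<Gamma> i -` A \<inter> space MG \<in> sets MG" unfolding MG by (intro sigma_sets.Basic) auto
  qed auto
  have [measurable]: "V i \<in> measurable MG mhat" for i
  proof (rule measurableI)
    fix A assume "A \<in> sets mhat"
    then have "V i -` A \<inter> space M \<in> input_events 1" using seq_eventsI[of A mhat] by simp
    then show "V i -` A \<inter> space MG \<in> sets MG" unfolding MG by (intro sigma_sets.Basic) auto
  qed (use measurable_space[OF measurable_V] MG in auto)
  have [measurable]: "\<gamma> i \<in> borel_measurable MS" for i
  proof (rule measurableI)
    fix A :: "real set" assume "A \<in> sets borel"
    then have "\<gamma> i -` A \<inter> space M \<in> input_events 2" using seq_eventsI[of A borel] by (simp add: numeral_2_eq_2)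
    then show "\<gamma> i -` A \<inter> space MS \<in> sets MS" unfolding MS by (intro sigma_sets.Basic) auto
  qed auto
  let ?W = "\<lambda>\<omega> i. T (\<Gamma> i \<omega>, V i \<omega>)" and ?G = "\<lambda>\<omega> i. \<gamma> i \<omega>"
  have W: "?W \<in> measurable MG ?P" and G: "?G \<in> measurable MS ?P"
    by (rule measurable_PiM_single'; auto)+
  have W': "?W \<in> measurable M ?P" and G': "?G \<in> measurable M ?P"
    by (rule measurable_PiM_single'; auto)+
  have 1: "sigma_sets (space M) {?W -` A \<inter> space M |A. A \<in> sets ?P} \<subseteq> ?S True"
  proof -
    have "sigma_sets (space M) {?W -` A \<inter> space M |A. A \<in> sets ?P} \<subseteq> sets MG"
      using sets.sigma_sets_subset[of "{?W -` A \<inter> space M |A. A \<in> sets ?P}" MG] measurable_sets[OF W] MG(2)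
      by auto
    then show ?thesis unfolding MG .
  qed
  have 2: "sigma_sets (space M) {?G -` A \<inter> space M |A. A \<in> sets ?P} \<subseteq> ?S False"
  proof -
    have "sigma_sets (space M) {?G -` A \<inter> space M |A. A \<in> sets ?P} \<subseteq> sets MS"
      using sets.sigma_sets_subset[of "{?G -` A \<inter> space M |A. A \<in> sets ?P}" MS] measurable_sets[OF G] MS(2)
      by auto
    then show ?thesis unfolding MS .
  qed
  have "indep_set (sigma_sets (space M) {?W -` A \<inter> space M |A. A \<in> sets ?P})
      (sigma_sets (space M) {?G -` A \<inter> space M |A. A \<in> sets ?P})"
    unfolding indep_set_def
  proof (rule indep_sets_mono_sets[OF ind[unfolded indep_set_def]])
    fix j :: bool
    show "case_bool (sigma_sets (space M) {?W -` A \<inter> space M |A. A \<in> sets ?P})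
       (sigma_sets (space M) {?G -` A \<inter> space M |A. A \<in> sets ?P}) j \<subseteq> case_bool (?S True) (?S False) j"
      using 1 2 by (cases j) (simp_all only: bool.case)
  qed
  with W' G' show ?thesis unfolding indep_var_eq by (intro conjI)
qed

definition "series T \<omega> = (\<Sum>i. \<gamma> i \<omega> * T (\<Gamma> i \<omega>, V i \<omega>))"

context
  fixes T :: "real \<times> 'e \<Rightarrow> real"
  assumes T[measurable]: "T \<in> borel_measurable (borel \<Otimes>\<^sub>M mhat)"
begin

lemma measurable_series: "random_variable borel (series T)"
  unfolding series_def[abs_def] by measurable

lemma AE_summable_series:
  assumes "(\<integral>\<^sup>+v. \<integral>\<^sup>+x. indicator {0..} x * ennreal (min 1 ((T (x, v))\<^sup>2)) \<partial>lborel \<partial>mhat) < \<infinity>"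
  shows "AE \<omega> in M. summable (\<lambda>i. \<gamma> i \<omega> * T (\<Gamma> i \<omega>, V i \<omega>))"
proof (rule AE_summable_random_weights[OF _ indep_var_weights_signs[OF T]])
  show "random_variable borel (\<lambda>\<omega>. T (\<Gamma> i \<omega>, V i \<omega>))" for i by measurable
  have "(\<integral>\<^sup>+\<omega>. (\<Sum>i. ennreal (min 1 ((T (\<Gamma> i \<omega>, V i \<omega>))\<^sup>2))) \<partial>M) =
      (\<integral>\<^sup>+v. \<integral>\<^sup>+x. indicator {0..} x * ennreal (min 1 ((T (x, v))\<^sup>2)) \<partial>lborel \<partial>mhat)"
    by (rule campbell[of "\<lambda>p. ennreal (min 1 ((T p)\<^sup>2))"]) measurable
  with assms show "(\<integral>\<^sup>+\<omega>. (\<Sum>i. ennreal (min 1 ((T (\<Gamma> i \<omega>, V i \<omega>))\<^sup>2))) \<partial>M) < \<infinity>"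
    by argo
qed

lemma series_tail:
  assumes "0 < l"
  shows "emeasure M {\<omega>\<in>space M. l < \<bar>series T \<omega>\<bar>} \<le>
    (\<integral>\<^sup>+v. \<integral>\<^sup>+x. indicator {0..} x * ennreal (min 1 ((T (x, v))\<^sup>2 / l\<^sup>2)) \<partial>lborel \<partial>mhat)"
proof -
  have "emeasure M {\<omega>\<in>space M. l < \<bar>\<Sum>i. \<gamma> i \<omega> * T (\<Gamma> i \<omega>, V i \<omega>)\<bar>} \<le>
    (\<integral>\<^sup>+\<omega>. (\<Sum>i. ennreal (min 1 ((T (\<Gamma> i \<omega>, V i \<omega>))\<^sup>2 / l\<^sup>2))) \<partial>M)"
    by (rule suminf_tail_random_weights[OF _ indep_var_weights_signs[OF T] assms]) measurable
  also have "\<dots> = (\<integral>\<^sup>+v. \<integral>\<^sup>+x. indicator {0..} x * ennreal (min 1 ((T (x, v))\<^sup>2 / l\<^sup>2)) \<partial>lborel \<partial>mhat)"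
    by (rule campbell[of "\<lambda>p. ennreal (min 1 ((T p)\<^sup>2 / l\<^sup>2))"]) measurable
  finally show ?thesis unfolding series_def .
qed

end
end

section \<open>Tail bounds and convergence of moments\<close>

text \<open>The crossover point is \<open>z = K powr (1 / \<beta>)\<close>, where
  \<open>K * x powr (-\<beta>) = 1\<close>. The part below \<open>z\<close> contributes at most
  \<open>z\<close>; beyond it the square integrates to \<open>z / (2 * \<beta> - 1)\<close>, finite
  since \<open>2 * \<beta> > 1\<close>.\<close>

lemma nn_integral_min_power_le:
  assumes \<beta>: "1/2 < \<beta>" and K: "0 \<le> K"
  shows "(\<integral>\<^sup>+x. indicator {0..} x * ennreal (min 1 ((K * x powr (-\<beta>))\<^sup>2)) \<partial>lborel)
     \<le> ennreal (2 * \<beta> / (2 * \<beta> - 1) * K powr (1 / \<beta>))"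
proof (cases "K = 0")
  case False
  then have K: "0 < K" using K by simp
  define z where "z = K powr (1 / \<beta>)"
  have z: "0 < z" using K by (simp add: z_def)
  have zK: "z powr (- (2 * \<beta>)) * K\<^sup>2 = 1"
    using K \<beta> by (simp add: z_def powr_powr powr_minus powr_numeral)
  have tail: "(\<integral>\<^sup>+x. indicator {z..} x * ennreal (x powr (- (2 * \<beta>))) \<partial>lborel)
      = ennreal (- (z powr (- (2 * \<beta>) + 1)) / (- (2 * \<beta>) + 1))"
    using nn_integral_has_integral_lebesgue'[OF _ has_integral_powr_to_inf[of "- (2 * \<beta>)" z]] \<beta> z
    by (simp add: mult.commute)
  have "(\<integral>\<^sup>+x. indicator {0..} x * ennreal (min 1 ((K * x powr (-\<beta>))\<^sup>2)) \<partial>lborel)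
    \<le> (\<integral>\<^sup>+x. indicator {0..z} x + ennreal (K\<^sup>2) * (indicator {z..} x * ennreal (x powr (- (2 * \<beta>)))) \<partial>lborel)"
  proof (rule nn_integral_mono)
    fix x :: real
    have *: "(K * x powr (-\<beta>))\<^sup>2 = K\<^sup>2 * x powr (- (2 * \<beta>))" if "x > 0"
      using that by (simp add: power_mult_distrib powr_power)
    show "indicator {0..} x * ennreal (min 1 ((K * x powr (-\<beta>))\<^sup>2)) \<le>
        indicator {0..z} x + ennreal (K\<^sup>2) * (indicator {z..} x * ennreal (x powr (- (2 * \<beta>))))"
    proof -
      have "ennreal (min 1 y) \<le> 1 + u" for y u
        using ennreal_leI[of "min 1 y" 1] by (intro add_increasing2) auto
      then show ?thesis
        using z * by (cases "x \<le> z") (auto simp: indicator_def ennreal_mult[symmetric] intro!: ennreal_leI)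
    qed
  qed
  also have "\<dots> = ennreal z + ennreal (K\<^sup>2) * ennreal (- (z powr (- (2 * \<beta>) + 1)) / (- (2 * \<beta>) + 1))"
    using z by (subst nn_integral_add) (auto simp: nn_integral_cmult tail)
  also have "\<dots> = ennreal (z + K\<^sup>2 * (- (z powr (- (2 * \<beta>) + 1)) / (- (2 * \<beta>) + 1)))"
  proof -
    have nn: "0 \<le> - (z powr (- (2 * \<beta>) + 1)) / (- (2 * \<beta>) + 1)"
      using \<beta> by (intro divide_nonpos_neg) auto
    then have "0 \<le> K\<^sup>2 * (- (z powr (- (2 * \<beta>) + 1)) / (- (2 * \<beta>) + 1))"
      by (intro mult_nonneg_nonneg) auto
    with nn z show ?thesis by (simp only: ennreal_mult[symmetric] ennreal_plus zero_le_power2 less_imp_le)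
  qed
  also have "K\<^sup>2 * (- (z powr (- (2 * \<beta>) + 1)) / (- (2 * \<beta>) + 1)) = z / (2 * \<beta> - 1)"
  proof -
    have "K\<^sup>2 * z powr (- (2 * \<beta>) + 1) = z"
      unfolding powr_add using zK z by (simp add: algebra_simps)
    moreover have "K\<^sup>2 * (- (z powr (- (2 * \<beta>) + 1)) / (- (2 * \<beta>) + 1)) = K\<^sup>2 * z powr (- (2 * \<beta>) + 1) / (2 * \<beta> - 1)"
      using \<beta> by (simp add: field_simps)
    ultimately show ?thesis by simp
  qed
  also have "z + z / (2 * \<beta> - 1) = 2 * \<beta> / (2 * \<beta> - 1) * z"
    using \<beta> by (simp add: field_simps)
  finally show ?thesis by (simp add: z_def)
qed simp

text \<open>Measurability is included because \<open>measure\<close> assigns 0 to nonmeasurable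
  sets, which would make the bound on the tails vacuous.\<close>

definition tail_bounded :: "'a measure \<Rightarrow> ('a \<Rightarrow> real) \<Rightarrow> real \<Rightarrow> real \<Rightarrow> bool" where
  "tail_bounded M R C q \<longleftrightarrow> R \<in> borel_measurable M \<and>
     (\<forall>l>0. measure M {\<omega>\<in>space M. l < \<bar>R \<omega>\<bar>} \<le> C * l powr (-q))"

lemma tail_bounded_nonneg:
  assumes "tail_bounded M R C q"
  shows "0 \<le> C"
  using assms order_trans[OF measure_nonneg] unfolding tail_bounded_def by (force dest: spec[of _ 1])

lemma tail_bounded_measurable: "tail_bounded M R C q \<Longrightarrow> R \<in> borel_measurable M"
  by (simp add: tail_bounded_def)

text \<open>The order may be lowered from \<open>a\<close> to \<open>q\<close>: for
  \<open>l > 1\<close> the power \<open>l powr (-q)\<close> is the larger one, and for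
  \<open>l \<le> 1\<close> it is at least 1, the trivial bound for a probability; hence a constant
  of at least 1. This gives one common order for stability indices that vary with the point.\<close>

lemma tail_boundedI:
  assumes "prob_space M" and [measurable]: "R \<in> borel_measurable M" and "q \<le> a" "0 < q" "0 \<le> C"
    and tail: "\<And>l. 0 < l \<Longrightarrow> emeasure M {\<omega>\<in>space M. l < \<bar>R \<omega>\<bar>} \<le> ennreal (C * l powr (-a))"
  shows "tail_bounded M R (max 1 C) q"
  unfolding tail_bounded_def
proof (intro conjI allI impI)
  fix l :: real assume l: "0 < l"
  interpret prob_space M by fact
  show "prob {\<omega>\<in>space M. l < \<bar>R \<omega>\<bar>} \<le> max 1 C * l powr (-q)"
  proof (cases "l \<le> 1")
    case True
    have "prob {\<omega>\<in>space M. l < \<bar>R \<omega>\<bar>} \<le> 1" by simp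
    also have "1 = 1 * 1 powr (-q)" by simp
    also have "\<dots> \<le> max 1 C * l powr (-q)"
      using True l \<open>0 < q\<close> by (intro mult_mono powr_mono2') auto
    finally show ?thesis .
  next
    case False
    have "prob {\<omega>\<in>space M. l < \<bar>R \<omega>\<bar>} \<le> C * l powr (-a)"
      using tail[OF l] \<open>0 \<le> C\<close> by (simp add: emeasure_eq_measure)
    also have "\<dots> \<le> max 1 C * l powr (-q)"
      using False \<open>q \<le> a\<close> \<open>0 \<le> C\<close> by (intro mult_mono powr_mono) auto
    finally show ?thesis .
  qed
qed fact

lemma tail_bounded_cong_AE:
  assumes "tail_bounded M R C q" and [measurable]: "R' \<in> borel_measurable M"
    and eq: "AE \<omega> in M. R \<omega> = R' \<omega>"
  shows "tail_bounded M R' C q"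
proof -
  have [measurable]: "R \<in> borel_measurable M" using assms by (simp add: tail_bounded_def)
  have "measure M {\<omega>\<in>space M. l < \<bar>R' \<omega>\<bar>} = measure M {\<omega>\<in>space M. l < \<bar>R \<omega>\<bar>}" for l
    using eq by (intro measure_eq_AE) auto
  then show ?thesis using assms by (simp add: tail_bounded_def)
qed

lemma tail_bounded_mono:
  assumes R: "tail_bounded M R C q" and "C \<le> C'"
  shows "tail_bounded M R C' q"
  using assms unfolding tail_bounded_def by (meson mult_right_mono order_trans powr_ge_zero)

lemma tail_bounded_scale:
  assumes R: "tail_bounded M R C q"
  shows "tail_bounded M (\<lambda>\<omega>. k * R \<omega>) (C * \<bar>k\<bar> powr q) q"
  unfolding tail_bounded_def
proof (intro conjI allI impI)
  show "(\<lambda>\<omega>. k * R \<omega>) \<in> borel_measurable M"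
    using tail_bounded_measurable[OF R] by measurable
  fix l :: real assume l: "0 < l"
  show "measure M {\<omega>\<in>space M. l < \<bar>k * R \<omega>\<bar>} \<le> C * \<bar>k\<bar> powr q * l powr (-q)"
  proof (cases "k = 0")
    case False
    have "{\<omega>\<in>space M. l < \<bar>k * R \<omega>\<bar>} = {\<omega>\<in>space M. l / \<bar>k\<bar> < \<bar>R \<omega>\<bar>}"
      using False by (auto simp: abs_mult field_simps)
    then have "measure M {\<omega>\<in>space M. l < \<bar>k * R \<omega>\<bar>} \<le> C * (l / \<bar>k\<bar>) powr (-q)"
      using R l False by (simp add: tail_bounded_def)
    also have "(l / \<bar>k\<bar>) powr (-q) = \<bar>k\<bar> powr q * l powr (-q)"
      using False l by (simp add: powr_divide powr_minus field_simps)
    finally show ?thesis by (simp add: mult_ac)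
  qed (use l in \<open>simp\<close>)
qed

text \<open>One of the two summands must exceed \<open>l / 2\<close> in absolute value; the halved
  level costs the factor \<open>2 powr q\<close>.\<close>

lemma tail_bounded_add:
  assumes "prob_space M" and R: "tail_bounded M R C q" and R': "tail_bounded M R' C' q"
  shows "tail_bounded M (\<lambda>\<omega>. R \<omega> + R' \<omega>) ((C + C') * 2 powr q) q"
  unfolding tail_bounded_def
proof (intro conjI allI impI)
  interpret prob_space M by fact
  note [measurable] = tail_bounded_measurable[OF R] tail_bounded_measurable[OF R']
  show "(\<lambda>\<omega>. R \<omega> + R' \<omega>) \<in> borel_measurable M" by measurable
  fix l :: real assume l: "0 < l"
  have "prob {\<omega>\<in>space M. l < \<bar>R \<omega> + R' \<omega>\<bar>} \<le> prob ({\<omega>\<in>space M. l/2 < \<bar>R \<omega>\<bar>} \<union> {\<omega>\<in>space M. l/2 < \<bar>R' \<omega>\<bar>})"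
    by (intro finite_measure_mono) auto
  also have "\<dots> \<le> prob {\<omega>\<in>space M. l/2 < \<bar>R \<omega>\<bar>} + prob {\<omega>\<in>space M. l/2 < \<bar>R' \<omega>\<bar>}"
    by (intro measure_Un_le) auto
  also have "\<dots> \<le> C * (l/2) powr (-q) + C' * (l/2) powr (-q)"
    using R[unfolded tail_bounded_def, THEN conjunct2, rule_format, of "l/2"]
      R'[unfolded tail_bounded_def, THEN conjunct2, rule_format, of "l/2"] l by (intro add_mono) auto
  also have "\<dots> = (C + C') * 2 powr q * l powr (-q)"
    using l by (simp add: powr_divide powr_minus field_simps)
  finally show "prob {\<omega>\<in>space M. l < \<bar>R \<omega> + R' \<omega>\<bar>} \<le> (C + C') * 2 powr q * l powr (-q)" .
qed

lemma ennreal_le_suminf: "f k \<le> (\<Sum>k. f k :: ennreal)"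
proof -
  have "sum f {k} \<le> (\<Sum>k. f k)" by (rule sum_le_suminf) auto
  then show ?thesis by simp
qed

text \<open>A dyadic layer-cake bound: if \<open>2 ^ k < \<bar>x\<bar> \<le> 2 ^ Suc k\<close>, the
  term with index \<open>k\<close> alone dominates, and the leading 1 covers
  \<open>\<bar>x\<bar> \<le> 1\<close>.\<close>

lemma powr_le_dyadic_sum:
  fixes x p :: real
  assumes "0 < p"
  shows "ennreal (\<bar>x\<bar> powr p) \<le> 1 + (\<Sum>k. ennreal (2 powr (real (Suc k) * p)) * indicator {y. 2 ^ k < \<bar>y\<bar>} x)"
    (is "_ \<le> 1 + (\<Sum>k. ?f k)")
proof (cases "\<bar>x\<bar> \<le> 1")
  case True
  then have "\<bar>x\<bar> powr p \<le> 1 powr p" using assms by (intro powr_mono2) auto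
  then have "ennreal (\<bar>x\<bar> powr p) \<le> 1" by simp
  then show ?thesis by (rule order_trans) simp
next
  case False
  define n where "n = (LEAST n. \<bar>x\<bar> \<le> 2 ^ n)"
  obtain n' where "\<bar>x\<bar> < 2 ^ n'" using real_arch_pow[of 2 "\<bar>x\<bar>"] by auto
  then have n: "\<bar>x\<bar> \<le> 2 ^ n" unfolding n_def by (intro LeastI[of "\<lambda>n. \<bar>x\<bar> \<le> 2 ^ n" n']) auto
  then obtain k where k: "n = Suc k" using False by (cases n) auto
  have k': "2 ^ k < \<bar>x\<bar>"
    using not_less_Least[of k "\<lambda>n. \<bar>x\<bar> \<le> 2 ^ n"] k by (auto simp: n_def)
  have "\<bar>x\<bar> powr p \<le> (2 ^ Suc k) powr p" using n k assms by (intro powr_mono2) auto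
  also have "\<dots> = 2 powr (real (Suc k) * p)"
    by (subst powr_realpow[symmetric]) (auto simp: powr_powr)
  finally have "ennreal (\<bar>x\<bar> powr p) \<le> ?f k"
    using k' by (simp add: ennreal_leI)
  also have "\<dots> \<le> (\<Sum>k. ?f k)"
    by (rule ennreal_le_suminf)
  finally show ?thesis by (rule order_trans) simp
qed

text \<open>Inserting the tail estimate at the levels \<open>2 ^ k\<close> leaves a geometric series
  of ratio \<open>2 powr (p - q)\<close>, convergent since \<open>p < q\<close>. The bound depends
  on \<open>R\<close> only through \<open>C\<close> and \<open>q\<close>, so it is uniform along a
  family with common tails.\<close>

lemma nn_integral_powr_le_of_tail:
  assumes "prob_space M" and R: "tail_bounded M R C q" and p: "0 < p" "p < q"
  shows "(\<integral>\<^sup>+\<omega>. ennreal (\<bar>R \<omega>\<bar> powr p) \<partial>M) \<le> ennreal (1 + C * 2 powr p / (1 - 2 powr (p - q)))"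
proof -
  interpret prob_space M by fact
  note [measurable] = tail_bounded_measurable[OF R]
  have C: "0 \<le> C" by (rule tail_bounded_nonneg[OF R])
  let ?r = "2 powr (p - q)"
  have r: "0 \<le> ?r" "?r < 1" using p by (auto simp: powr_less_one)
  have "(\<integral>\<^sup>+\<omega>. ennreal (\<bar>R \<omega>\<bar> powr p) \<partial>M) \<le>
     (\<integral>\<^sup>+\<omega>. 1 + (\<Sum>k. ennreal (2 powr (real (Suc k) * p)) * indicator {y. 2 ^ k < \<bar>y\<bar>} (R \<omega>)) \<partial>M)"
    by (intro nn_integral_mono powr_le_dyadic_sum p)
  also have "\<dots> = 1 + (\<Sum>k. ennreal (2 powr (real (Suc k) * p)) * emeasure M {\<omega>\<in>space M. 2 ^ k < \<bar>R \<omega>\<bar>})"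
  proof -
    have "(\<integral>\<^sup>+\<omega>. indicator {y. 2 ^ k < \<bar>y\<bar>} (R \<omega>) \<partial>M) = emeasure M {\<omega>\<in>space M. 2 ^ k < \<bar>R \<omega>\<bar>}" for k
    proof -
      have "(\<integral>\<^sup>+\<omega>. indicator {y. 2 ^ k < \<bar>y\<bar>} (R \<omega>) \<partial>M) = (\<integral>\<^sup>+\<omega>. indicator {\<omega>\<in>space M. 2 ^ k < \<bar>R \<omega>\<bar>} \<omega> \<partial>M)"
        by (intro nn_integral_cong) (auto simp: indicator_def)
      then show ?thesis by simp
    qed
    then show ?thesis
      by (simp add: nn_integral_add nn_integral_suminf nn_integral_cmult emeasure_space_1)
  qed
  also have "\<dots> \<le> 1 + (\<Sum>k. ennreal (C * 2 powr p * ?r ^ k))"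
  proof (intro add_left_mono suminf_le)
    fix k :: nat
    have "ennreal (2 powr (real (Suc k) * p)) * emeasure M {\<omega>\<in>space M. 2 ^ k < \<bar>R \<omega>\<bar>} =
       ennreal (2 powr (real (Suc k) * p) * prob {\<omega>\<in>space M. 2 ^ k < \<bar>R \<omega>\<bar>})"
      by (simp add: emeasure_eq_measure ennreal_mult)
    also have "\<dots> \<le> ennreal (2 powr (real (Suc k) * p) * (C * (2 ^ k) powr (-q)))"
      using R by (intro ennreal_leI mult_left_mono) (auto simp: tail_bounded_def)
    also have "2 powr (real (Suc k) * p) * (C * (2 ^ k) powr (-q)) = C * 2 powr p * ?r ^ k"
    proof -
      have "?r ^ k = 2 powr ((p - q) * real k)" by (simp add: powr_power mult.commute)
      moreover have "(2 ^ k) powr (-q) = 2 powr (real k * (- q))"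
        by (subst powr_realpow[symmetric]) (auto simp: powr_powr)
      ultimately show ?thesis
        by (simp add: powr_add[symmetric] algebra_simps)
    qed
    finally show "ennreal (2 powr (real (Suc k) * p)) * emeasure M {\<omega>\<in>space M. 2 ^ k < \<bar>R \<omega>\<bar>} \<le> ennreal (C * 2 powr p * ?r ^ k)" .
  qed auto
  also have "(\<Sum>k. ennreal (C * 2 powr p * ?r ^ k)) = ennreal (C * 2 powr p * (1 / (1 - ?r)))"
    using C r by (intro suminf_ennreal_eq sums_mult geometric_sums) auto
  also have "1 + \<dots> = ennreal (1 + C * 2 powr p / (1 - ?r))"
    using C r by (subst ennreal_plus) auto
  finally show ?thesis .
qed


section \<open>Truncation errors, uniform integrability and convergence of moments\<close>

lemma abs_diff_min_le:
  fixes y R s :: real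
  assumes "0 \<le> y" "0 < R" "0 < s"
  shows "\<bar>y - min y R\<bar> \<le> y powr (1 + s) * R powr (-s)"
proof (cases "y \<le> R")
  case False
  \<comment> \<open>Above the level \<open>R\<close>, splitting off \<open>y powr (-s)\<close>
    trades a higher power of \<open>y\<close> for decay in \<open>R\<close>.\<close>
  then have "y = y powr (1 + s) * y powr (-s)" using assms by (simp add: powr_add[symmetric])
  also have "\<dots> \<le> y powr (1 + s) * R powr (-s)"
    using False assms by (intro mult_left_mono powr_mono2') auto
  finally show ?thesis using False assms by auto
qed simp

text \<open>With \<open>s = p / \<eta> - 1\<close> the power
  \<open>(\<bar>R \<omega>\<bar> powr \<eta>) powr (1 + s)\<close> equals
  \<open>\<bar>R \<omega>\<bar> powr p\<close>, so the error of truncating at \<open>B\<close>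
  decays like \<open>B powr (-s)\<close>, uniformly over variables whose moment of order
  \<open>p\<close> is at most \<open>K\<close>.\<close>

lemma moment_truncation_error:
  assumes "prob_space M" and [measurable]: "R \<in> borel_measurable M" and e: "0 < \<eta>" "\<eta> < p" and B: "0 < B"
    and K: "(\<integral>\<^sup>+\<omega>. ennreal (\<bar>R \<omega>\<bar> powr p) \<partial>M) \<le> ennreal K" "0 \<le> K"
  shows "integrable M (\<lambda>\<omega>. \<bar>R \<omega>\<bar> powr \<eta>)"
    and "\<bar>(\<integral>\<omega>. \<bar>R \<omega>\<bar> powr \<eta> \<partial>M) - (\<integral>\<omega>. min (\<bar>R \<omega>\<bar> powr \<eta>) B \<partial>M)\<bar> \<le> K * B powr (-(p / \<eta> - 1))" (is ?err)
proof -
  interpret prob_space M by fact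
  have ip: "integrable M (\<lambda>\<omega>. \<bar>R \<omega>\<bar> powr p)"
    using K by (intro integrableI_nonneg) (auto simp: less_top[symmetric] top_unique)
  have Kp: "(\<integral>\<omega>. \<bar>R \<omega>\<bar> powr p \<partial>M) \<le> K"
    using K nn_integral_eq_integral[OF ip] by auto
  show i: "integrable M (\<lambda>\<omega>. \<bar>R \<omega>\<bar> powr \<eta>)"
  proof (rule Bochner_Integration.integrable_bound)
    show "integrable M (\<lambda>\<omega>. 1 + \<bar>R \<omega>\<bar> powr p)" using ip by simp
    show "AE \<omega> in M. norm (\<bar>R \<omega>\<bar> powr \<eta>) \<le> norm (1 + \<bar>R \<omega>\<bar> powr p)"
    proof (intro AE_I2)
      fix \<omega>
      show "norm (\<bar>R \<omega>\<bar> powr \<eta>) \<le> norm (1 + \<bar>R \<omega>\<bar> powr p)"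
      proof (cases "\<bar>R \<omega>\<bar> \<le> 1")
        case True
        then have "\<bar>R \<omega>\<bar> powr \<eta> \<le> 1 powr \<eta>" using e by (intro powr_mono2) auto
        then show ?thesis by (auto intro: order_trans add_increasing2)
      next
        case False
        then have "\<bar>R \<omega>\<bar> powr \<eta> \<le> \<bar>R \<omega>\<bar> powr p" using e by (intro powr_mono) auto
        then show ?thesis by auto
      qed
    qed
  qed measurable
  have im: "integrable M (\<lambda>\<omega>. min (\<bar>R \<omega>\<bar> powr \<eta>) B)"
    using B by (intro integrable_const_bound[where B=B]) auto
  have "\<bar>(\<integral>\<omega>. \<bar>R \<omega>\<bar> powr \<eta> \<partial>M) - (\<integral>\<omega>. min (\<bar>R \<omega>\<bar> powr \<eta>) B \<partial>M)\<bar>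
     = \<bar>\<integral>\<omega>. \<bar>R \<omega>\<bar> powr \<eta> - min (\<bar>R \<omega>\<bar> powr \<eta>) B \<partial>M\<bar>"
    using i im by simp
  also have "\<dots> \<le> (\<integral>\<omega>. \<bar>\<bar>R \<omega>\<bar> powr \<eta> - min (\<bar>R \<omega>\<bar> powr \<eta>) B\<bar> \<partial>M)"
    by (rule integral_abs_bound)
  also have "\<dots> \<le> (\<integral>\<omega>. \<bar>R \<omega>\<bar> powr p * B powr (-(p / \<eta> - 1)) \<partial>M)"
  proof (rule integral_mono)
    fix \<omega>
    have "\<bar>\<bar>R \<omega>\<bar> powr \<eta> - min (\<bar>R \<omega>\<bar> powr \<eta>) B\<bar> \<le>
        (\<bar>R \<omega>\<bar> powr \<eta>) powr (1 + (p / \<eta> - 1)) * B powr (-(p / \<eta> - 1))"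
      using e B by (intro abs_diff_min_le) auto
    then show "\<bar>\<bar>R \<omega>\<bar> powr \<eta> - min (\<bar>R \<omega>\<bar> powr \<eta>) B\<bar> \<le> \<bar>R \<omega>\<bar> powr p * B powr (-(p / \<eta> - 1))"
      using e by (simp add: powr_powr)
  qed (use i im ip in auto)
  also have "\<dots> = (\<integral>\<omega>. \<bar>R \<omega>\<bar> powr p \<partial>M) * B powr (-(p / \<eta> - 1))" by simp
  also have "\<dots> \<le> K * B powr (-(p / \<eta> - 1))" using Kp by (intro mult_right_mono) auto
  finally show ?err .
qed

text \<open>Uniform integrability in quantitative form. Weak convergence handles the bounded
  continuous function \<open>min (\<bar>x\<bar> powr \<eta>) B\<close>; the truncation errors are
  small on both sides because the moments of an order \<open>p\<close> between \<open>\<eta>\<close>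
  and \<open>q\<close> have the common bound \<open>K\<close>.\<close>

lemma moment_convergence_of_tail:
  fixes Z :: "'r \<Rightarrow> 'w \<Rightarrow> real" and Z' :: "'v \<Rightarrow> real"
  assumes M: "prob_space M" and M': "prob_space M'" and [measurable]: "Z' \<in> borel_measurable M'"
    and F: "F \<noteq> bot"
    and tail: "eventually (\<lambda>r. tail_bounded M (Z r) C q) F" and e: "0 < \<eta>" "\<eta> < q"
    and weak: "\<And>g :: real \<Rightarrow> real. continuous_on UNIV g \<Longrightarrow> bounded (range g) \<Longrightarrow>
        ((\<lambda>r. \<integral>\<omega>. g (Z r \<omega>) \<partial>M) \<longlongrightarrow> (\<integral>\<omega>. g (Z' \<omega>) \<partial>M')) F"
  shows "eventually (\<lambda>r. integrable M (\<lambda>\<omega>. \<bar>Z r \<omega>\<bar> powr \<eta>)) F"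
    and "integrable M' (\<lambda>\<omega>. \<bar>Z' \<omega>\<bar> powr \<eta>)"
    and "((\<lambda>r. \<integral>\<omega>. \<bar>Z r \<omega>\<bar> powr \<eta> \<partial>M) \<longlongrightarrow> (\<integral>\<omega>. \<bar>Z' \<omega>\<bar> powr \<eta> \<partial>M')) F"
proof -
  interpret M: prob_space M by fact
  interpret M': prob_space M' by fact
  define p where "p = (\<eta> + q) / 2"
  have p: "0 < p" "\<eta> < p" "p < q" using e by (auto simp: p_def)
  obtain r0 where "tail_bounded M (Z r0) C q" using eventually_happens'[OF F tail] by auto
  then have C: "0 \<le> C" by (rule tail_bounded_nonneg)
  define K where "K = 1 + C * 2 powr p / (1 - 2 powr (p - q))"
  have K: "0 \<le> K" unfolding K_def using C p by (auto intro!: add_nonneg_nonneg divide_nonneg_nonneg simp: powr_less_one less_imp_le)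
  have bd: "eventually (\<lambda>r. Z r \<in> borel_measurable M \<and> (\<integral>\<^sup>+\<omega>. ennreal (\<bar>Z r \<omega>\<bar> powr p) \<partial>M) \<le> ennreal K) F"
    using tail by eventually_elim
      (auto simp: K_def dest: tail_bounded_measurable intro: nn_integral_powr_le_of_tail[OF M _ p(1,3)])
  have lim: "((\<lambda>r. \<integral>\<omega>. min (\<bar>Z r \<omega>\<bar> powr a) B \<partial>M) \<longlongrightarrow> (\<integral>\<omega>. min (\<bar>Z' \<omega>\<bar> powr a) B \<partial>M')) F"
    if "0 < a" "0 < B" for a B
  proof (rule weak)
    show "continuous_on UNIV (\<lambda>x::real. min (\<bar>x\<bar> powr a) B)"
      using that by (intro continuous_intros continuous_on_powr') auto
    show "bounded (range (\<lambda>x::real. min (\<bar>x\<bar> powr a) B))"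
      using that by (intro boundedI[of _ B]) auto
  qed
  \<comment> \<open>Weak convergence transfers the bound to truncated moments of the limit, and
    monotone convergence removes the truncation. The levels \<open>Suc n\<close> are positive, as
    \<open>lim\<close> requires.\<close>
  have bd': "(\<integral>\<^sup>+\<omega>. ennreal (\<bar>Z' \<omega>\<bar> powr p) \<partial>M') \<le> ennreal K"
  proof -
    have tr: "(\<integral>\<^sup>+\<omega>. ennreal (min (\<bar>Z' \<omega>\<bar> powr p) (real (Suc n))) \<partial>M') \<le> ennreal K" for n
    proof -
      have "(\<integral>\<omega>. min (\<bar>Z' \<omega>\<bar> powr p) (real (Suc n)) \<partial>M') \<le> K"
      proof (rule tendsto_upperbound[OF lim[OF p(1), of "real (Suc n)"] _ F])
        show "eventually (\<lambda>r. (\<integral>\<omega>. min (\<bar>Z r \<omega>\<bar> powr p) (real (Suc n)) \<partial>M) \<le> K) F"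
          using bd
        proof eventually_elim
          case (elim r)
          then have [measurable]: "Z r \<in> borel_measurable M" by simp
          have i: "integrable M (\<lambda>\<omega>. min (\<bar>Z r \<omega>\<bar> powr p) (real (Suc n)))"
            by (intro M.integrable_const_bound[where B="real (Suc n)"]) auto
          have "ennreal (\<integral>\<omega>. min (\<bar>Z r \<omega>\<bar> powr p) (real (Suc n)) \<partial>M) = (\<integral>\<^sup>+\<omega>. ennreal (min (\<bar>Z r \<omega>\<bar> powr p) (real (Suc n))) \<partial>M)"
            by (intro nn_integral_eq_integral[symmetric] i) auto
          also have "\<dots> \<le> (\<integral>\<^sup>+\<omega>. ennreal (\<bar>Z r \<omega>\<bar> powr p) \<partial>M)"
            by (intro nn_integral_mono ennreal_leI) auto
          also have "\<dots> \<le> ennreal K" using elim by simp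
          finally show ?case using K by simp
        qed
      qed simp
      moreover have "integrable M' (\<lambda>\<omega>. min (\<bar>Z' \<omega>\<bar> powr p) (real (Suc n)))"
        by (intro M'.integrable_const_bound[where B="real (Suc n)"]) auto
      ultimately show ?thesis
        by (subst nn_integral_eq_integral) (auto intro: ennreal_leI)
    qed
    have "(\<integral>\<^sup>+\<omega>. ennreal (\<bar>Z' \<omega>\<bar> powr p) \<partial>M') = (\<integral>\<^sup>+\<omega>. (SUP n. ennreal (min (\<bar>Z' \<omega>\<bar> powr p) (real (Suc n)))) \<partial>M')"
    proof (intro nn_integral_cong antisym SUP_least)
      fix \<omega>
      obtain n where n: "\<bar>Z' \<omega>\<bar> powr p \<le> real n" using real_arch_simple by auto
      then have "ennreal (\<bar>Z' \<omega>\<bar> powr p) = ennreal (min (\<bar>Z' \<omega>\<bar> powr p) (real (Suc n)))" by simp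
      also have "\<dots> \<le> (SUP n. ennreal (min (\<bar>Z' \<omega>\<bar> powr p) (real (Suc n))))" by (rule SUP_upper) simp
      finally show "ennreal (\<bar>Z' \<omega>\<bar> powr p) \<le> \<dots>" .
    qed (auto intro!: ennreal_leI)
    also have "\<dots> = (SUP n. \<integral>\<^sup>+\<omega>. ennreal (min (\<bar>Z' \<omega>\<bar> powr p) (real (Suc n))) \<partial>M')"
      by (intro nn_integral_monotone_convergence_SUP) (auto simp: incseq_def le_fun_def intro!: ennreal_leI)
    also have "\<dots> \<le> ennreal K" by (intro SUP_least tr)
    finally show ?thesis .
  qed
  show "eventually (\<lambda>r. integrable M (\<lambda>\<omega>. \<bar>Z r \<omega>\<bar> powr \<eta>)) F"
    using bd by eventually_elim (rule moment_truncation_error[OF M _ e(1) p(2) zero_less_one _ K], auto)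
  show "integrable M' (\<lambda>\<omega>. \<bar>Z' \<omega>\<bar> powr \<eta>)"
    by (rule moment_truncation_error[OF M' _ e(1) p(2) zero_less_one bd' K]) measurable
  show "((\<lambda>r. \<integral>\<omega>. \<bar>Z r \<omega>\<bar> powr \<eta> \<partial>M) \<longlongrightarrow> (\<integral>\<omega>. \<bar>Z' \<omega>\<bar> powr \<eta> \<partial>M')) F"
  proof (rule tendstoI)
    fix d :: real assume d: "0 < d"
    define s where "s = p / \<eta> - 1"
    have s: "0 < s" using e p by (simp add: s_def)
    have "((\<lambda>B. K * B powr (-s)) \<longlongrightarrow> K * 0) at_top"
      using s by (intro tendsto_mult tendsto_const tendsto_neg_powr filterlim_ident) auto
    then have "eventually (\<lambda>B. K * B powr (-s) < d / 3) at_top"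
      using d by (intro order_tendstoD(2)[of _ "K * 0"]) auto
    then have "eventually (\<lambda>B. K * B powr (-s) < d / 3 \<and> 0 < B) at_top"
      using eventually_gt_at_top[of 0] by eventually_elim auto
    \<comment> \<open>Each of the two truncation errors takes less than \<open>d / 3\<close>; the
      last third is left to weak convergence.\<close>
    then obtain B where B: "K * B powr (-s) < d / 3" "0 < B"
      using eventually_happens'[OF trivial_limit_at_top_linorder] by blast
    have "eventually (\<lambda>r. dist (\<integral>\<omega>. min (\<bar>Z r \<omega>\<bar> powr \<eta>) B \<partial>M) (\<integral>\<omega>. min (\<bar>Z' \<omega>\<bar> powr \<eta>) B \<partial>M') < d / 3) F"
      using lim[OF e(1) B(2)] d by (intro tendstoD) auto
    with bd show "eventually (\<lambda>r. dist (\<integral>\<omega>. \<bar>Z r \<omega>\<bar> powr \<eta> \<partial>M) (\<integral>\<omega>. \<bar>Z' \<omega>\<bar> powr \<eta> \<partial>M') < d) F"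
    proof eventually_elim
      case (elim r)
      have "\<bar>(\<integral>\<omega>. \<bar>Z r \<omega>\<bar> powr \<eta> \<partial>M) - (\<integral>\<omega>. min (\<bar>Z r \<omega>\<bar> powr \<eta>) B \<partial>M)\<bar> \<le> K * B powr (-s)"
        unfolding s_def using elim by (intro moment_truncation_error[OF M _ e(1) p(2) B(2) _ K]) auto
      moreover have "\<bar>(\<integral>\<omega>. \<bar>Z' \<omega>\<bar> powr \<eta> \<partial>M') - (\<integral>\<omega>. min (\<bar>Z' \<omega>\<bar> powr \<eta>) B \<partial>M')\<bar> \<le> K * B powr (-s)"
        unfolding s_def by (intro moment_truncation_error[OF M' _ e(1) p(2) B(2) bd' K]) auto
      ultimately show ?case using elim B unfolding dist_real_def by linarith
    qed
  qed
qed

section \<open>The normalising constant\<close>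

text \<open>Multiplied by \<open>a\<close>, this is the integral of
  \<open>x powr (-a) * sin x\<close> after integration by parts with the antiderivative
  \<open>1 - cos x\<close>. The new integrand is of order \<open>x powr (1 - a)\<close> at 0 and
  \<open>x powr (-a - 1)\<close> at infinity, so it is absolutely integrable for
  \<open>0 < a < 2\<close>.\<close>

definition versine_integral :: "real \<Rightarrow> real" where
  "versine_integral a = integral {0<..} (\<lambda>x. (1 - cos x) * x powr (-a - 1))"

lemma one_minus_cos_le: "1 - cos x \<le> x\<^sup>2" for x :: real
proof -
  have "1 - cos x = 2 * (sin (x / 2))\<^sup>2"
    using cos_double_sin[of "x/2"] by simp
  also have "\<dots> \<le> 2 * (x / 2)\<^sup>2"
    using abs_sin_x_le_abs_x[of "x/2"] by (intro mult_left_mono) (auto simp: abs_le_square_iff[symmetric] simp del: power_divide)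
  also have "\<dots> \<le> x\<^sup>2" by (simp add: power2_eq_square)
  finally show ?thesis .
qed

text \<open>Integrable majorant with separate exponents at 0 and at infinity. The two pieces overlap
  in the single point 1, and omitting 0 changes a null set.\<close>

lemma integrable_two_sided_powr:
  fixes p q :: real
  assumes "-1 < p" "q < -1"
  shows "(\<lambda>x. if x \<le> 1 then x powr p else x powr q) integrable_on {0<..}"
proof -
  let ?f = "\<lambda>x. if x \<le> 1 then x powr p else x powr q :: real"
  have "(\<lambda>x. x powr p) integrable_on {0..1}"
    using assms by (intro integrable_on_powr_from_0) auto
  then have 1: "?f integrable_on {0..1}"
    by (rule integrable_eq) auto
  have "(\<lambda>x. x powr q) integrable_on {1..}"
    using has_integral_powr_to_inf[of q 1] assms by (auto simp: integrable_on_def)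
  then have 2: "?f integrable_on {1..}"
    by (rule integrable_eq) auto
  have "?f integrable_on {0..1} \<union> {1..}"
  proof (rule integrable_Un[OF _ 1 2])
    have "{0..1} \<inter> {1::real..} = {1}" by auto
    then show "negligible ({0..1} \<inter> {1::real..})" by simp
  qed
  also have "{0..1} \<union> {1::real..} = {0..}" by auto
  finally show ?thesis
    by (rule integrable_spike_set) (auto intro: negligible_subset[of "{0}"])
qed

text \<open>Uniform over indices in \<open>{a1..a2}\<close>: near 0 the worst index is
  \<open>a2\<close>, at infinity it is \<open>a1\<close>. The degenerate range gives integrability,
  a proper range the Lipschitz estimate.\<close>

lemma versine_bound:
  fixes x a :: real
  assumes x: "0 < x" and a: "a1 \<le> a" "a \<le> a2"
  shows "\<bar>(1 - cos x) * x powr (-a - 1)\<bar> \<le> 2 * (if x \<le> 1 then x powr (1 - a2) else x powr (-a1 - 1))"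
proof (cases "x \<le> 1")
  case True
  have "(1 - cos x) * x powr (-a - 1) \<le> x\<^sup>2 * x powr (-a - 1)"
    by (intro mult_right_mono one_minus_cos_le) auto
  also have "\<dots> = x powr (1 - a)"
    using x by (simp add: powr_numeral[symmetric] powr_add[symmetric] del: powr_numeral)
  also have "\<dots> \<le> x powr (1 - a2)" using True x a by (intro powr_mono') auto
  finally show ?thesis using True by (simp add: abs_mult) (simp add: order_trans[of _ "x powr (1 - a2)"])
next
  case False
  have "(1 - cos x) * x powr (-a - 1) \<le> 2 * x powr (-a1 - 1)"
    using False a cos_ge_minus_one[of x] by (intro mult_mono powr_mono) auto
  then show ?thesis using False by (simp add: abs_mult)
qed

lemma versine_absolutely_integrable:
  fixes a :: real
  assumes "0 < a" "a < 2"
  shows "(\<lambda>x. (1 - cos x) * x powr (-a - 1)) absolutely_integrable_on {0<..}"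
proof (rule measurable_bounded_by_integrable_imp_absolutely_integrable)
  show "(\<lambda>x. (1 - cos x) * x powr (-a - 1)) \<in> borel_measurable (lebesgue_on {0<..})"
  proof -
    have [measurable]: "(cos :: real \<Rightarrow> real) \<in> borel_measurable borel"
      by (intro borel_measurable_continuous_onI continuous_intros)
    have "(\<lambda>x. (1 - cos x) * x powr (-a - 1)) \<in> borel_measurable borel" by measurable
    then show ?thesis by (intro measurable_restrict_space1 measurable_completion) simp
  qed
  show "(\<lambda>x. 2 * (if x \<le> 1 then x powr (1 - a) else x powr (-a - 1))) integrable_on {0<..}"
    using assms by (intro integrable_on_mult_right integrable_two_sided_powr) auto
  show "norm ((1 - cos x) * x powr (-a - 1)) \<le> 2 * (if x \<le> 1 then x powr (1 - a) else x powr (-a - 1))"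
    if "x \<in> {0<..}" for x
    using versine_bound[of x a a a] that by simp
qed simp

lemma versine_integrable:
  "0 < a \<Longrightarrow> a < 2 \<Longrightarrow> (\<lambda>x :: real. (1 - cos x) * x powr (-a - 1)) integrable_on {0<..}"
  using versine_absolutely_integrable set_lebesgue_integral_eq_integral(1) by blast

text \<open>The integrand is nonnegative, and on \<open>{1..2}\<close>, where cosine decreases since
  \<open>2 < pi\<close>, it is bounded below by a positive constant.\<close>

lemma versine_integral_pos:
  assumes "0 < a" "a < 2"
  shows "0 < versine_integral a"
proof -
  let ?f = "\<lambda>x. (1 - cos x) * x powr (-a - 1) :: real"
  let ?c = "(1 - cos 1) * 2 powr (-a - 1) :: real"
  have i: "?f integrable_on {1..2}"
    by (intro integrable_continuous_interval continuous_intros) auto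
  have "0 < ?c" using cos_monotone_0_pi[of 0 1] pi_gt3 by simp
  also have "?c = integral {1..2} (\<lambda>x::real. ?c)" by simp
  also have "\<dots> \<le> integral {1..2} ?f"
  proof (rule integral_le[OF _ i])
    fix x :: real assume x: "x \<in> {1..2}"
    then have "cos x \<le> cos 1" using pi_gt3 by (intro cos_monotone_0_pi_le) auto
    moreover have "2 powr (-a - 1) \<le> x powr (-a - 1)"
      using x assms by (intro powr_mono2') auto
    ultimately show "?c \<le> ?f x" by (intro mult_mono) auto
  qed auto
  also have "\<dots> \<le> integral {0<..} ?f"
    by (intro integral_subset_le i versine_integrable assms) auto
  finally show ?thesis by (simp add: versine_integral_def)
qed

text \<open>Integration by parts turns the conditionally convergent integral into an absolutely convergent one.\<close>

lemma has_integral_powr_sin: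
  fixes a :: real
  assumes a: "0 < a" "a < 2"
  shows "((\<lambda>x. x powr (-a) * sin x) has_integral (a * versine_integral a)) {0<..}"
proof -
  let ?\<phi> = "\<lambda>x. (1 - cos x) * x powr (-a - 1) :: real"
  let ?f = "\<lambda>x. x powr (-a) * sin x :: real"
  let ?F = "\<lambda>x. (1 - cos x) * x powr (-a) :: real"
  have \<phi>: "(?\<phi> has_integral versine_integral a) {0<..}"
    unfolding versine_integral_def using versine_integrable[OF a] by (rule integrable_integral)
  have \<phi>': "?\<phi> integrable_on {0<..R}" for R
  proof -
    have "?\<phi> absolutely_integrable_on {0<..R}"
      by (rule set_integrable_subset[OF versine_absolutely_integrable[OF a]]) auto
    then show ?thesis using set_lebesgue_integral_eq_integral(1) by blast
  qed
  \<comment> \<open>\<open>?F\<close> has derivative \<open>?f x - a * ?\<phi> x\<close>. It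
    vanishes at 0, where it is of order \<open>x powr (2 - a)\<close>, so only the boundary term at
    \<open>R\<close> survives.\<close>
  have main: "(?f has_integral (?F R + a * integral {0<..R} ?\<phi>)) {0<..R}" if R: "0 \<le> R" for R
  proof -
    have cont: "continuous_on {0..R} ?F"
    proof (clarsimp simp: continuous_on_eq_continuous_within)
      fix x :: real assume x: "0 \<le> x" "x \<le> R"
      show "continuous (at x within {0..R}) ?F"
      proof (cases "x = 0")
        case True
        have "((\<lambda>x. x powr (2 - a)) \<longlongrightarrow> 0) (at 0 within {0..R})"
          using a by (intro tendsto_zero_powrI[where b="2 - a"] tendsto_const tendsto_ident_at) (auto simp: eventually_at_filter)
        then have "(?F \<longlongrightarrow> 0) (at 0 within {0..R})"
        proof (rule Lim_null_comparison[rotated])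
          show "eventually (\<lambda>x. norm (?F x) \<le> x powr (2 - a)) (at 0 within {0..R})"
            unfolding eventually_at_filter
          proof (intro always_eventually allI impI)
            fix x :: real assume "x \<noteq> 0" "x \<in> {0..R}"
            then have x: "0 < x" by auto
            have "?F x \<le> x\<^sup>2 * x powr (-a)" by (intro mult_right_mono one_minus_cos_le) auto
            also have "\<dots> = x powr (2 - a)"
              using x by (simp add: powr_numeral[symmetric] powr_add[symmetric] del: powr_numeral)
            finally show "norm (?F x) \<le> x powr (2 - a)" by (simp add: abs_mult)
          qed
        qed
        then show ?thesis using True by (simp add: continuous_within)
      next
        case False
        then have "continuous (at x) ?F" using x by (intro continuous_intros) auto
        then show ?thesis by (rule continuous_at_imp_continuous_at_within)
      qed
    qed
    have "((\<lambda>x. ?f x - a * ?\<phi> x) has_integral (?F R - ?F 0)) {0..R}"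
    proof (rule fundamental_theorem_of_calculus_interior[OF R cont])
      fix x :: real assume "x \<in> {0<..<R}"
      then have "0 < x" by simp
      have "((\<lambda>x. 1 - cos x) has_real_derivative sin x) (at x)"
        by (auto intro!: derivative_eq_intros)
      from DERIV_mult[OF this has_real_derivative_powr[OF \<open>0 < x\<close>, of "-a"]]
      show "(?F has_vector_derivative (?f x - a * ?\<phi> x)) (at x)"
        unfolding has_real_derivative_iff_has_vector_derivative[symmetric]
        by (simp add: algebra_simps)
    qed
    moreover have "negligible {x \<in> {0..R} - {0<..R}. ?f x - a * ?\<phi> x \<noteq> 0}"
      by (rule negligible_subset[of "{0}"]) auto
    moreover have "negligible {x \<in> {0<..R} - {0..R}. ?f x - a * ?\<phi> x \<noteq> 0}"
      by (rule negligible_subset[of "{}"]) auto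
    ultimately have "((\<lambda>x. ?f x - a * ?\<phi> x) has_integral ?F R) {0<..R}"
      using has_integral_spike_set_eq[of "{0..R}" "{0<..R}" "\<lambda>x. ?f x - a * ?\<phi> x"] by simp
    from has_integral_add[OF this has_integral_mult_right[OF integrable_integral[OF \<phi>'[of R]], of a]]
    show ?thesis by simp
  qed
  have fint: "?f integrable_on ({0<..} \<inter> {l..u})" for l u
  proof (cases "l \<le> 0")
    case True
    then have "{0<..} \<inter> {l..u} = {0<..u}" by auto
    moreover have "?f integrable_on {0<..u}"
      using main[of u] by (cases "0 \<le> u") (auto simp: integrable_on_def)
    ultimately show ?thesis by simp
  next
    case False
    then have "{0<..} \<inter> {l..u} = {l..u}" by auto
    moreover have "?f integrable_on {l..u}"
      using False by (intro integrable_continuous_interval continuous_intros) auto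
    ultimately show ?thesis by simp
  qed
  show ?thesis
    \<comment> \<open>Over an unbounded set the integral is a limit over boxes containing large
      balls. Such a box meets the half-line in \<open>{0<..u}\<close>, so \<open>main\<close>
      computes its integral, and the boundary term is at most
      \<open>2 * u powr (-a)\<close>.\<close>
    unfolding has_integral_alt'[of ?f]
  proof (intro conjI allI impI)
    fix l u :: real
    show "(\<lambda>x. if x \<in> {0<..} then ?f x else 0) integrable_on cbox l u"
      using fint[of l u] by (simp only: integrable_restrict_Int box_real)
  next
    fix e :: real assume e: "0 < e"
    have "0 < e / (2 * a)" using e a by simp
    then obtain B1 where B1: "B1 > 0" "\<And>l u. ball 0 B1 \<subseteq> cbox l u \<Longrightarrow>
        norm (integral (cbox l u) (\<lambda>x. if x \<in> {0<..} then ?\<phi> x else 0) - versine_integral a) < e / (2 * a)"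
      using \<phi>[unfolded has_integral_alt'[of ?\<phi>], THEN conjunct2, rule_format, OF \<open>0 < e / (2 * a)\<close>]
      by (elim exE conjE) (rule that, assumption, elim allE impE)
    have "((\<lambda>u. 2 * u powr (-a)) \<longlongrightarrow> 2 * 0) at_top"
      using a by (intro tendsto_mult tendsto_const tendsto_neg_powr filterlim_ident) auto
    then have "eventually (\<lambda>u. 2 * u powr (-a) < e / 2) at_top"
      using e by (intro order_tendstoD(2)[of _ "2 * 0"]) auto
    then obtain B2 where B2: "\<And>u. u \<ge> B2 \<Longrightarrow> 2 * u powr (-a) < e / 2"
      unfolding eventually_at_top_linorder by blast
    show "\<exists>B>0. \<forall>l u. ball 0 B \<subseteq> cbox l u \<longrightarrow>
        norm (integral (cbox l u) (\<lambda>x. if x \<in> {0<..} then ?f x else 0) - a * versine_integral a) < e"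
    \<comment> \<open>A radius of at least \<open>B2 + 1\<close> puts a positive \<open>B2\<close>
      into the open ball, which forces \<open>B2 \<le> u\<close>.\<close>
    proof (intro exI[of _ "max B1 (B2 + 1)"] conjI allI impI)
      fix l u :: real assume sub: "ball 0 (max B1 (B2 + 1)) \<subseteq> cbox l u"
      then have s1: "ball 0 B1 \<subseteq> cbox l u" by (auto simp: subset_eq)
      have "0 \<in> cbox l u" using sub B1 by (auto simp: subset_eq)
      then have lu: "l \<le> 0" "0 \<le> u" by auto
      have uB: "B2 \<le> u"
      proof (cases "B2 \<le> 0")
        case False
        then have "B2 \<in> ball 0 (max B1 (B2 + 1))" by simp
        then show ?thesis using sub by auto
      qed (use lu in simp)
      have seteq: "{0<..} \<inter> {l..u} = {0<..u}" using lu by auto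
      have i1: "integral (cbox l u) (\<lambda>x. if x \<in> {0<..} then ?f x else 0) = ?F u + a * integral {0<..u} ?\<phi>"
        using integral_unique[OF main[OF lu(2)]] seteq by (simp only: integral_restrict_Int box_real)
      have i2: "integral (cbox l u) (\<lambda>x. if x \<in> {0<..} then ?\<phi> x else 0) = integral {0<..u} ?\<phi>"
        using seteq by (simp only: integral_restrict_Int box_real)
      have F: "\<bar>?F u\<bar> < e / 2"
      proof -
        have "\<bar>?F u\<bar> \<le> 2 * u powr (-a)"
          using cos_ge_minus_one[of u] by (auto simp: abs_mult intro!: mult_right_mono)
        then show ?thesis using B2[OF uB] by simp
      qed
      have "\<bar>integral {0<..u} ?\<phi> - versine_integral a\<bar> < e / (2 * a)"
        using B1(2)[OF s1] unfolding i2 by simp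
      then have "\<bar>a * (integral {0<..u} ?\<phi> - versine_integral a)\<bar> < e / 2"
        using mult_strict_left_mono[OF _ a(1)] a unfolding abs_mult by fastforce
      then show "norm (integral (cbox l u) (\<lambda>x. if x \<in> {0<..} then ?f x else 0) - a * versine_integral a) < e"
        unfolding i1 real_norm_def right_diff_distrib using F by linarith
    qed (use B1 in auto)
  qed
qed

lemma stable_const_eq:
  assumes "0 < a" "a < 2"
  shows "stable_const a = inverse (a * versine_integral a)"
  using has_integral_powr_sin[OF assms] by (simp add: stable_const_def integral_unique)


section \<open>Lipschitz dependence of the normalising constant on the index\<close>

lemma abs_ln_le_powr:
  fixes x \<kappa> :: real
  assumes "0 < x" "0 < \<kappa>"
  shows "\<bar>ln x\<bar> \<le> (if x \<le> 1 then x powr (-\<kappa>) else x powr \<kappa>) / \<kappa>"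
proof (cases "x \<le> 1")
  case True
  then have "ln (1 / x) \<le> (1 / x) powr \<kappa> / \<kappa>" using assms by (intro ln_powr_bound) auto
  then show ?thesis using True assms by (simp add: ln_div powr_divide powr_minus_divide)
next
  case False
  then show ?thesis using ln_powr_bound[of x \<kappa>] assms by simp
qed

text \<open>Mean value theorem in the index for each fixed \<open>x\<close>: the derivative is
  \<open>- ln x\<close> times the integrand, and a small power with exponent \<open>\<kappa>\<close>
  absorbs the logarithm at both ends, leaving an integrable majorant.\<close>

lemma versine_integral_lipschitz:
  assumes lu: "0 < l" "u < 2"
  shows "\<exists>K. \<forall>a b. l \<le> a \<and> a \<le> b \<and> b \<le> u \<longrightarrow> \<bar>versine_integral b - versine_integral a\<bar> \<le> K * (b - a)"
proof (intro exI allI impI)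
  \<comment> \<open>At most half of the distances from \<open>l\<close> to 0 and from
    \<open>u\<close> to 2, so the shifted exponents \<open>1 - u - \<kappa>\<close> at 0 and
    \<open>\<kappa> - l - 1\<close> at infinity remain integrable.\<close>
  define \<kappa> where "\<kappa> = min (l / 2) ((2 - u) / 2)"
  have \<kappa>: "0 < \<kappa>" "\<kappa> < l" "u + \<kappa> < 2" using lu by (auto simp: \<kappa>_def min_def field_simps)
  define D where "D x = (if x \<le> 1 then x powr (-\<kappa> + (1 - u)) else x powr (\<kappa> + (-l - 1)))" for x :: real
  have D: "D integrable_on {0<..}"
    unfolding D_def using \<kappa> by (intro integrable_two_sided_powr) auto
  fix a b assume ab: "l \<le> a \<and> a \<le> b \<and> b \<le> u"
  let ?\<phi> = "\<lambda>a x. (1 - cos x) * x powr (-a - 1) :: real"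
  have i: "?\<phi> a integrable_on {0<..}" "?\<phi> b integrable_on {0<..}"
    using ab lu by (auto intro!: versine_integrable)
  have "norm (integral {0<..} (\<lambda>x. ?\<phi> b x - ?\<phi> a x)) \<le> integral {0<..} (\<lambda>x. ((b - a) * (2 / \<kappa>)) * D x)"
  proof (rule integral_norm_bound_integral)
    show "(\<lambda>x. ?\<phi> b x - ?\<phi> a x) integrable_on {0<..}" using i by (intro integrable_diff)
    show "(\<lambda>x. ((b - a) * (2 / \<kappa>)) * D x) integrable_on {0<..}" using D by (intro integrable_on_mult_right)
    fix x :: real assume "x \<in> {0<..}"
    then have x: "0 < x" by simp
    show "norm (?\<phi> b x - ?\<phi> a x) \<le> ((b - a) * (2 / \<kappa>)) * D x"
    proof (cases "a = b")
      case False
      then have "a < b" using ab by simp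
      have d: "((\<lambda>a. ?\<phi> a x) has_real_derivative (- ln x * ?\<phi> \<xi> x)) (at \<xi>)" for \<xi>
        using x by (auto intro!: derivative_eq_intros simp: powr_def)
      obtain \<xi> where \<xi>: "a < \<xi>" "\<xi> < b" "?\<phi> b x - ?\<phi> a x = (b - a) * (- ln x * ?\<phi> \<xi> x)"
        using MVT2[OF \<open>a < b\<close> d] by blast
      have "norm (?\<phi> b x - ?\<phi> a x) = (b - a) * (\<bar>ln x\<bar> * \<bar>?\<phi> \<xi> x\<bar>)"
        unfolding \<xi>(3) using \<open>a < b\<close> by (simp add: abs_mult)
      also have "\<dots> \<le> (b - a) * (((if x \<le> 1 then x powr (-\<kappa>) else x powr \<kappa>) / \<kappa>) *
          (2 * (if x \<le> 1 then x powr (1 - u) else x powr (-l - 1))))"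
        using x \<kappa> \<xi> ab \<open>a < b\<close> by (intro mult_left_mono mult_mono abs_ln_le_powr versine_bound) auto
      also have "\<dots> = ((b - a) * (2 / \<kappa>)) * D x"
        unfolding D_def powr_add using \<kappa> by simp
      finally show ?thesis .
    qed simp
  qed
  then show "\<bar>versine_integral b - versine_integral a\<bar> \<le> (2 / \<kappa> * integral {0<..} D) * (b - a)"
    unfolding versine_integral_def integral_diff[OF i(2,1), symmetric]
    unfolding integral_mult_right real_norm_def by (simp only: mult.commute mult.left_commute)
qed

text \<open>Nearby values are compared only with the value at \<open>t\<close>, which is weaker than
  a Lipschitz condition around \<open>t\<close>. It follows from differentiability at
  \<open>t\<close>, is stable under sums, products and composition, and matches increments taken
  from the fixed point \<open>t\<close>.\<close>

definition lipschitz_at :: "(real \<Rightarrow> real) \<Rightarrow> real \<Rightarrow> bool" where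
  "lipschitz_at g t \<longleftrightarrow> (\<exists>K. \<forall>\<^sub>F u in nhds t. \<bar>g u - g t\<bar> \<le> K * \<bar>u - t\<bar>)"

lemma lipschitz_atE:
  assumes "lipschitz_at g t"
  obtains K where "0 \<le> K" "\<forall>\<^sub>F u in nhds t. \<bar>g u - g t\<bar> \<le> K * \<bar>u - t\<bar>"
proof -
  obtain K where K: "\<forall>\<^sub>F u in nhds t. \<bar>g u - g t\<bar> \<le> K * \<bar>u - t\<bar>" using assms by (auto simp: lipschitz_at_def)
  have "\<forall>\<^sub>F u in nhds t. \<bar>g u - g t\<bar> \<le> max K 0 * \<bar>u - t\<bar>"
    using K by eventually_elim (erule order_trans, auto intro!: mult_right_mono)
  then show ?thesis using that[of "max K 0"] by simp
qed

lemma lipschitz_at_continuous: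
  assumes "lipschitz_at g t"
  shows "filterlim g (nhds (g t)) (nhds t)"
proof -
  obtain K where K: "0 \<le> K" "\<forall>\<^sub>F u in nhds t. \<bar>g u - g t\<bar> \<le> K * \<bar>u - t\<bar>" by (rule lipschitz_atE[OF assms])
  have "((\<lambda>u. K * \<bar>u - t\<bar>) \<longlongrightarrow> K * \<bar>t - t\<bar>) (nhds t)" by (intro tendsto_intros filterlim_ident)
  then have "((\<lambda>u. g u - g t) \<longlongrightarrow> 0) (nhds t)"
    using K(2) by (intro Lim_null_comparison[of "\<lambda>u. g u - g t" "\<lambda>u. K * \<bar>u - t\<bar>"]) auto
  then show ?thesis by (simp add: LIM_zero_iff)
qed

lemma lipschitz_at_deriv:
  assumes "(g has_real_derivative D) (at t)"
  shows "lipschitz_at g t"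
proof -
  have "((\<lambda>u. \<bar>(g u - g t) / (u - t)\<bar>) \<longlongrightarrow> \<bar>D\<bar>) (at t)"
    using assms unfolding has_field_derivative_iff by (rule tendsto_rabs)
  then have "\<forall>\<^sub>F u in at t. \<bar>(g u - g t) / (u - t)\<bar> < \<bar>D\<bar> + 1"
    by (rule order_tendstoD) simp
  then have "\<forall>\<^sub>F u in at t. \<bar>g u - g t\<bar> \<le> (\<bar>D\<bar> + 1) * \<bar>u - t\<bar>"
    unfolding eventually_at_filter by eventually_elim (auto simp: abs_divide field_simps)
  then show ?thesis
    unfolding lipschitz_at_def eventually_at_filter by (intro exI[of _ "\<bar>D\<bar> + 1"]) (auto elim: eventually_mono)
qed

lemma lipschitz_at_compose:
  assumes \<phi>: "lipschitz_at \<phi> (g t)" and g: "lipschitz_at g t"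
  shows "lipschitz_at (\<lambda>u. \<phi> (g u)) t"
proof -
  obtain K where K: "0 \<le> K" "\<forall>\<^sub>F u in nhds t. \<bar>g u - g t\<bar> \<le> K * \<bar>u - t\<bar>" by (rule lipschitz_atE[OF g])
  obtain L where L: "0 \<le> L" "\<forall>\<^sub>F y in nhds (g t). \<bar>\<phi> y - \<phi> (g t)\<bar> \<le> L * \<bar>y - g t\<bar>" by (rule lipschitz_atE[OF \<phi>])
  have "\<forall>\<^sub>F u in nhds t. \<bar>\<phi> (g u) - \<phi> (g t)\<bar> \<le> L * \<bar>g u - g t\<bar>"
    using L(2) lipschitz_at_continuous[OF g] by (rule eventually_compose_filterlim)
  with K(2) have "\<forall>\<^sub>F u in nhds t. \<bar>\<phi> (g u) - \<phi> (g t)\<bar> \<le> (L * K) * \<bar>u - t\<bar>"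
  proof eventually_elim
    case (elim u)
    then show ?case using mult_left_mono[OF elim(1) L(1)] by (simp add: mult.assoc)
  qed
  then show ?thesis unfolding lipschitz_at_def by blast
qed

lemma lipschitz_at_add:
  assumes "lipschitz_at f t" and g: "lipschitz_at g t"
  shows "lipschitz_at (\<lambda>u. f u + g u) t"
proof -
  obtain K where K: "\<forall>\<^sub>F u in nhds t. \<bar>f u - f t\<bar> \<le> K * \<bar>u - t\<bar>" using assms by (auto elim: lipschitz_atE)
  obtain L where L: "\<forall>\<^sub>F u in nhds t. \<bar>g u - g t\<bar> \<le> L * \<bar>u - t\<bar>" using g by (auto elim: lipschitz_atE)
  have "\<forall>\<^sub>F u in nhds t. \<bar>(f u + g u) - (f t + g t)\<bar> \<le> (K + L) * \<bar>u - t\<bar>"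
    using K L by eventually_elim (simp add: distrib_right)
  then show ?thesis unfolding lipschitz_at_def by blast
qed

lemma lipschitz_at_mult:
  assumes f: "lipschitz_at f t" and g: "lipschitz_at g t"
  shows "lipschitz_at (\<lambda>u. f u * g u) t"
proof -
  obtain K where K: "0 \<le> K" "\<forall>\<^sub>F u in nhds t. \<bar>f u - f t\<bar> \<le> K * \<bar>u - t\<bar>" by (rule lipschitz_atE[OF f])
  obtain L where L: "0 \<le> L" "\<forall>\<^sub>F u in nhds t. \<bar>g u - g t\<bar> \<le> L * \<bar>u - t\<bar>" by (rule lipschitz_atE[OF g])
  have "((\<lambda>u. \<bar>g u\<bar>) \<longlongrightarrow> \<bar>g t\<bar>) (nhds t)" by (intro tendsto_rabs lipschitz_at_continuous g)
  then have "\<forall>\<^sub>F u in nhds t. \<bar>g u\<bar> < \<bar>g t\<bar> + 1" by (rule order_tendstoD) simp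
  with K(2) L(2) have "\<forall>\<^sub>F u in nhds t. \<bar>f u * g u - f t * g t\<bar> \<le> (K * (\<bar>g t\<bar> + 1) + \<bar>f t\<bar> * L) * \<bar>u - t\<bar>"
  proof eventually_elim
    case (elim u)
    have "\<bar>f u * g u - f t * g t\<bar> = \<bar>(f u - f t) * g u + f t * (g u - g t)\<bar>" by (simp add: algebra_simps)
    also have "\<dots> \<le> \<bar>f u - f t\<bar> * \<bar>g u\<bar> + \<bar>f t\<bar> * \<bar>g u - g t\<bar>"
      by (rule order_trans[OF abs_triangle_ineq]) (simp add: abs_mult)
    also have "\<dots> \<le> (K * \<bar>u - t\<bar>) * (\<bar>g t\<bar> + 1) + \<bar>f t\<bar> * (L * \<bar>u - t\<bar>)"
      using elim K L by (intro add_mono mult_mono) auto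
    finally show ?case by (simp add: algebra_simps)
  qed
  then show ?thesis unfolding lipschitz_at_def by blast
qed

lemma lipschitz_at_cong:
  assumes "lipschitz_at f t" and "\<forall>\<^sub>F u in nhds t. f u = g u"
  shows "lipschitz_at g t"
proof -
  have "f t = g t" using assms(2) by (rule eventually_nhds_x_imp_x)
  obtain K where "\<forall>\<^sub>F u in nhds t. \<bar>f u - f t\<bar> \<le> K * \<bar>u - t\<bar>" using assms by (auto elim: lipschitz_atE)
  with assms(2) have "\<forall>\<^sub>F u in nhds t. \<bar>g u - g t\<bar> \<le> K * \<bar>u - t\<bar>"
    by eventually_elim (simp add: \<open>f t = g t\<close>)
  then show ?thesis unfolding lipschitz_at_def by blast
qed

lemma lipschitz_at_versine_integral:
  assumes a: "0 < a" "a < 2"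
  shows "lipschitz_at versine_integral a"
proof -
  define l u where "l = a / 2" and "u = (a + 2) / 2"
  have lu: "0 < l" "l < a" "a < u" "u < 2" using a by (auto simp: l_def u_def)
  obtain K where K: "\<And>a b. l \<le> a \<Longrightarrow> a \<le> b \<Longrightarrow> b \<le> u \<Longrightarrow> \<bar>versine_integral b - versine_integral a\<bar> \<le> K * (b - a)"
    using versine_integral_lipschitz[OF lu(1,4)] by blast
  have "\<forall>\<^sub>F x in nhds a. x \<in> {l<..<u}" using lu by (intro eventually_nhds_in_open) auto
  then have "\<forall>\<^sub>F x in nhds a. \<bar>versine_integral x - versine_integral a\<bar> \<le> K * \<bar>x - a\<bar>"
  proof eventually_elim
    case (elim x)
    then show ?case
      using K[of x a] K[of a x] lu by (cases "x \<le> a") (auto simp: abs_minus_commute)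
  qed
  then show ?thesis unfolding lipschitz_at_def by blast
qed

text \<open>Near \<open>a\<close> the function is the exponential of
  \<open>- (ln a + ln (versine_integral a)) / a\<close>; positivity of the integral makes its
  logarithm differentiable there.\<close>

lemma lipschitz_at_stable_const:
  assumes a: "0 < a" "a < 2"
  shows "lipschitz_at (\<lambda>a. stable_const a powr (1 / a)) a"
proof (rule lipschitz_at_cong)
  have "lipschitz_at (\<lambda>a. (ln a + ln (versine_integral a)) * (- 1 / a)) a"
  proof (intro lipschitz_at_mult lipschitz_at_add)
    show "lipschitz_at ln a" using a by (intro lipschitz_at_deriv[OF DERIV_ln])
    show "lipschitz_at (\<lambda>a. ln (versine_integral a)) a"
      by (rule lipschitz_at_compose[where \<phi>=ln,
            OF lipschitz_at_deriv[OF DERIV_ln[OF versine_integral_pos[OF a]]] lipschitz_at_versine_integral[OF a]])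
    have "((\<lambda>a. - 1 / a) has_real_derivative 1 / a\<^sup>2) (at a)"
      using a by (auto intro!: derivative_eq_intros simp: power2_eq_square)
    then show "lipschitz_at (\<lambda>a. - 1 / a) a" by (rule lipschitz_at_deriv)
  qed
  then show "lipschitz_at (\<lambda>a. exp ((ln a + ln (versine_integral a)) * (- 1 / a))) a"
    by (rule lipschitz_at_compose[where \<phi>=exp, OF lipschitz_at_deriv[OF DERIV_exp]])
  have "\<forall>\<^sub>F x in nhds a. x \<in> {0<..<2}" using a by (intro eventually_nhds_in_open) auto
  then show "\<forall>\<^sub>F x in nhds a. exp ((ln x + ln (versine_integral x)) * (- 1 / x)) = stable_const x powr (1 / x)"
  proof eventually_elim
    case (elim x)
    then have x: "0 < x" "0 < versine_integral x" "0 < x * versine_integral x" "x < 2"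
      using versine_integral_pos[of x] by auto
    have "ln (inverse (x * versine_integral x)) = - (ln x + ln (versine_integral x))"
      using x by (subst ln_inverse) (simp_all add: ln_mult)
    then show ?case
      unfolding stable_const_eq[OF x(1,4)] powr_def using x by (simp add: mult.commute diff_divide_distrib add_divide_distrib)
  qed
qed

section \<open>Increments of the kernel\<close>

text \<open>The exponent \<open>1 / a\<close> lies between \<open>1 / d\<close> and
  \<open>1 / c\<close>: for \<open>x \<le> 1\<close> the larger \<open>\<beta>1\<close> dominates,
  for \<open>x > 1\<close> the smaller \<open>\<beta>2\<close>. The gaps to \<open>1 / c\<close> and
  \<open>1 / d\<close> leave a power \<open>\<kappa>\<close> to spare, which absorbs
  \<open>ln x\<close> at the cost of \<open>1 / \<kappa>\<close>.\<close>

lemma powr_two_sided_le: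
  fixes x :: real
  assumes x: "0 < x" and a: "c \<le> a" "a \<le> d" "0 < c" and \<beta>: "1 / c < \<beta>1" "\<beta>2 < 1 / d"
  shows "x powr (-1 / a) \<le> x powr (-\<beta>1) + x powr (-\<beta>2)"
    and "x powr (-1 / a) * \<bar>ln x\<bar> \<le> (x powr (-\<beta>1) + x powr (-\<beta>2)) / min (\<beta>1 - 1 / c) (1 / d - \<beta>2)"
proof -
  define \<kappa> where "\<kappa> = min (\<beta>1 - 1 / c) (1 / d - \<beta>2)"
  have \<kappa>: "0 < \<kappa>" "1 / c + \<kappa> \<le> \<beta>1" "\<beta>2 \<le> 1 / d - \<kappa>" using \<beta> by (auto simp: \<kappa>_def)
  have inv: "1 / a \<le> 1 / c" "1 / d \<le> 1 / a" using a by (auto intro!: divide_left_mono)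
  show "x powr (-1 / a) \<le> x powr (-\<beta>1) + x powr (-\<beta>2)"
  proof (cases "x \<le> 1")
    case True
    then have "x powr (-1 / a) \<le> x powr (-\<beta>1)" using x inv \<beta> by (intro powr_mono') auto
    then show ?thesis by (simp add: add_increasing2)
  next
    case False
    then have "x powr (-1 / a) \<le> x powr (-\<beta>2)" using inv \<beta> by (intro powr_mono) auto
    then show ?thesis by (simp add: add_increasing)
  qed
  have "x powr (-1 / a) * \<bar>ln x\<bar> \<le> x powr (-1 / a) * ((if x \<le> 1 then x powr (-\<kappa>) else x powr \<kappa>) / \<kappa>)"
    using abs_ln_le_powr[OF x \<kappa>(1)] by (intro mult_left_mono) auto
  also have "\<dots> = (if x \<le> 1 then x powr (-1 / a + - \<kappa>) else x powr (-1 / a + \<kappa>)) / \<kappa>"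
    unfolding powr_add by simp
  also have "\<dots> \<le> (x powr (-\<beta>1) + x powr (-\<beta>2)) / \<kappa>"
  proof (intro divide_right_mono)
    show "(if x \<le> 1 then x powr (-1 / a + - \<kappa>) else x powr (-1 / a + \<kappa>)) \<le> x powr (-\<beta>1) + x powr (-\<beta>2)"
    proof (cases "x \<le> 1")
      case True
      then have "x powr (-1 / a + - \<kappa>) \<le> x powr (-\<beta>1)" using x inv \<kappa> by (intro powr_mono') auto
      then show ?thesis using True by (simp add: add_increasing2)
    next
      case False
      then have "x powr (-1 / a + \<kappa>) \<le> x powr (-\<beta>2)" using inv \<kappa> by (intro powr_mono) auto
      then show ?thesis using False by (simp add: add_increasing)
    qed
  qed (use \<kappa> in simp)
  finally show "x powr (-1 / a) * \<bar>ln x\<bar> \<le> (x powr (-\<beta>1) + x powr (-\<beta>2)) / min (\<beta>1 - 1 / c) (1 / d - \<beta>2)"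
    unfolding \<kappa>_def .
qed

text \<open>The left side is \<open>(r * \<bar>y\<bar> powr a) powr (1 / a)\<close>. As
  \<open>Z\<close> is at least 1, the exponent may be raised to \<open>1 / c\<close>, which removes
  the dependence on the index.\<close>

lemma powr_inverse_mult_le:
  fixes r y Z a c :: real
  assumes "0 \<le> r" "r * \<bar>y\<bar> powr a \<le> Z" "1 \<le> Z" "0 < c" "c \<le> a"
  shows "r powr (1 / a) * \<bar>y\<bar> \<le> Z powr (1 / c)"
proof -
  have a: "0 < a" using assms by simp
  have "r powr (1 / a) * \<bar>y\<bar> = (r * \<bar>y\<bar> powr a) powr (1 / a)"
    using a assms(1) by (simp add: powr_mult powr_powr)
  also have "\<dots> \<le> Z powr (1 / a)" using assms a by (intro powr_mono2) auto
  also have "\<dots> \<le> Z powr (1 / c)" using assms a by (intro powr_mono divide_left_mono) auto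
  finally show ?thesis .
qed

text \<open>Mean value theorem in \<open>w\<close>. One term of the derivative contains
  \<open>\<phi>' w\<close>; the other two contain \<open>\<alpha>' w / (\<alpha> w)\<^sup>2\<close>,
  bounded by \<open>A / c\<^sup>2\<close>, and come from the powers of \<open>r\<close> and of
  \<open>x\<close>. The factor \<open>ln r\<close> stays with \<open>\<phi> w\<close> and is
  controlled through \<open>Z\<close>; the factor \<open>ln x\<close> is absorbed by the two powers
  of \<open>x\<close>.\<close>

lemma kernel_increment_bound:
  fixes \<phi> \<alpha> :: "real \<Rightarrow> real"
  assumes x: "0 < x" and r: "0 < r" and tu: "t < u" and c: "0 < c" and \<beta>: "1 / c < \<beta>1" "\<beta>2 < 1 / d"
    and \<alpha>: "\<And>w. t \<le> w \<Longrightarrow> w \<le> u \<Longrightarrow> c \<le> \<alpha> w \<and> \<alpha> w \<le> d"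
      "\<And>w. t \<le> w \<Longrightarrow> w \<le> u \<Longrightarrow> (\<alpha> has_real_derivative \<alpha>' w) (at w) \<and> \<bar>\<alpha>' w\<bar> \<le> A"
    and \<phi>: "\<And>w. t \<le> w \<Longrightarrow> w \<le> u \<Longrightarrow> (\<phi> has_real_derivative \<phi>' w) (at w)"
    and Z: "1 \<le> Z" "\<And>w. t \<le> w \<Longrightarrow> w \<le> u \<Longrightarrow> r * \<bar>\<phi> w\<bar> powr \<alpha> w \<le> Z"
      "\<And>w. t \<le> w \<Longrightarrow> w \<le> u \<Longrightarrow> r * \<bar>\<phi>' w\<bar> powr \<alpha> w \<le> Z"
      "\<And>w. t \<le> w \<Longrightarrow> w \<le> u \<Longrightarrow> r * \<bar>\<phi> w * ln r\<bar> powr \<alpha> w \<le> Z"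
  shows "\<bar>x powr (-1 / \<alpha> u) * (r powr (1 / \<alpha> u) * \<phi> u) - x powr (-1 / \<alpha> t) * (r powr (1 / \<alpha> t) * \<phi> t)\<bar> \<le>
    (u - t) * (1 + A / c\<^sup>2 * (1 + 1 / min (\<beta>1 - 1 / c) (1 / d - \<beta>2))) * Z powr (1 / c) * (x powr (-\<beta>1) + x powr (-\<beta>2))"
proof -
  let ?k = "\<lambda>w. x powr (-1 / \<alpha> w) * (r powr (1 / \<alpha> w) * \<phi> w)"
  let ?k' = "\<lambda>w. x powr (-1 / \<alpha> w) * (r powr (1 / \<alpha> w) * \<phi>' w)
      - \<alpha>' w / (\<alpha> w)\<^sup>2 * (x powr (-1 / \<alpha> w) * (r powr (1 / \<alpha> w) * (\<phi> w * ln r)))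
      + \<alpha>' w / (\<alpha> w)\<^sup>2 * (x powr (-1 / \<alpha> w) * ln x * (r powr (1 / \<alpha> w) * \<phi> w))"
  have d: "(?k has_real_derivative ?k' w) (at w)" if w: "t \<le> w" "w \<le> u" for w
  proof -
    define q q' where "q = (\<lambda>w. 1 / \<alpha> w)" and "q' = - \<alpha>' w / (\<alpha> w)\<^sup>2"
    have "\<alpha> w \<noteq> 0" using \<alpha>(1)[OF w] c by auto
    then have q: "(q has_real_derivative q') (at w)"
      unfolding q_def q'_def using \<alpha>(2)[OF w]
      by (intro DERIV_cong[OF DERIV_divide[OF DERIV_const]]) (auto simp: power2_eq_square)
    have R: "((\<lambda>w. r powr q w) has_real_derivative r powr q w * (q' * ln r)) (at w)"
      using DERIV_fun_exp[OF DERIV_cmult_right[OF q, of "ln r"]] r by (simp add: powr_def)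
    have X: "((\<lambda>w. x powr (- q w)) has_real_derivative x powr (- q w) * (- q' * ln x)) (at w)"
      using DERIV_fun_exp[OF DERIV_cmult_right[OF DERIV_minus[OF q], of "ln x"]] x by (simp add: powr_def)
    have "((\<lambda>w. x powr (- q w) * (r powr q w * \<phi> w)) has_real_derivative
        x powr (- q w) * (- q' * ln x) * (r powr q w * \<phi> w) +
        (r powr q w * (q' * ln r) * \<phi> w + \<phi>' w * r powr q w) * x powr (- q w)) (at w)"
      by (rule DERIV_mult[OF X DERIV_mult[OF R \<phi>[OF w]]])
    then have "(?k has_real_derivative x powr (- q w) * (- q' * ln x) * (r powr q w * \<phi> w) +
        (r powr q w * (q' * ln r) * \<phi> w + \<phi>' w * r powr q w) * x powr (- q w)) (at w)"
      unfolding q_def by simp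
    then show ?thesis by (rule DERIV_cong) (simp add: q_def q'_def algebra_simps)
  qed
  obtain w where w: "t < w" "w < u" "?k u - ?k t = (u - t) * ?k' w"
    using MVT2[OF tu d] by blast
  have tw: "t \<le> w" "w \<le> u" using w by auto
  note \<alpha>w = \<alpha>(1)[OF tw]
  let ?X = "x powr (-\<beta>1) + x powr (-\<beta>2)" and ?\<kappa> = "min (\<beta>1 - 1 / c) (1 / d - \<beta>2)" and ?Z = "Z powr (1 / c)"
  have \<kappa>: "0 < ?\<kappa>" using \<beta> by simp
  have A: "\<bar>\<alpha>' w / (\<alpha> w)\<^sup>2\<bar> \<le> A / c\<^sup>2"
    using \<alpha>(2)[OF tw] \<alpha>w c by (simp add: abs_divide) (intro frac_le power_mono, auto)
  have A0: "0 \<le> A" using \<alpha>(2)[OF tw] by auto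
  have p1: "x powr (-1 / \<alpha> w) \<le> ?X" and p2: "x powr (-1 / \<alpha> w) * \<bar>ln x\<bar> \<le> ?X / ?\<kappa>"
    using powr_two_sided_le[OF x _ _ c \<beta>] \<alpha>w by auto
  have z: "r powr (1 / \<alpha> w) * \<bar>\<phi> w\<bar> \<le> ?Z" "r powr (1 / \<alpha> w) * \<bar>\<phi>' w\<bar> \<le> ?Z" "r powr (1 / \<alpha> w) * \<bar>\<phi> w * ln r\<bar> \<le> ?Z"
    using r c \<alpha>w Z(2-)[OF tw] by (auto intro!: powr_inverse_mult_le Z(1))
  have ident: "y * z + B * (y * z) + B * (y / k * z) = (1 + B * (1 + 1 / k)) * z * y" for y z B k :: real
    by (simp add: algebra_simps)
  have tri: "\<bar>y1 - y2 + y3\<bar> \<le> \<bar>y1\<bar> + \<bar>y2\<bar> + \<bar>y3\<bar>" for y1 y2 y3 :: real by linarith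
  have "\<bar>?k' w\<bar> \<le> \<bar>x powr (-1 / \<alpha> w) * (r powr (1 / \<alpha> w) * \<phi>' w)\<bar>
      + \<bar>\<alpha>' w / (\<alpha> w)\<^sup>2 * (x powr (-1 / \<alpha> w) * (r powr (1 / \<alpha> w) * (\<phi> w * ln r)))\<bar>
      + \<bar>\<alpha>' w / (\<alpha> w)\<^sup>2 * (x powr (-1 / \<alpha> w) * ln x * (r powr (1 / \<alpha> w) * \<phi> w))\<bar>"
    by (rule tri)
  also have "\<dots> = x powr (-1 / \<alpha> w) * (r powr (1 / \<alpha> w) * \<bar>\<phi>' w\<bar>)
      + \<bar>\<alpha>' w / (\<alpha> w)\<^sup>2\<bar> * (x powr (-1 / \<alpha> w) * (r powr (1 / \<alpha> w) * \<bar>\<phi> w * ln r\<bar>))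
      + \<bar>\<alpha>' w / (\<alpha> w)\<^sup>2\<bar> * (x powr (-1 / \<alpha> w) * \<bar>ln x\<bar> * (r powr (1 / \<alpha> w) * \<bar>\<phi> w\<bar>))"
    by (simp add: abs_mult)
  also have "\<dots> \<le> ?X * ?Z + A / c\<^sup>2 * (?X * ?Z) + A / c\<^sup>2 * (?X / ?\<kappa> * ?Z)"
    using p1 p2 z A A0 \<kappa> c by (intro add_mono mult_mono) (auto intro!: mult_nonneg_nonneg divide_nonneg_nonneg add_nonneg_nonneg)
  also have "\<dots> = (1 + A / c\<^sup>2 * (1 + 1 / ?\<kappa>)) * ?Z * ?X"
    by (rule ident)
  finally have "\<bar>?k' w\<bar> \<le> (1 + A / c\<^sup>2 * (1 + 1 / ?\<kappa>)) * ?Z * ?X" .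
  then have "(u - t) * \<bar>?k' w\<bar> \<le> (u - t) * ((1 + A / c\<^sup>2 * (1 + 1 / ?\<kappa>)) * ?Z * ?X)"
    using tu by (intro mult_left_mono) auto
  moreover have "\<bar>?k u - ?k t\<bar> = (u - t) * \<bar>?k' w\<bar>"
    unfolding w(3) abs_mult using tu by simp
  ultimately show ?thesis by (simp add: mult.assoc)
qed

text \<open>The sum is at most twice its larger term, so one of the two minima on the right already
  suffices.\<close>

lemma min_one_square_add_le:
  fixes y z :: real
  assumes "0 \<le> y" "0 \<le> z"
  shows "min 1 ((y + z)\<^sup>2) \<le> min 1 ((2 * y)\<^sup>2) + min 1 ((2 * z)\<^sup>2)"
proof (cases "y \<le> z")
  case True
  then have "(y + z)\<^sup>2 \<le> (2 * z)\<^sup>2" using assms by (intro power_mono) auto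
  then have "min 1 ((y + z)\<^sup>2) \<le> min 1 ((2 * z)\<^sup>2)" by auto
  then show ?thesis by (simp add: add_increasing)
next
  case False
  then have "(y + z)\<^sup>2 \<le> (2 * y)\<^sup>2" using assms by (intro power_mono) auto
  then have "min 1 ((y + z)\<^sup>2) \<le> min 1 ((2 * y)\<^sup>2)" by auto
  then show ?thesis by (simp add: add_increasing2)
qed

text \<open>The two powers are integrated separately, each giving a multiple of
  \<open>(2 * \<theta> * Z powr (1 / c)) powr (1 / \<beta>)\<close> with its own
  \<open>\<beta>\<close>. Since \<open>2 * \<theta> \<le> 1\<close>, the smaller exponent
  \<open>1 / \<beta>1\<close> is kept for \<open>\<theta>\<close>; since \<open>Z \<ge> 1\<close>,
  the larger one \<open>1 / (c * \<beta>2)\<close>, and then \<open>p\<close>, is kept for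
  \<open>Z\<close>.\<close>

lemma nn_integral_min_two_powers_le:
  fixes T :: "real \<Rightarrow> real"
  assumes T: "\<And>x. 0 < x \<Longrightarrow> \<bar>T x\<bar> \<le> \<theta> * Z powr (1 / c) * (x powr (-\<beta>1) + x powr (-\<beta>2))"
    and \<beta>: "1/2 < \<beta>2" "\<beta>2 \<le> \<beta>1" and c: "0 < c" "1 / (c * \<beta>2) \<le> p" and Z: "1 \<le> Z" and \<theta>: "0 \<le> \<theta>" "2 * \<theta> \<le> 1"
  shows "(\<integral>\<^sup>+x. indicator {0..} x * ennreal (min 1 ((T x)\<^sup>2)) \<partial>lborel) \<le>
    ennreal ((2 * \<beta>1 / (2 * \<beta>1 - 1) + 2 * \<beta>2 / (2 * \<beta>2 - 1)) * (2 * \<theta>) powr (1 / \<beta>1) * Z powr p)" (is "?lhs \<le> _")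
proof -
  let ?K = "\<theta> * Z powr (1 / c)"
  have K: "0 \<le> ?K" using \<theta> by simp
  have each: "(\<integral>\<^sup>+x. indicator {0..} x * ennreal (min 1 ((2 * ?K * x powr (-\<beta>))\<^sup>2)) \<partial>lborel)
      \<le> ennreal (2 * \<beta> / (2 * \<beta> - 1) * ((2 * \<theta>) powr (1 / \<beta>1) * Z powr p))" if b: "\<beta>2 \<le> \<beta>" "\<beta> \<le> \<beta>1" for \<beta>
  proof -
    have b': "1/2 < \<beta>" using b \<beta> by simp
    have "(2 * ?K) powr (1 / \<beta>) = (2 * \<theta>) powr (1 / \<beta>) * Z powr (1 / (c * \<beta>))"
      using \<theta> Z by (simp add: powr_mult powr_powr mult.assoc[symmetric])
    also have "\<dots> \<le> (2 * \<theta>) powr (1 / \<beta>1) * Z powr p"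
    proof (intro mult_mono)
      show "(2 * \<theta>) powr (1 / \<beta>) \<le> (2 * \<theta>) powr (1 / \<beta>1)"
        using \<theta> b b' by (intro powr_mono' divide_left_mono) auto
      have "1 / (c * \<beta>) \<le> 1 / (c * \<beta>2)" using b \<beta> c by (intro divide_left_mono mult_left_mono) auto
      then show "Z powr (1 / (c * \<beta>)) \<le> Z powr p" using c Z by (intro powr_mono) auto
    qed auto
    finally have "2 * \<beta> / (2 * \<beta> - 1) * (2 * ?K) powr (1 / \<beta>) \<le> 2 * \<beta> / (2 * \<beta> - 1) * ((2 * \<theta>) powr (1 / \<beta>1) * Z powr p)"
      using b' by (intro mult_left_mono) auto
    with nn_integral_min_power_le[OF b', of "2 * ?K"] K show ?thesis
      by (meson ennreal_leI mult_nonneg_nonneg order_trans zero_le_numeral)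
  qed
  have "?lhs \<le>
    (\<integral>\<^sup>+x. indicator {0..} x * ennreal (min 1 ((2 * ?K * x powr (-\<beta>1))\<^sup>2)) +
       indicator {0..} x * ennreal (min 1 ((2 * ?K * x powr (-\<beta>2))\<^sup>2)) \<partial>lborel)"
  proof (rule nn_integral_mono_AE)
    \<comment> \<open>\<open>T\<close> is controlled only at positive arguments; the point 0 is
      null.\<close>
    have "AE x in lborel. x \<noteq> (0::real)" by (rule AE_lborel_singleton)
    then show "AE x in lborel. indicator {0..} x * ennreal (min 1 ((T x)\<^sup>2)) \<le>
      indicator {0..} x * ennreal (min 1 ((2 * ?K * x powr (-\<beta>1))\<^sup>2)) +
       indicator {0..} x * ennreal (min 1 ((2 * ?K * x powr (-\<beta>2))\<^sup>2))"
    proof eventually_elim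
      case (elim x)
      show ?case
      proof (cases "0 < x")
        case True
        have "(T x)\<^sup>2 \<le> (?K * x powr (-\<beta>1) + ?K * x powr (-\<beta>2))\<^sup>2"
          using T[OF True] K by (intro power2_le_iff_abs_le[THEN iffD2]) (auto simp: algebra_simps)
        then have "min 1 ((T x)\<^sup>2) \<le> min 1 ((?K * x powr (-\<beta>1) + ?K * x powr (-\<beta>2))\<^sup>2)" by auto
        also have "\<dots> \<le> min 1 ((2 * (?K * x powr (-\<beta>1)))\<^sup>2) + min 1 ((2 * (?K * x powr (-\<beta>2)))\<^sup>2)"
          using K by (intro min_one_square_add_le) auto
        finally have "ennreal (min 1 ((T x)\<^sup>2)) \<le>
          ennreal (min 1 ((2 * ?K * x powr (-\<beta>1))\<^sup>2)) + ennreal (min 1 ((2 * ?K * x powr (-\<beta>2))\<^sup>2))"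
          by (subst ennreal_plus[symmetric]) (auto simp only: mult.assoc intro!: ennreal_leI, auto)
        then show ?thesis using True by simp
      qed (use elim in auto)
    qed
  qed
  also have "\<dots> = (\<integral>\<^sup>+x. indicator {0..} x * ennreal (min 1 ((2 * ?K * x powr (-\<beta>1))\<^sup>2)) \<partial>lborel) +
     (\<integral>\<^sup>+x. indicator {0..} x * ennreal (min 1 ((2 * ?K * x powr (-\<beta>2))\<^sup>2)) \<partial>lborel)"
    by (rule nn_integral_add) measurable
  also have "\<dots> \<le> ennreal (2 * \<beta>1 / (2 * \<beta>1 - 1) * ((2 * \<theta>) powr (1 / \<beta>1) * Z powr p)) +
      ennreal (2 * \<beta>2 / (2 * \<beta>2 - 1) * ((2 * \<theta>) powr (1 / \<beta>1) * Z powr p))"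
    using \<beta> by (intro add_mono each) auto
  also have "\<dots> = ennreal ((2 * \<beta>1 / (2 * \<beta>1 - 1) + 2 * \<beta>2 / (2 * \<beta>2 - 1)) * (2 * \<theta>) powr (1 / \<beta>1) * Z powr p)"
    using \<beta> by (subst ennreal_plus[symmetric]) (auto simp: algebra_simps intro!: mult_nonneg_nonneg)
  finally show ?thesis .
qed

section \<open>Suprema over the second argument and lower integrals\<close>

lemma measurable_ennreal_powr[measurable]: "(\<lambda>x. ennreal_powr x p) \<in> borel_measurable borel"
  unfolding ennreal_powr_def[abs_def] by measurable

lemma SUP_countable_dense:
  fixes g :: "real \<Rightarrow> real"
  assumes U: "open U" and g: "continuous_on U g"
  shows "(SUP w\<in>U. ennreal (g w)) = (SUP w\<in>U \<inter> \<rat>. ennreal (g w))"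
proof (rule antisym)
  show "(SUP w\<in>U. ennreal (g w)) \<le> (SUP w\<in>U \<inter> \<rat>. ennreal (g w))"
  proof (rule SUP_least)
    fix w assume w: "w \<in> U"
    have "w \<in> closure (U \<inter> \<rat>)"
      using w open_Int_closure_subset[OF U, of "\<rat>"] Rats_closure_real by auto
    then obtain z where z: "\<And>n. z n \<in> U \<inter> \<rat>" "z \<longlonglongrightarrow> w" unfolding closure_sequential by blast
    have "(\<lambda>n. g (z n)) \<longlonglongrightarrow> g w"
      by (rule continuous_on_tendsto_compose[OF g z(2) w]) (use z in auto)
    then have "(\<lambda>n. ennreal (g (z n))) \<longlonglongrightarrow> ennreal (g w)" by (rule tendsto_ennrealI)
    then show "ennreal (g w) \<le> (SUP w\<in>U \<inter> \<rat>. ennreal (g w))"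
      by (rule LIMSEQ_le_const2) (use z in \<open>auto intro!: exI SUP_upper\<close>)
  qed
qed (rule SUP_subset_mono, auto)

text \<open>The function \<open>b\<close> may be nonmeasurable; then the last integral is a lower integral.\<close>

lemma nn_integral_le_add_nonmeasurable:
  assumes [measurable]: "H \<in> borel_measurable M" "g \<in> borel_measurable M" and le: "AE x in M. H x \<le> g x + b x"
  shows "(\<integral>\<^sup>+x. H x \<partial>M) \<le> (\<integral>\<^sup>+x. g x \<partial>M) + (\<integral>\<^sup>+x. b x \<partial>M)"
proof (cases "(\<integral>\<^sup>+x. g x \<partial>M) = \<infinity>")
  case False
  \<comment> \<open>With truncated subtraction \<open>H x - g x\<close> is measurable and lies below
    \<open>b x\<close> wherever \<open>g x\<close> is finite, so it stands in for
    \<open>b\<close>.\<close>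
  then have fin: "AE x in M. g x \<noteq> \<infinity>" by (intro nn_integral_PInf_AE) auto
  have "(\<integral>\<^sup>+x. H x \<partial>M) \<le> (\<integral>\<^sup>+x. g x + (H x - g x) \<partial>M)"
  proof (intro nn_integral_mono)
    fix x
    show "H x \<le> g x + (H x - g x)"
    proof (cases "g x \<le> H x")
      case True
      show ?thesis by (subst add.commute) (simp only: diff_add_cancel_ennreal[OF True] order_refl)
    qed (simp add: add_increasing2)
  qed
  also have "\<dots> = (\<integral>\<^sup>+x. g x \<partial>M) + (\<integral>\<^sup>+x. H x - g x \<partial>M)" by (rule nn_integral_add) measurable
  also have "(\<integral>\<^sup>+x. H x - g x \<partial>M) \<le> (\<integral>\<^sup>+x. b x \<partial>M)"
  proof (rule nn_integral_mono_AE)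
    show "AE x in M. H x - g x \<le> b x"
      using le fin by eventually_elim (auto simp: ennreal_minus_le_iff top_unique)
  qed
  finally show ?thesis by (simp add: add_left_mono)
qed simp

section \<open>Stable kernels\<close>

text \<open>The integrand of \<open>sup_cond_sigma_finite\<close> for one value of the first
  argument, with values in \<open>[0, \<infinity>]\<close> because the supremum may be
  infinite.\<close>

definition sup_density :: "real set \<Rightarrow> (real \<Rightarrow> real) \<Rightarrow> ('e \<Rightarrow> real) \<Rightarrow> real \<Rightarrow> (real \<Rightarrow> 'e \<Rightarrow> real) \<Rightarrow> 'e \<Rightarrow> ennreal" where
  "sup_density U \<alpha> \<rho> \<delta> g x = ennreal_powr (SUP w\<in>U. ennreal (\<bar>g w x\<bar> powr \<alpha> w)) (1 + \<delta>) * ennreal (\<rho> x powr \<delta>)"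

lemma sup_cond_sigma_finiteE:
  assumes "sup_cond_sigma_finite U \<alpha> c d m \<rho> g"
  obtains \<delta> K where "d / c - 1 < \<delta>" "0 \<le> K" "\<And>s. s \<in> U \<Longrightarrow> (\<integral>\<^sup>+x. sup_density U \<alpha> \<rho> \<delta> (g s) x \<partial>m) \<le> ennreal K"
proof -
  obtain \<delta> where \<delta>: "d / c - 1 < \<delta>" "(SUP s\<in>U. \<integral>\<^sup>+x. sup_density U \<alpha> \<rho> \<delta> (g s) x \<partial>m) < \<infinity>"
    using assms unfolding sup_cond_sigma_finite_def sup_density_def by blast
  show ?thesis
  proof (rule that[OF \<delta>(1)])
    show "(\<integral>\<^sup>+x. sup_density U \<alpha> \<rho> \<delta> (g s) x \<partial>m) \<le> ennreal (enn2real (SUP s\<in>U. \<integral>\<^sup>+x. sup_density U \<alpha> \<rho> \<delta> (g s) x \<partial>m))"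
      if "s \<in> U" for s
      using \<delta>(2) SUP_upper[OF that, of "\<lambda>s. \<integral>\<^sup>+x. sup_density U \<alpha> \<rho> \<delta> (g s) x \<partial>m"] by simp
  qed simp
qed

lemma sup_density_top:
  assumes "0 < \<rho> x" "(SUP w\<in>U. ennreal (\<bar>g w x\<bar> powr \<alpha> w)) = \<infinity>"
  shows "sup_density U \<alpha> \<rho> \<delta> g x = \<infinity>"
  using assms by (simp add: sup_density_def ennreal_powr_def ennreal_top_mult)

text \<open>Since \<open>S powr (1 + \<delta>) * \<rho> x powr \<delta> = 1 / \<rho> x * (\<rho> x *
  S) powr (1 + \<delta>)\<close>, the condition bounds the moment of order
  \<open>1 + \<delta>\<close> of \<open>\<rho> * S\<close> under the law with density
  \<open>1 / \<rho>\<close>; this explains the weight \<open>\<rho> x powr \<delta>\<close>.\<close>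

lemma sup_density_finite:
  assumes "0 < \<rho> x" "(SUP w\<in>U. ennreal (\<bar>g w x\<bar> powr \<alpha> w)) = ennreal S" "0 \<le> S"
  shows "sup_density U \<alpha> \<rho> \<delta> g x = ennreal (1 / \<rho> x * (\<rho> x * S) powr (1 + \<delta>))"
    and "\<And>w. w \<in> U \<Longrightarrow> \<bar>g w x\<bar> powr \<alpha> w \<le> S"
proof -
  have "1 / \<rho> x * (\<rho> x * S) powr (1 + \<delta>) = S powr (1 + \<delta>) * \<rho> x powr \<delta>"
    using assms by (simp add: powr_mult powr_add)
  then show "sup_density U \<alpha> \<rho> \<delta> g x = ennreal (1 / \<rho> x * (\<rho> x * S) powr (1 + \<delta>))"
    using assms by (simp add: sup_density_def ennreal_powr_def ennreal_mult)
  show "\<bar>g w x\<bar> powr \<alpha> w \<le> S" if "w \<in> U" for w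
    using SUP_upper[OF that, of "\<lambda>w. ennreal (\<bar>g w x\<bar> powr \<alpha> w)"] assms by simp
qed

text \<open>Continuity in \<open>w\<close> reduces the supremum to rational arguments, where
  measurability is available.\<close>

lemma sup_density_countable:
  assumes U: "open U" and g: "continuous_on U (\<lambda>w. g w x)" and \<alpha>: "continuous_on U \<alpha>" "\<And>w. w \<in> U \<Longrightarrow> 0 < \<alpha> w"
  shows "sup_density U \<alpha> \<rho> \<delta> g x = sup_density (U \<inter> \<rat>) \<alpha> \<rho> \<delta> g x"
proof -
  have "continuous_on U (\<lambda>w. \<bar>g w x\<bar> powr \<alpha> w)"
    by (intro continuous_on_powr' continuous_on_rabs g \<alpha>(1)) (use \<alpha>(2) in auto)
  then show ?thesis
    unfolding sup_density_def by (simp add: SUP_countable_dense[OF U])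
qed

lemma measurable_sup_density_countable:
  assumes [measurable]: "\<And>w. w \<in> U \<Longrightarrow> g w \<in> borel_measurable m" "\<rho> \<in> borel_measurable m"
  shows "sup_density (U \<inter> \<rat>) \<alpha> \<rho> \<delta> g \<in> borel_measurable m"
proof -
  have "countable (U \<inter> \<rat>)" using countable_rat by (rule countable_subset[rotated]) auto
  then have [measurable]: "(\<lambda>x. SUP w\<in>U \<inter> \<rat>. ennreal (\<bar>g w x\<bar> powr \<alpha> w)) \<in> borel_measurable m"
  proof (rule borel_measurable_SUP)
    fix w assume "w \<in> U \<inter> \<rat>"
    then have [measurable]: "g w \<in> borel_measurable m" by auto
    show "(\<lambda>x. ennreal (\<bar>g w x\<bar> powr \<alpha> w)) \<in> borel_measurable m" by measurable
  qed
  show ?thesis unfolding sup_density_def[abs_def] by measurable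
qed

text \<open>The three quantities come with different exponents above \<open>p\<close>, and each
  satisfies \<open>y powr p \<le> 1 + y powr q\<close>. As the maximum is one of its arguments, a
  single 1 suffices.\<close>

lemma powr_max_le_sum:
  fixes p a b e :: real
  assumes "0 \<le> a" "0 \<le> b" "0 \<le> e" "0 \<le> p" "p \<le> pa" "p \<le> pb" "p \<le> pe"
  shows "max 1 (max a (max b e)) powr p \<le> 1 + a powr pa + b powr pb + e powr pe"
proof -
  have *: "y powr p \<le> 1 + y powr q" if "0 \<le> y" "p \<le> q" for y q
  proof (cases "y \<le> 1")
    case True
    then have "y powr p \<le> 1 powr p" using that assms(4) by (intro powr_mono2) auto
    then show ?thesis by (simp add: add_increasing2)
  next
    case False
    then have "y powr p \<le> y powr q" using that by (intro powr_mono) auto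
    then show ?thesis by simp
  qed
  have "max 1 (max a (max b e)) \<in> {1, a, b, e}" by (auto simp: max_def)
  then show ?thesis
    using *[OF assms(1,5)] *[OF assms(2,6)] *[OF assms(3,7)]
      powr_ge_zero[of a pa] powr_ge_zero[of b pb] powr_ge_zero[of e pe] by (auto simp del: powr_ge_zero)
qed

locale stable_kernel = lepage M mhat \<Gamma> V \<gamma>
  for M :: "'w measure" and mhat :: "'e measure" and \<Gamma> V \<gamma> +
  fixes m :: "'e measure" and \<rho> :: "'e \<Rightarrow> real"
  assumes measurable_\<rho>[measurable]: "\<rho> \<in> borel_measurable m"
    and \<rho>_pos: "\<And>x. x \<in> space m \<Longrightarrow> 0 < \<rho> x"
    and mhat_def: "mhat = density m (\<lambda>x. ennreal (1 / \<rho> x))"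
begin

lemma sets_mhat[measurable_cong]: "sets mhat = sets m"
  by (simp add: mhat_def)

lemma space_mhat: "space mhat = space m"
  by (simp add: mhat_def)

lemma nn_integral_mhat:
  "F \<in> borel_measurable m \<Longrightarrow> (\<integral>\<^sup>+x. F x \<partial>mhat) = (\<integral>\<^sup>+x. ennreal (1 / \<rho> x) * F x \<partial>m)"
  unfolding mhat_def by (rule nn_integral_density) measurable

lemma nn_integral_inverse_\<rho>: "(\<integral>\<^sup>+x. ennreal (1 / \<rho> x) \<partial>m) = 1"
  using nn_integral_mhat[of "\<lambda>_. 1"] prob_space.emeasure_space_1[OF prob_space_mhat] by simp

definition kernel :: "real \<Rightarrow> ('e \<Rightarrow> real) \<Rightarrow> real \<times> 'e \<Rightarrow> real" where
  "kernel a g p = fst p powr (-1 / a) * (\<rho> (snd p) powr (1 / a) * g (snd p))"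

lemma measurable_kernel[measurable]:
  assumes [measurable]: "g \<in> borel_measurable m"
  shows "kernel a g \<in> borel_measurable (borel \<Otimes>\<^sub>M mhat)"
  unfolding kernel_def[abs_def] by measurable

text \<open>For a fixed mark, the power bound with exponent \<open>1 / a > 1 / 2\<close> yields a
  multiple of \<open>\<rho> v * \<bar>g v\<bar> powr a * l powr (-a)\<close>. The factor
  \<open>\<rho> v\<close> cancels against the density of \<open>mhat\<close>, which is why the
  series carries \<open>\<rho>\<close> to the power \<open>1 / a\<close>.\<close>

lemma nn_integral_kernel_le:
  assumes [measurable]: "g \<in> borel_measurable m" and a: "0 < a" "a < 2" and l: "0 < l"
  shows "(\<integral>\<^sup>+v. \<integral>\<^sup>+x. indicator {0..} x * ennreal (min 1 ((kernel a g (x, v))\<^sup>2 / l\<^sup>2)) \<partial>lborel \<partial>mhat)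
    \<le> ennreal (2 / (2 - a) * l powr (-a)) * (\<integral>\<^sup>+v. ennreal (\<bar>g v\<bar> powr a) \<partial>m)" (is "?lhs \<le> _")
proof -
  have "?lhs \<le> (\<integral>\<^sup>+v. ennreal (2 / (2 - a) * l powr (-a)) * ennreal (\<rho> v * \<bar>g v\<bar> powr a) \<partial>mhat)"
  proof (rule nn_integral_mono)
    fix v assume "v \<in> space mhat"
    then have \<rho>: "0 < \<rho> v" using \<rho>_pos space_mhat by simp
    let ?K = "\<rho> v powr (1 / a) * \<bar>g v\<bar> / l"
    have "(\<integral>\<^sup>+x. indicator {0..} x * ennreal (min 1 ((kernel a g (x, v))\<^sup>2 / l\<^sup>2)) \<partial>lborel)
       = (\<integral>\<^sup>+x. indicator {0..} x * ennreal (min 1 ((?K * x powr (- (1 / a)))\<^sup>2)) \<partial>lborel)"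
      by (simp add: kernel_def power_mult_distrib power_divide mult_ac)
    also have "\<dots> \<le> ennreal (2 * (1 / a) / (2 * (1 / a) - 1) * ?K powr (1 / (1 / a)))"
      using a l by (intro nn_integral_min_power_le) (auto simp: field_simps)
    also have "2 * (1 / a) / (2 * (1 / a) - 1) = 2 / (2 - a)" using a by (simp add: field_simps)
    also have "?K powr (1 / (1 / a)) = \<rho> v * \<bar>g v\<bar> powr a * l powr (-a)"
      using a l \<rho> by (simp add: powr_mult powr_divide powr_powr powr_minus field_simps)
    also have "ennreal (2 / (2 - a) * (\<rho> v * \<bar>g v\<bar> powr a * l powr (-a))) = ennreal (2 / (2 - a) * l powr (-a)) * ennreal (\<rho> v * \<bar>g v\<bar> powr a)"
      using a \<rho> by (subst ennreal_mult[symmetric]) (auto simp: mult_ac)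
    finally show "(\<integral>\<^sup>+x. indicator {0..} x * ennreal (min 1 ((kernel a g (x, v))\<^sup>2 / l\<^sup>2)) \<partial>lborel)
      \<le> ennreal (2 / (2 - a) * l powr (-a)) * ennreal (\<rho> v * \<bar>g v\<bar> powr a)" .
  qed
  also have "\<dots> = ennreal (2 / (2 - a) * l powr (-a)) * (\<integral>\<^sup>+v. ennreal (\<rho> v * \<bar>g v\<bar> powr a) \<partial>mhat)"
    by (rule nn_integral_cmult) measurable
  also have "(\<integral>\<^sup>+v. ennreal (\<rho> v * \<bar>g v\<bar> powr a) \<partial>mhat) = (\<integral>\<^sup>+v. ennreal (1 / \<rho> v) * ennreal (\<rho> v * \<bar>g v\<bar> powr a) \<partial>m)"
    by (rule nn_integral_mhat) measurable
  also have "\<dots> = (\<integral>\<^sup>+v. ennreal (\<bar>g v\<bar> powr a) \<partial>m)"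
  proof (rule nn_integral_cong)
    fix v assume "v \<in> space m"
    then have "0 < \<rho> v" by (rule \<rho>_pos)
    then show "ennreal (1 / \<rho> v) * ennreal (\<rho> v * \<bar>g v\<bar> powr a) = ennreal (\<bar>g v\<bar> powr a)"
      by (subst ennreal_mult[symmetric]) auto
  qed
  finally show ?thesis .
qed

lemma AE_summable_kernel:
  assumes [measurable]: "g \<in> borel_measurable m" and a: "0 < a" "a < 2"
    and fin: "(\<integral>\<^sup>+v. ennreal (\<bar>g v\<bar> powr a) \<partial>m) < \<infinity>"
  shows "AE \<omega> in M. summable (\<lambda>i. \<gamma> i \<omega> * kernel a g (\<Gamma> i \<omega>, V i \<omega>))"
proof (rule AE_summable_series)
  have "(\<integral>\<^sup>+v. \<integral>\<^sup>+x. indicator {0..} x * ennreal (min 1 ((kernel a g (x, v))\<^sup>2 / 1\<^sup>2)) \<partial>lborel \<partial>mhat)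
    \<le> ennreal (2 / (2 - a) * 1 powr (-a)) * (\<integral>\<^sup>+v. ennreal (\<bar>g v\<bar> powr a) \<partial>m)"
    by (rule nn_integral_kernel_le) (use a in auto)
  also have "\<dots> < \<infinity>" using fin by (simp add: ennreal_mult_less_top)
  finally show "(\<integral>\<^sup>+v. \<integral>\<^sup>+x. indicator {0..} x * ennreal (min 1 ((kernel a g (x, v))\<^sup>2)) \<partial>lborel \<partial>mhat) < \<infinity>"
    by simp
qed measurable

text \<open>The factor \<open>2 / (2 - a)\<close> increases with \<open>a\<close>; replacing it by
  its value at \<open>d\<close> and lowering the order to \<open>q\<close> makes the bound uniform
  over indices between \<open>q\<close> and \<open>d\<close>.\<close>

lemma series_kernel_tail:
  assumes [measurable]: "g \<in> borel_measurable m" and a: "0 < a" "a \<le> d" "d < 2" and q: "0 < q" "q \<le> a"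
    and B: "(\<integral>\<^sup>+v. ennreal (\<bar>g v\<bar> powr a) \<partial>m) \<le> ennreal B" "0 \<le> B"
  shows "tail_bounded M (series (kernel a g)) (max 1 (2 / (2 - d) * B)) q"
proof (rule tail_boundedI[OF prob_space_axioms _ q(2,1)])
  show "random_variable borel (series (kernel a g))" by (rule measurable_series) measurable
  show "0 \<le> 2 / (2 - d) * B" using a B by simp
  fix l :: real assume l: "0 < l"
  have "emeasure M {\<omega>\<in>space M. l < \<bar>series (kernel a g) \<omega>\<bar>} \<le>
     (\<integral>\<^sup>+v. \<integral>\<^sup>+x. indicator {0..} x * ennreal (min 1 ((kernel a g (x, v))\<^sup>2 / l\<^sup>2)) \<partial>lborel \<partial>mhat)"
    by (rule series_tail[OF _ l]) measurable
  also have "\<dots> \<le> ennreal (2 / (2 - a) * l powr (-a)) * (\<integral>\<^sup>+v. ennreal (\<bar>g v\<bar> powr a) \<partial>m)"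
    using a by (intro nn_integral_kernel_le l) auto
  also have "\<dots> \<le> ennreal (2 / (2 - d) * l powr (-a)) * ennreal B"
    using a B by (intro mult_mono ennreal_leI mult_right_mono divide_left_mono) auto
  also have "\<dots> = ennreal (2 / (2 - d) * B * l powr (-a))"
    using a B by (subst ennreal_mult[symmetric]) (auto simp: mult_ac)
  finally show "emeasure M {\<omega>\<in>space M. l < \<bar>series (kernel a g) \<omega>\<bar>} \<le> ennreal (2 / (2 - d) * B * l powr (-a))" .
qed

lemma field_sigma_finite_eq_series:
  "field_sigma_finite \<rho> \<alpha> b f \<Gamma> V \<gamma> s u \<omega> = b u * stable_const (\<alpha> u) powr (1 / \<alpha> u) * series (kernel (\<alpha> u) (f s u)) \<omega>"
  by (simp add: field_sigma_finite_def series_def kernel_def mult.assoc)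

lemma series_diff:
  assumes "summable (\<lambda>i. \<gamma> i \<omega> * T (\<Gamma> i \<omega>, V i \<omega>))" "summable (\<lambda>i. \<gamma> i \<omega> * T' (\<Gamma> i \<omega>, V i \<omega>))"
  shows "series (\<lambda>p. T p - T' p) \<omega> = series T \<omega> - series T' \<omega>"
  unfolding series_def suminf_diff[OF assms] by (simp add: right_diff_distrib)

end

section \<open>Increments in the stability index\<close>

lemma ennreal_enn2real_finite: "x \<noteq> \<infinity> \<Longrightarrow> x = ennreal (enn2real x)"
  by (cases x) auto

context stable_kernel
begin

lemma kernel_diff: "kernel a (\<lambda>x. g x - g' x) p = kernel a g p - kernel a g' p"
  by (simp add: kernel_def algebra_simps)

lemma kernel_divide: "kernel a (\<lambda>x. g x / k) p = kernel a g p / k"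
  by (simp add: kernel_def)

text \<open>The estimate for a single mark \<open>x\<close>. If one of the suprema is infinite, so
  is the right side, as \<open>\<rho> x\<close> and \<open>k\<close> are positive. Otherwise a
  common bound \<open>Z\<close> for the suprema times \<open>\<rho> x\<close> feeds the mean value
  estimate, with \<open>\<theta> = D * (u - t) / l\<close>.\<close>

lemma kernel_increment_slice:
  fixes g :: "real \<Rightarrow> 'e \<Rightarrow> real"
  assumes x: "x \<in> space m" and diff: "\<And>w. w \<in> U \<Longrightarrow> (\<lambda>w. g w x) differentiable (at w)"
    and tu: "t < u" "{t..u} \<subseteq> U" and c: "0 < c" "c \<le> d"
    and \<alpha>: "\<And>w. w \<in> U \<Longrightarrow> c \<le> \<alpha> w \<and> \<alpha> w \<le> d"
      "\<And>w. t \<le> w \<Longrightarrow> w \<le> u \<Longrightarrow> (\<alpha> has_real_derivative \<alpha>' w) (at w) \<and> \<bar>\<alpha>' w\<bar> \<le> A"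
    and \<beta>: "1 / c < \<beta>1" "1 / 2 < \<beta>2" "\<beta>2 < 1 / d"
    and \<delta>: "1 / (c * \<beta>2) \<le> 1 + \<delta>1" "1 / (c * \<beta>2) \<le> 1 + \<delta>2" "1 / (c * \<beta>2) \<le> 1 + \<delta>3"
    and D: "D = 1 + A / c\<^sup>2 * (1 + 1 / min (\<beta>1 - 1 / c) (1 / d - \<beta>2))"
    and l: "0 < l" "2 * (D * (u - t) / l) \<le> 1"
    and k: "k = (2 * \<beta>1 / (2 * \<beta>1 - 1) + 2 * \<beta>2 / (2 * \<beta>2 - 1)) * (2 * (D * (u - t) / l)) powr (1 / \<beta>1)"
  shows "ennreal (1 / \<rho> x) * (\<integral>\<^sup>+y. indicator {0..} y * ennreal (min 1 ((kernel (\<alpha> u) (g u) (y, x) - kernel (\<alpha> t) (g t) (y, x))\<^sup>2 / l\<^sup>2)) \<partial>lborel)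
    \<le> ennreal k * (ennreal (1 / \<rho> x) + sup_density U \<alpha> \<rho> \<delta>1 g x + sup_density U \<alpha> \<rho> \<delta>3 (\<lambda>w x. g w x * ln (\<rho> x)) x
        + sup_density U \<alpha> \<rho> \<delta>2 (\<lambda>w x. deriv (\<lambda>w. g w x) w) x)" (is "?lhs \<le> _ * (_ + ?d1 + ?d3 + ?d2)")
proof -
  let ?S = "\<lambda>g. SUP w\<in>U. ennreal (\<bar>g w x\<bar> powr \<alpha> w)"
  let ?g' = "\<lambda>w x. deriv (\<lambda>w. g w x) w" and ?gl = "\<lambda>w x. g w x * ln (\<rho> x)"
  have r: "0 < \<rho> x" using x by (rule \<rho>_pos)
  have A: "0 \<le> A" using \<alpha>(2)[of t] tu by auto
  have \<kappa>: "0 < min (\<beta>1 - 1 / c) (1 / d - \<beta>2)" using \<beta> by simp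
  have D1: "1 \<le> D" unfolding D using A c \<kappa> by auto
  have "1 / d \<le> 1 / c" using c by (intro divide_left_mono) auto
  then have \<beta>12: "\<beta>2 \<le> \<beta>1" "1/2 < \<beta>1" using \<beta> by auto
  have \<theta>: "0 < D * (u - t) / l" using D1 tu l by auto
  have k0: "0 < k" unfolding k using \<beta> \<beta>12 \<theta> by (intro mult_pos_pos add_pos_pos) auto
  show ?thesis
  proof (cases "?S g = \<infinity> \<or> ?S ?g' = \<infinity> \<or> ?S ?gl = \<infinity>")
    case True
    then have "?d1 = \<infinity> \<or> ?d2 = \<infinity> \<or> ?d3 = \<infinity>"       using sup_density_top[where \<rho>=\<rho> and x=x and U=U and g="g" and \<alpha>=\<alpha> and \<delta>="\<delta>1", OF r] sup_density_top[where \<rho>=\<rho> and x=x and U=U and g="?g'" and \<alpha>=\<alpha> and \<delta>="\<delta>2", OF r]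
        sup_density_top[where \<rho>=\<rho> and x=x and U=U and g="?gl" and \<alpha>=\<alpha> and \<delta>="\<delta>3", OF r] by argo
    then show ?thesis using k0 by (auto simp: ennreal_mult_top)
  next
    case False
    define s1 s2 s3 where "s1 = enn2real (?S g)" and "s2 = enn2real (?S ?g')" and "s3 = enn2real (?S ?gl)"
    have s: "?S g = ennreal s1" "0 \<le> s1" "?S ?g' = ennreal s2" "0 \<le> s2" "?S ?gl = ennreal s3" "0 \<le> s3"
      unfolding s1_def s2_def s3_def using False by (blast intro: ennreal_enn2real_finite enn2real_nonneg)+
    note d1 = sup_density_finite[where \<rho>=\<rho> and x=x and U=U and g="g" and \<alpha>=\<alpha> and S=s1, OF r s(1,2)]
    note d2 = sup_density_finite[where \<rho>=\<rho> and x=x and U=U and g="?g'" and \<alpha>=\<alpha> and S=s2, OF r s(3,4)]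
    note d3 = sup_density_finite[where \<rho>=\<rho> and x=x and U=U and g="?gl" and \<alpha>=\<alpha> and S=s3, OF r s(5,6)]
    \<comment> \<open>The lower bound 1 makes all changes of exponent monotone. It is paid for by
      the summand \<open>ennreal (1 / \<rho> x)\<close>, whose integral is 1.\<close>
    define Z where "Z = max 1 (max (\<rho> x * s1) (max (\<rho> x * s3) (\<rho> x * s2)))"
    have Z: "1 \<le> Z" "\<rho> x * s1 \<le> Z" "\<rho> x * s2 \<le> Z" "\<rho> x * s3 \<le> Z" by (auto simp: Z_def)
    define p where "p = 1 / (c * \<beta>2)"
    have p: "0 \<le> p" using c \<beta> by (simp add: p_def)
    let ?T = "\<lambda>y. (kernel (\<alpha> u) (g u) (y, x) - kernel (\<alpha> t) (g t) (y, x)) / l"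
    have "\<bar>?T y\<bar> \<le> D * (u - t) / l * Z powr (1 / c) * (y powr (-\<beta>1) + y powr (-\<beta>2))" if y: "0 < y" for y
    proof -
      have w: "w \<in> U" if "t \<le> w" "w \<le> u" for w using tu that by auto
      have "\<bar>kernel (\<alpha> u) (g u) (y, x) - kernel (\<alpha> t) (g t) (y, x)\<bar> \<le>
          (u - t) * D * Z powr (1 / c) * (y powr (-\<beta>1) + y powr (-\<beta>2))"
        unfolding D kernel_def fst_conv snd_conv
      proof (rule kernel_increment_bound[OF y r tu(1) c(1) \<beta>(1,3), where \<phi>="\<lambda>w. g w x" and \<phi>'="\<lambda>w. deriv (\<lambda>w. g w x) w" and \<alpha>'=\<alpha>'])
        fix w assume w': "t \<le> w" "w \<le> u"
        note wU = w[OF w']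
        show "c \<le> \<alpha> w \<and> \<alpha> w \<le> d" by (rule \<alpha>(1)[OF wU])
        show "(\<alpha> has_real_derivative \<alpha>' w) (at w) \<and> \<bar>\<alpha>' w\<bar> \<le> A" by (rule \<alpha>(2)[OF w'])
        show "((\<lambda>w. g w x) has_real_derivative deriv (\<lambda>w. g w x) w) (at w)"
          using diff[OF wU] by (simp add: DERIV_deriv_iff_real_differentiable)
        show "\<rho> x * \<bar>g w x\<bar> powr \<alpha> w \<le> Z"
          by (rule order_trans[OF mult_left_mono Z(2)]) (use d1(2)[OF wU] r in auto)
        show "\<rho> x * \<bar>deriv (\<lambda>w. g w x) w\<bar> powr \<alpha> w \<le> Z"
          by (rule order_trans[OF mult_left_mono Z(3)]) (use d2(2)[OF wU] r in auto)
        show "\<rho> x * \<bar>g w x * ln (\<rho> x)\<bar> powr \<alpha> w \<le> Z"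
          by (rule order_trans[OF mult_left_mono Z(4)]) (use d3(2)[OF wU] r in auto)
      qed (rule Z(1))
      then have "\<bar>kernel (\<alpha> u) (g u) (y, x) - kernel (\<alpha> t) (g t) (y, x)\<bar> / l \<le>
          (u - t) * D * Z powr (1 / c) * (y powr (-\<beta>1) + y powr (-\<beta>2)) / l"
        using l by (intro divide_right_mono) auto
      then show ?thesis using l by (simp add: mult_ac)
    qed
    then have "(\<integral>\<^sup>+y. indicator {0..} y * ennreal (min 1 ((?T y)\<^sup>2)) \<partial>lborel) \<le> ennreal (k * Z powr p)"
      unfolding k by (rule nn_integral_min_two_powers_le) (use \<beta> \<beta>12 c Z \<theta> l in \<open>auto simp: p_def\<close>)
    then have "?lhs \<le> ennreal (1 / \<rho> x) * ennreal (k * Z powr p)"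
      by (intro mult_left_mono) (auto simp: power_divide)
    also have "\<dots> = ennreal (k * (1 / \<rho> x * Z powr p))"
      using r k0 by (subst ennreal_mult[symmetric]) (auto simp: mult_ac)
    \<comment> \<open>As \<open>p\<close> is at most each of the \<open>1 + \<delta>1\<close>,
      \<open>1 + \<delta>2\<close>, \<open>1 + \<delta>3\<close>, the power of the maximum splits
      into the powers that occur in the three densities.\<close>
    also have "\<dots> \<le> ennreal (k * (1 / \<rho> x * (1 + (\<rho> x * s1) powr (1 + \<delta>1) + (\<rho> x * s3) powr (1 + \<delta>3) + (\<rho> x * s2) powr (1 + \<delta>2))))"
      unfolding Z_def using r s k0 p \<delta>[folded p_def] by (intro ennreal_leI mult_left_mono powr_max_le_sum) auto
    also have "1 / \<rho> x * (1 + (\<rho> x * s1) powr (1 + \<delta>1) + (\<rho> x * s3) powr (1 + \<delta>3) + (\<rho> x * s2) powr (1 + \<delta>2)) =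
       1 / \<rho> x + 1 / \<rho> x * (\<rho> x * s1) powr (1 + \<delta>1) + 1 / \<rho> x * (\<rho> x * s3) powr (1 + \<delta>3) + 1 / \<rho> x * (\<rho> x * s2) powr (1 + \<delta>2)"
      by (simp only: distrib_left mult_1_right)
    also have "ennreal (k * \<dots>) = ennreal k * (ennreal (1 / \<rho> x) + ?d1 + ?d3 + ?d2)"
      unfolding d1(1) d2(1) d3(1) using r k0 by (simp add: ennreal_mult ennreal_plus)
    finally show ?thesis .
  qed
qed

text \<open>The supremum of the derivatives over the uncountable set \<open>U\<close> need not be measurable, so its
  integral is only a lower integral; the other two suprema reduce to rational arguments.\<close>

lemma series_increment_tail:
  fixes g :: "real \<Rightarrow> 'e \<Rightarrow> real"
  assumes U: "open U" and g[measurable]: "\<And>w. w \<in> U \<Longrightarrow> g w \<in> borel_measurable m"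
    and diff: "AE x in m. \<forall>w\<in>U. (\<lambda>w. g w x) differentiable (at w)"
    and tu: "t < u" "{t..u} \<subseteq> U" and c: "0 < c" "c \<le> d"
    and \<alpha>: "\<And>w. w \<in> U \<Longrightarrow> c \<le> \<alpha> w \<and> \<alpha> w \<le> d" "continuous_on U \<alpha>"
      "\<And>w. t \<le> w \<Longrightarrow> w \<le> u \<Longrightarrow> (\<alpha> has_real_derivative \<alpha>' w) (at w) \<and> \<bar>\<alpha>' w\<bar> \<le> A"
    and \<beta>: "1 / c < \<beta>1" "1 / 2 < \<beta>2" "\<beta>2 < 1 / d"
    and \<delta>: "1 / (c * \<beta>2) \<le> 1 + \<delta>1" "1 / (c * \<beta>2) \<le> 1 + \<delta>2" "1 / (c * \<beta>2) \<le> 1 + \<delta>3"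
    and K: "0 \<le> K1" "0 \<le> K2" "0 \<le> K3"
      "(\<integral>\<^sup>+x. sup_density U \<alpha> \<rho> \<delta>1 g x \<partial>m) \<le> ennreal K1"
      "(\<integral>\<^sup>+x. sup_density U \<alpha> \<rho> \<delta>2 (\<lambda>w x. deriv (\<lambda>w. g w x) w) x \<partial>m) \<le> ennreal K2"
      "(\<integral>\<^sup>+x. sup_density U \<alpha> \<rho> \<delta>3 (\<lambda>w x. g w x * ln (\<rho> x)) x \<partial>m) \<le> ennreal K3"
    and D: "D = 1 + A / c\<^sup>2 * (1 + 1 / min (\<beta>1 - 1 / c) (1 / d - \<beta>2))"
    and C: "C = max 1 ((2 * \<beta>1 / (2 * \<beta>1 - 1) + 2 * \<beta>2 / (2 * \<beta>2 - 1)) * (1 + K1 + K3 + K2))"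
  shows "tail_bounded M (series (\<lambda>p. kernel (\<alpha> u) (g u) p - kernel (\<alpha> t) (g t) p))
    (C * (2 * D * (u - t)) powr (1 / \<beta>1)) (1 / \<beta>1)"
  unfolding tail_bounded_def
proof (intro conjI allI impI)
  have [measurable]: "g u \<in> borel_measurable m" "g t \<in> borel_measurable m" using tu by (auto intro!: g)
  let ?T = "\<lambda>p. kernel (\<alpha> u) (g u) p - kernel (\<alpha> t) (g t) p"
  let ?P = "\<lambda>l. prob {\<omega>\<in>space M. l < \<bar>series ?T \<omega>\<bar>}"
  let ?K = "1 + K1 + K3 + K2"
  let ?c = "2 * \<beta>1 / (2 * \<beta>1 - 1) + 2 * \<beta>2 / (2 * \<beta>2 - 1)"
  show "random_variable borel (series ?T)" by (rule measurable_series) measurable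
  have "1 / d \<le> 1 / c" using c by (intro divide_left_mono) auto
  then have \<beta>12: "1/2 < \<beta>1" using \<beta> by auto
  have A: "0 \<le> A" using \<alpha>(3)[of t] tu by auto
  have "0 < min (\<beta>1 - 1 / c) (1 / d - \<beta>2)" using \<beta> by simp
  then have D1: "1 \<le> D" unfolding D using A c by auto
  have C1: "1 \<le> C" by (simp add: C)
  fix l :: real assume l: "0 < l"
  let ?\<theta> = "2 * (D * (u - t) / l)"
  have \<theta>: "0 < 2 * (D * (u - t) / l)" using D1 tu l by auto
  have eq: "(2 * D * (u - t)) powr (1 / \<beta>1) * l powr (- (1 / \<beta>1)) = ?\<theta> powr (1 / \<beta>1)"
    using D1 tu l by (simp add: powr_divide powr_minus_divide mult.assoc)
  have "?P l \<le> C * ?\<theta> powr (1 / \<beta>1)"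
  proof (cases "2 * (D * (u - t) / l) \<le> 1")
    \<comment> \<open>Here \<open>?\<theta>\<close> exceeds 1, and so does the claimed bound,
      because \<open>C\<close> is at least 1.\<close>
    case False
    have "?P l \<le> 1 * 1" by simp
    also have "\<dots> \<le> C * ?\<theta> powr (1 / \<beta>1)"
      using False \<beta>12 C1 by (intro mult_mono ge_one_powr_ge_zero) auto
    finally show ?thesis .
  next
    case True
    define k where "k = ?c * ?\<theta> powr (1 / \<beta>1)"
    have k0: "0 < k" unfolding k_def using \<beta> \<beta>12 \<theta> by (intro mult_pos_pos add_pos_pos) auto
    interpret mh: prob_space mhat by (rule prob_space_mhat)
    let ?H = "\<lambda>x. \<integral>\<^sup>+y. indicator {0..} y * ennreal (min 1 ((?T (y, x))\<^sup>2 / l\<^sup>2)) \<partial>lborel"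
    let ?J = "\<integral>\<^sup>+x. ennreal (1 / \<rho> x) * ?H x \<partial>m"
    have [measurable]: "?H \<in> borel_measurable m"
    proof -
      have "(\<lambda>(x, y). indicator {0..} y * ennreal (min 1 ((?T (y, x))\<^sup>2 / l\<^sup>2))) \<in> borel_measurable (mhat \<Otimes>\<^sub>M lborel)"
        by measurable
      from lborel.borel_measurable_nn_integral_fst[OF this] show ?thesis
        by (simp cong: measurable_cong_sets add: sets_mhat)
    qed
    let ?gl = "\<lambda>w x. g w x * ln (\<rho> x)"
    let ?d1 = "sup_density U \<alpha> \<rho> \<delta>1 g" and ?d1' = "sup_density (U \<inter> \<rat>) \<alpha> \<rho> \<delta>1 g"
    let ?d3 = "sup_density U \<alpha> \<rho> \<delta>3 ?gl" and ?d3' = "sup_density (U \<inter> \<rat>) \<alpha> \<rho> \<delta>3 ?gl"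
    let ?d2 = "sup_density U \<alpha> \<rho> \<delta>2 (\<lambda>w x. deriv (\<lambda>w. g w x) w)"
    have [measurable]: "?d1' \<in> borel_measurable m" "?d3' \<in> borel_measurable m"
      by (rule measurable_sup_density_countable; measurable)+
    have d13: "AE x in m. ?d1 x = ?d1' x \<and> ?d3 x = ?d3' x"
      using diff
    proof eventually_elim
      case (elim x)
      then have "continuous_on U (\<lambda>w. g w x)"
        by (intro continuous_at_imp_continuous_on ballI differentiable_imp_continuous_within) auto
      then show ?case
        using \<alpha>(1) c by (intro conjI sup_density_countable[OF U] \<alpha>(2) continuous_intros) (auto intro: less_le_trans)
    qed
    \<comment> \<open>Dividing by \<open>k\<close> leaves the derivative density \<open>?d2\<close>
      as a separate summand with coefficient 1, the form in which a possibly nonmeasurable function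
      can be added.\<close>
    have slice: "AE x in m. ennreal (1 / k) * (ennreal (1 / \<rho> x) * ?H x) \<le> (ennreal (1 / \<rho> x) + ?d1' x + ?d3' x) + ?d2 x"
      using diff d13 AE_space
    proof eventually_elim
      case (elim x)
      have "ennreal (1 / \<rho> x) * ?H x \<le> ennreal k * (ennreal (1 / \<rho> x) + ?d1 x + ?d3 x + ?d2 x)"
        using elim by (intro kernel_increment_slice[OF _ _ tu c \<alpha>(1,3) \<beta> \<delta> D l True k_def]) auto
      then have "ennreal (1 / k) * (ennreal (1 / \<rho> x) * ?H x) \<le> ennreal (1 / k) * (ennreal k * (ennreal (1 / \<rho> x) + ?d1 x + ?d3 x + ?d2 x))"
        by (intro mult_left_mono) auto
      also have "\<dots> = ennreal (1 / k) * ennreal k * (ennreal (1 / \<rho> x) + ?d1 x + ?d3 x + ?d2 x)"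
        by (simp only: mult.assoc)
      also have "ennreal (1 / k) * ennreal k = 1" using k0 by (subst ennreal_mult[symmetric]) auto
      finally show ?case using elim by simp
    qed
    have "ennreal (1 / k) * ?J = (\<integral>\<^sup>+x. ennreal (1 / k) * (ennreal (1 / \<rho> x) * ?H x) \<partial>m)"
      by (rule nn_integral_cmult[symmetric]) measurable
    also have "\<dots> \<le> (\<integral>\<^sup>+x. ennreal (1 / \<rho> x) + ?d1' x + ?d3' x \<partial>m) + (\<integral>\<^sup>+x. ?d2 x \<partial>m)"
      by (rule nn_integral_le_add_nonmeasurable[OF _ _ slice]) measurable
    also have "(\<integral>\<^sup>+x. ennreal (1 / \<rho> x) + ?d1' x + ?d3' x \<partial>m) = 1 + (\<integral>\<^sup>+x. ?d1' x \<partial>m) + (\<integral>\<^sup>+x. ?d3' x \<partial>m)"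
      by (simp add: nn_integral_add nn_integral_inverse_\<rho>)
    also have "(\<integral>\<^sup>+x. ?d1' x \<partial>m) = (\<integral>\<^sup>+x. ?d1 x \<partial>m)"
      using d13 by (intro nn_integral_cong_AE) auto
    also have "(\<integral>\<^sup>+x. ?d3' x \<partial>m) = (\<integral>\<^sup>+x. ?d3 x \<partial>m)"
      using d13 by (intro nn_integral_cong_AE) auto
    also have "1 + (\<integral>\<^sup>+x. ?d1 x \<partial>m) + (\<integral>\<^sup>+x. ?d3 x \<partial>m) + (\<integral>\<^sup>+x. ?d2 x \<partial>m) \<le> 1 + ennreal K1 + ennreal K3 + ennreal K2"
      using K by (intro add_mono) auto
    also have "\<dots> = ennreal ?K"
      using K by (simp add: ennreal_plus)
    finally have "ennreal (1 / k) * ?J \<le> ennreal ?K" .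
    then have "ennreal k * (ennreal (1 / k) * ?J) \<le> ennreal k * ennreal ?K"
      by (intro mult_left_mono) auto
    then have int: "?J \<le> ennreal (k * ?K)"
    proof -
      assume le: "ennreal k * (ennreal (1 / k) * ?J) \<le> ennreal k * ennreal ?K"
      have "ennreal k * ennreal (1 / k) = 1" using k0 by (subst ennreal_mult[symmetric]) auto
      moreover have "ennreal k * ennreal ?K = ennreal (k * ?K)"
        using k0 K by (intro ennreal_mult[symmetric]) auto
      ultimately show ?thesis using le by (simp only: mult.assoc[symmetric] mult_1_left)
    qed
    have "emeasure M {\<omega>\<in>space M. l < \<bar>series ?T \<omega>\<bar>} \<le> (\<integral>\<^sup>+x. ?H x \<partial>mhat)"
      by (rule series_tail[OF _ l]) measurable
    also have "\<dots> = ?J" by (rule nn_integral_mhat) measurable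
    also note int
    finally have "?P l \<le> k * ?K"
      using k0 K by (simp add: emeasure_eq_measure)
    also have "\<dots> \<le> C * ?\<theta> powr (1 / \<beta>1)"
    proof -
      have "k * ?K = (?c * ?K) * ?\<theta> powr (1 / \<beta>1)"
        by (simp only: k_def mult_ac)
      also have "\<dots> \<le> C * ?\<theta> powr (1 / \<beta>1)"
        by (intro mult_right_mono) (simp_all add: C)
      finally show ?thesis .
    qed
    finally show ?thesis .
  qed
  then show "?P l \<le> C * (2 * D * (u - t)) powr (1 / \<beta>1) * l powr (- (1 / \<beta>1))"
    unfolding mult.assoc[of C] eq .
qed

text \<open>Apply \<open>y \<le> 1 + y powr (1 + \<delta>)\<close> to
  \<open>y = \<rho> x * s\<close>, where \<open>s\<close> is the supremum, and divide by
  \<open>\<rho> x\<close>. The resulting bound does not depend on \<open>w\<close>, as the tail of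
  the series next to the varying prefactor requires.\<close>

lemma nn_integral_slice_le:
  assumes g[measurable]: "g w \<in> borel_measurable m" and w: "w \<in> U" and \<delta>: "0 \<le> \<delta>"
    and K: "0 \<le> K" "(\<integral>\<^sup>+x. sup_density U \<alpha> \<rho> \<delta> g x \<partial>m) \<le> ennreal K"
  shows "(\<integral>\<^sup>+x. ennreal (\<bar>g w x\<bar> powr \<alpha> w) \<partial>m) \<le> ennreal (1 + K)"
proof -
  have "(\<integral>\<^sup>+x. ennreal (\<bar>g w x\<bar> powr \<alpha> w) \<partial>m) \<le> (\<integral>\<^sup>+x. ennreal (1 / \<rho> x) \<partial>m) + (\<integral>\<^sup>+x. sup_density U \<alpha> \<rho> \<delta> g x \<partial>m)"
  proof (rule nn_integral_le_add_nonmeasurable)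
    show "AE x in m. ennreal (\<bar>g w x\<bar> powr \<alpha> w) \<le> ennreal (1 / \<rho> x) + sup_density U \<alpha> \<rho> \<delta> g x"
    proof (rule AE_I2)
      fix x assume "x \<in> space m"
      then have r: "0 < \<rho> x" by (rule \<rho>_pos)
      let ?S = "SUP w\<in>U. ennreal (\<bar>g w x\<bar> powr \<alpha> w)"
      show "ennreal (\<bar>g w x\<bar> powr \<alpha> w) \<le> ennreal (1 / \<rho> x) + sup_density U \<alpha> \<rho> \<delta> g x"
      proof (cases "?S = \<infinity>")
        case True
        then show ?thesis using sup_density_top[where \<rho>=\<rho> and x=x and U=U and g="g" and \<alpha>=\<alpha> and \<delta>="\<delta>", OF r True] by simp
      next
        case False
        define s where "s = enn2real ?S"
        have s: "?S = ennreal s" "0 \<le> s"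
          unfolding s_def using ennreal_enn2real_finite[OF False] enn2real_nonneg by blast+
        note d = sup_density_finite[where \<rho>=\<rho> and x=x and U=U and g="g" and \<alpha>=\<alpha> and S=s, OF r s]
        have "\<rho> x * s \<le> 1 + (\<rho> x * s) powr (1 + \<delta>)"
        proof (cases "\<rho> x * s \<le> 1")
          case False
          then have "(\<rho> x * s) powr 1 \<le> (\<rho> x * s) powr (1 + \<delta>)" using \<delta> by (intro powr_mono) auto
          then show ?thesis using False by simp
        qed (simp add: add_increasing2)
        then have "1 / \<rho> x * (\<rho> x * s) \<le> 1 / \<rho> x * (1 + (\<rho> x * s) powr (1 + \<delta>))"
          using r by (intro mult_left_mono) auto
        then have "\<bar>g w x\<bar> powr \<alpha> w \<le> 1 / \<rho> x + 1 / \<rho> x * (\<rho> x * s) powr (1 + \<delta>)"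
          using d(2)[OF w] r by (simp add: distrib_left)
        then show ?thesis
          unfolding d(1) using r by (simp only: ennreal_plus[symmetric] zero_le_divide_1_iff less_imp_le
              mult_nonneg_nonneg powr_ge_zero ennreal_leI)
      qed
    qed
  qed measurable
  also have "\<dots> \<le> 1 + ennreal K" using K by (intro add_mono) (auto simp: nn_integral_inverse_\<rho>)
  also have "\<dots> = ennreal (1 + K)" using K by (simp add: ennreal_plus)
  finally show ?thesis .
qed

end

section \<open>Increments of the diagonal process\<close>

lemma eventually_at_right_shift:
  fixes t :: real
  assumes "eventually P (nhds t)"
  shows "eventually (\<lambda>\<epsilon>. P (t + \<epsilon>)) (at_right 0)"
proof -
  have "((\<lambda>\<epsilon>. t + \<epsilon>) \<longlongrightarrow> t + 0) (at_right 0)"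
    by (intro tendsto_intros)
  then show ?thesis using assms by (simp add: filterlim_iff)
qed

lemma real_deriv_of_C1:
  assumes "g C1_differentiable_on U"
  obtains g' where "\<And>x. x \<in> U \<Longrightarrow> (g has_real_derivative g' x) (at x)" "continuous_on U g'"
  using assms unfolding C1_differentiable_on_def has_real_derivative_iff_has_vector_derivative by auto

context stable_kernel
begin

lemma AE_summable_field:
  assumes f: "f s u \<in> F_space (\<alpha> u) m" and a: "0 < \<alpha> u" "\<alpha> u < 2"
  shows "AE \<omega> in M. summable (\<lambda>i. \<gamma> i \<omega> * kernel (\<alpha> u) (f s u) (\<Gamma> i \<omega>, V i \<omega>))"
  using f a by (intro AE_summable_kernel) (auto simp: F_space_def)

lemma measurable_field:
  assumes f: "f s u \<in> F_space (\<alpha> u) m"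
  shows "random_variable borel (field_sigma_finite \<rho> \<alpha> b f \<Gamma> V \<gamma> s u)"
proof -
  have [measurable]: "f s u \<in> borel_measurable m" using f by (simp add: F_space_def)
  have [measurable]: "random_variable borel (series (kernel (\<alpha> u) (f s u)))"
    by (rule measurable_series) measurable
  show ?thesis unfolding field_sigma_finite_eq_series[abs_def] by measurable
qed

text \<open>Each of the three pieces, divided by \<open>\<epsilon> powr H\<close>, gets a tail of
  order \<open>q\<close> with a constant free of \<open>\<epsilon>\<close>. For the first two this
  rests on \<open>\<epsilon> \<le> \<epsilon> powr H\<close>; the third is the series of the
  rescaled kernel, whose integral is at most \<open>K\<close> by \<open>cond4\<close>.\<close>

lemma diagonal_increment_tail:
  fixes f :: "real \<Rightarrow> real \<Rightarrow> 'e \<Rightarrow> real"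
  assumes U: "open U" "t \<in> U"
    and cd: "0 < c" "c \<le> d" "d < 2"
    and \<alpha>: "\<alpha> C1_differentiable_on U" "\<alpha> ` U \<subseteq> {c..d}"
    and b: "b C1_differentiable_on U"
    and f: "\<forall>s\<in>U. \<forall>u\<in>U. f s u \<in> F_space (\<alpha> u) m"
    and cond1: "\<forall>s\<in>U. AE x in m. \<forall>v\<in>U. (\<lambda>w. f s w x) differentiable (at v)"
    and cond2: "sup_cond_sigma_finite U \<alpha> c d m \<rho> f"
      "sup_cond_sigma_finite U \<alpha> c d m \<rho> (\<lambda>s w x. deriv (\<lambda>v. f s v x) w)"
      "sup_cond_sigma_finite U \<alpha> c d m \<rho> (\<lambda>s w x. f s w x * ln (\<rho> x))"
    and \<eta>: "0 < \<eta>" "\<eta> < c" and H: "0 < H" "H < 1"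
    and cond4: "\<exists>\<epsilon>0>0. \<exists>K>0. \<forall>r. 0 < r \<and> r < \<epsilon>0 \<longrightarrow>
      ennreal (1 / r powr (H * \<alpha> t)) *
        (\<integral>\<^sup>+x. ennreal (\<bar>f (t + r) t x - f t t x\<bar> powr \<alpha> t) \<partial>m) \<le> ennreal K"
  shows "\<exists>C q. \<eta> < q \<and> (\<forall>\<^sub>F \<epsilon> in at_right 0. tail_bounded M
    (\<lambda>\<omega>. (field_sigma_finite \<rho> \<alpha> b f \<Gamma> V \<gamma> (t + \<epsilon>) (t + \<epsilon>) \<omega> -
         field_sigma_finite \<rho> \<alpha> b f \<Gamma> V \<gamma> t t \<omega>) / \<epsilon> powr H) C q)"
proof -
  obtain \<delta>1 K1 where 1: "d / c - 1 < \<delta>1" "0 \<le> K1" "\<And>s. s \<in> U \<Longrightarrow> (\<integral>\<^sup>+x. sup_density U \<alpha> \<rho> \<delta>1 (f s) x \<partial>m) \<le> ennreal K1"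
    by (rule sup_cond_sigma_finiteE[OF cond2(1)]) blast
  obtain \<delta>2 K2 where 2: "d / c - 1 < \<delta>2" "0 \<le> K2"
      "\<And>s. s \<in> U \<Longrightarrow> (\<integral>\<^sup>+x. sup_density U \<alpha> \<rho> \<delta>2 (\<lambda>w x. deriv (\<lambda>v. f s v x) w) x \<partial>m) \<le> ennreal K2"
    by (rule sup_cond_sigma_finiteE[OF cond2(2)]) blast
  obtain \<delta>3 K3 where 3: "d / c - 1 < \<delta>3" "0 \<le> K3"
      "\<And>s. s \<in> U \<Longrightarrow> (\<integral>\<^sup>+x. sup_density U \<alpha> \<rho> \<delta>3 (\<lambda>w x. f s w x * ln (\<rho> x)) x \<partial>m) \<le> ennreal K3"
    by (rule sup_cond_sigma_finiteE[OF cond2(3)]) blast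
  \<comment> \<open>The three conditions may hold with different exponents; the smallest one governs
    the choice of \<open>\<beta>2\<close>.\<close>
  define \<delta> where "\<delta> = min \<delta>1 (min \<delta>2 \<delta>3)"
  have \<delta>: "d / c - 1 < \<delta>" "\<delta> \<le> \<delta>1" "\<delta> \<le> \<delta>2" "\<delta> \<le> \<delta>3" using 1 2 3 by (auto simp: \<delta>_def)
  have dc: "1 \<le> d / c" using cd by simp
  then have \<delta>0: "0 < \<delta>" using \<delta> by simp
  have \<delta>1: "0 \<le> \<delta>1" using \<delta> \<delta>0 by simp
  \<comment> \<open>Any order strictly between \<open>\<eta>\<close> and \<open>c\<close> would do:
    above \<open>\<eta>\<close> for the convergence of moments, below \<open>c\<close> so that
    \<open>\<beta>1 = 1 / q\<close> exceeds \<open>1 / c\<close>.\<close>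
  define q where "q = (\<eta> + c) / 2"
  define \<beta>1 where "\<beta>1 = 1 / q"
  have q: "0 < q" "\<eta> < q" "q < c" "1 / \<beta>1 = q" using \<eta> by (auto simp: q_def \<beta>1_def)
  have \<beta>1: "1 / c < \<beta>1" unfolding \<beta>1_def using q cd by (intro divide_strict_left_mono) auto
  \<comment> \<open>This is \<open>\<delta> > d / c - 1\<close> rewritten; together with
    \<open>d < 2\<close> it leaves room for \<open>\<beta>2\<close> below
    \<open>1 / d\<close>.\<close>
  have "1 / (c * (1 + \<delta>)) < 1 / d" using \<delta>(1) \<delta>0 cd by (simp add: field_simps)
  moreover have "1 / 2 < 1 / d" using cd by (simp add: field_simps)
  ultimately have "max (1 / 2) (1 / (c * (1 + \<delta>))) < 1 / d" by simp
  then obtain \<beta>2 where b2: "max (1 / 2) (1 / (c * (1 + \<delta>))) < \<beta>2" "\<beta>2 < 1 / d" using dense by blast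
  then have \<beta>2: "1 / 2 < \<beta>2" "\<beta>2 < 1 / d" by auto
  have "1 < \<beta>2 * (c * (1 + \<delta>))"
    using b2(1) cd \<delta>0 by (subst (asm) max_less_iff_conj) (simp only: pos_divide_less_eq mult_pos_pos add_pos_pos zero_less_one)
  then have "1 \<le> (1 + \<delta>) * (c * \<beta>2)" by (simp add: mult_ac)
  then have \<beta>2': "1 / (c * \<beta>2) \<le> 1 + \<delta>"
    using cd \<beta>2 by (subst pos_divide_le_eq) auto
  have \<delta>s: "1 / (c * \<beta>2) \<le> 1 + \<delta>1" "1 / (c * \<beta>2) \<le> 1 + \<delta>2" "1 / (c * \<beta>2) \<le> 1 + \<delta>3"
    using \<beta>2' \<delta> by auto
  obtain \<alpha>' where \<alpha>': "\<And>x. x \<in> U \<Longrightarrow> (\<alpha> has_real_derivative \<alpha>' x) (at x)" "continuous_on U \<alpha>'"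
    by (rule real_deriv_of_C1[OF \<alpha>(1)]) blast
  have \<alpha>c: "continuous_on U \<alpha>"
    using \<alpha>'(1) by (auto intro!: continuous_at_imp_continuous_on DERIV_isCont)
  have \<alpha>U: "c \<le> \<alpha> w \<and> \<alpha> w \<le> d" if "w \<in> U" for w using \<alpha>(2) that by (auto simp: image_subset_iff)
  obtain b' where b': "\<And>x. x \<in> U \<Longrightarrow> (b has_real_derivative b' x) (at x)"
    by (rule real_deriv_of_C1[OF b]) blast
  \<comment> \<open>On a compact ball around \<open>t\<close> the continuous derivative of
    \<open>\<alpha>\<close> is bounded, which provides \<open>A\<close>.\<close>
  obtain e where e: "0 < e" "cball t e \<subseteq> U" using U open_contains_cball by blast
  have "bounded (\<alpha>' ` cball t e)"
    using e by (intro compact_imp_bounded compact_continuous_image continuous_on_subset[OF \<alpha>'(2)]) auto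
  then obtain A where "\<forall>y\<in>\<alpha>' ` cball t e. norm y \<le> A" unfolding bounded_iff by blast
  then have A: "\<bar>\<alpha>' w\<bar> \<le> A" if "w \<in> cball t e" for w
    using imageI[OF that, of \<alpha>'] by (metis real_norm_def)
  define D where "D = 1 + A / c\<^sup>2 * (1 + 1 / min (\<beta>1 - 1 / c) (1 / d - \<beta>2))"
  define C0 where "C0 = max 1 ((2 * \<beta>1 / (2 * \<beta>1 - 1) + 2 * \<beta>2 / (2 * \<beta>2 - 1)) * (1 + K1 + K3 + K2))"
  have "0 \<le> A" using A[of t] e(1) by auto
  moreover have "0 < min (\<beta>1 - 1 / c) (1 / d - \<beta>2)" using \<beta>1 \<beta>2 by simp
  ultimately have D0: "0 < D" using cd unfolding D_def by (intro add_pos_nonneg) auto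
  define \<Phi> where "\<Phi> u = b u * stable_const (\<alpha> u) powr (1 / \<alpha> u)" for u
  have \<alpha>t: "0 < \<alpha> t" "\<alpha> t < 2" using \<alpha>U[OF U(2)] cd by auto
  have "lipschitz_at (\<lambda>u. stable_const (\<alpha> u) powr (1 / \<alpha> u)) t"
    by (rule lipschitz_at_compose[where \<phi>="\<lambda>a. stable_const a powr (1 / a)",
          OF lipschitz_at_stable_const[OF \<alpha>t] lipschitz_at_deriv[OF \<alpha>'(1)[OF U(2)]]])
  then have "lipschitz_at \<Phi> t"
    unfolding \<Phi>_def by (intro lipschitz_at_mult lipschitz_at_deriv[OF b'[OF U(2)]])
  then obtain L where L: "0 \<le> L" "\<forall>\<^sub>F u in nhds t. \<bar>\<Phi> u - \<Phi> t\<bar> \<le> L * \<bar>u - t\<bar>" by (rule lipschitz_atE)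
  obtain \<epsilon>0 K where K: "0 < \<epsilon>0" "0 < K" "\<And>r. 0 < r \<Longrightarrow> r < \<epsilon>0 \<Longrightarrow> ennreal (1 / r powr (H * \<alpha> t)) *
        (\<integral>\<^sup>+x. ennreal (\<bar>f (t + r) t x - f t t x\<bar> powr \<alpha> t) \<partial>m) \<le> ennreal K"
    using cond4 by blast
  \<comment> \<open>One constant for each piece; each of the two additions of tail bounds costs a
    factor \<open>2 powr q\<close>.\<close>
  define C1 where "C1 = max 1 (2 / (2 - d) * (1 + K1)) * L powr q"
  define C2 where "C2 = C0 * (2 * D) powr q * \<bar>\<Phi> t\<bar> powr q"
  define C3 where "C3 = max 1 (2 / (2 - d) * K) * \<bar>\<Phi> t\<bar> powr q"
  define C where "C = ((C1 + C2) * 2 powr q + C3) * 2 powr q"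
  let ?Y = "\<lambda>u. field_sigma_finite \<rho> \<alpha> b f \<Gamma> V \<gamma> u u"
  have "\<forall>\<^sub>F \<epsilon> in at_right 0. tail_bounded M (\<lambda>\<omega>. (?Y (t + \<epsilon>) \<omega> - ?Y t \<omega>) / \<epsilon> powr H) C q"
    using eventually_at_right_shift[OF L(2)] eventually_at_right_less[of 0] eventually_at_right_real[OF e(1)]
      eventually_at_right_real[OF K(1)] eventually_at_right_real[OF zero_less_one]
  proof eventually_elim
    case (elim \<epsilon>)
    then have \<epsilon>: "0 < \<epsilon>" "\<epsilon> < e" "\<epsilon> < \<epsilon>0" "\<epsilon> < 1" by auto
    define u where "u = t + \<epsilon>"
    have u: "t < u" "{t..u} \<subseteq> U" "u \<in> U"
      using \<epsilon> e by (auto simp: u_def subset_eq dist_real_def)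
    have F: "f s w \<in> F_space (\<alpha> w) m" if "s \<in> U" "w \<in> U" for s w using f that by blast
    have fm[measurable]: "f u u \<in> borel_measurable m" "f u t \<in> borel_measurable m" "f t t \<in> borel_measurable m"
      using F u U by (auto simp: F_space_def)
    have \<epsilon>H: "0 < \<epsilon> powr H" "\<epsilon> \<le> \<epsilon> powr H"
      using \<epsilon> H powr_mono'[of H 1 \<epsilon>] by auto
    let ?S = "series (kernel (\<alpha> u) (f u u))"
    let ?I = "series (\<lambda>p. kernel (\<alpha> u) (f u u) p - kernel (\<alpha> t) (f u t) p)"
    let ?G = "\<lambda>x. (f u t x - f t t x) / \<epsilon> powr H"
    let ?J = "series (kernel (\<alpha> t) ?G)"
    have tS: "tail_bounded M ?S (max 1 (2 / (2 - d) * (1 + K1))) q"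
      using \<alpha>U[OF u(3)] cd q 1 \<delta>1 u by (intro series_kernel_tail nn_integral_slice_le[where U=U and \<delta>=\<delta>1 and g="f u" and w=u]) auto
    have t1: "tail_bounded M (\<lambda>\<omega>. ((\<Phi> u - \<Phi> t) / \<epsilon> powr H) * ?S \<omega>) C1 q"
    proof (rule tail_bounded_mono[OF tail_bounded_scale[OF tS]])
      have "\<bar>(\<Phi> u - \<Phi> t) / \<epsilon> powr H\<bar> \<le> L * \<epsilon> / \<epsilon> powr H"
        using elim \<epsilon> \<epsilon>H by (auto simp: u_def abs_divide intro!: divide_right_mono)
      also have "\<dots> \<le> L" using \<epsilon>H L by (simp add: divide_le_eq mult_left_mono)
      finally show "max 1 (2 / (2 - d) * (1 + K1)) * \<bar>(\<Phi> u - \<Phi> t) / \<epsilon> powr H\<bar> powr q \<le> C1"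
        unfolding C1_def using q by (intro mult_left_mono powr_mono2) auto
    qed
    have tI: "tail_bounded M ?I (C0 * (2 * D * (u - t)) powr (1 / \<beta>1)) (1 / \<beta>1)"
    proof (rule series_increment_tail[OF U(1) _ _ u(1,2) cd(1,2) \<alpha>U \<alpha>c _ \<beta>1 \<beta>2(1,2) \<delta>s 1(2) 2(2) 3(2) 1(3)[OF u(3)] 2(3)[OF u(3)] 3(3)[OF u(3)] D_def C0_def])
      show "AE x in m. \<forall>w\<in>U. (\<lambda>w. f u w x) differentiable at w" using cond1 u by blast
      show "f u w \<in> borel_measurable m" if "w \<in> U" for w using F[OF u(3) that] by (simp add: F_space_def)
      fix w assume w: "t \<le> w" "w \<le> u"
      have "w \<in> cball t e" using w \<epsilon> by (auto simp: u_def dist_real_def)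
      then show "(\<alpha> has_real_derivative \<alpha>' w) (at w) \<and> \<bar>\<alpha>' w\<bar> \<le> A" using \<alpha>'(1) A e by blast
    qed
    have t2: "tail_bounded M (\<lambda>\<omega>. (\<Phi> t / \<epsilon> powr H) * ?I \<omega>) C2 q"
    proof (rule tail_bounded_mono[OF tail_bounded_scale[OF tI[unfolded q(4)]]])
      have "(2 * D * (u - t)) powr q * \<bar>\<Phi> t / \<epsilon> powr H\<bar> powr q = (2 * D) powr q * \<bar>\<Phi> t\<bar> powr q * (\<epsilon> / \<epsilon> powr H) powr q"
        using D0 \<epsilon> \<epsilon>H by (simp add: u_def abs_divide powr_mult powr_divide)
      also have "\<dots> \<le> (2 * D) powr q * \<bar>\<Phi> t\<bar> powr q * 1"
        using \<epsilon> \<epsilon>H q by (intro mult_left_mono powr_le1) auto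
      finally have "C0 * ((2 * D * (u - t)) powr q * \<bar>\<Phi> t / \<epsilon> powr H\<bar> powr q) \<le> C0 * ((2 * D) powr q * \<bar>\<Phi> t\<bar> powr q * 1)"
        by (intro mult_left_mono) (auto simp: C0_def)
      then show "C0 * (2 * D * (u - t)) powr q * \<bar>\<Phi> t / \<epsilon> powr H\<bar> powr q \<le> C2"
        by (simp add: C2_def mult.assoc)
    qed
    have tJ: "tail_bounded M ?J (max 1 (2 / (2 - d) * K)) q"
    proof (rule series_kernel_tail)
      have "(\<integral>\<^sup>+x. ennreal (\<bar>?G x\<bar> powr \<alpha> t) \<partial>m) = (\<integral>\<^sup>+x. ennreal (1 / \<epsilon> powr (H * \<alpha> t)) * ennreal (\<bar>f u t x - f t t x\<bar> powr \<alpha> t) \<partial>m)"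
        using \<epsilon>H by (intro nn_integral_cong) (simp add: ennreal_mult[symmetric] abs_divide powr_divide powr_powr)
      also have "\<dots> = ennreal (1 / \<epsilon> powr (H * \<alpha> t)) * (\<integral>\<^sup>+x. ennreal (\<bar>f u t x - f t t x\<bar> powr \<alpha> t) \<partial>m)"
        by (rule nn_integral_cmult) measurable
      also have "\<dots> \<le> ennreal K" using K(3)[OF \<epsilon>(1,3)] by (simp add: u_def)
      finally show "(\<integral>\<^sup>+x. ennreal (\<bar>?G x\<bar> powr \<alpha> t) \<partial>m) \<le> ennreal K" .
    qed (use \<alpha>t \<alpha>U[OF U(2)] cd q K in auto)
    have t3: "tail_bounded M (\<lambda>\<omega>. \<Phi> t * ?J \<omega>) C3 q"
      unfolding C3_def by (rule tail_bounded_scale[OF tJ])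
    have sum: "tail_bounded M (\<lambda>\<omega>. ((\<Phi> u - \<Phi> t) / \<epsilon> powr H) * ?S \<omega> + (\<Phi> t / \<epsilon> powr H) * ?I \<omega> + \<Phi> t * ?J \<omega>) C q"
      unfolding C_def by (intro tail_bounded_add prob_space_axioms t1 t2 t3)
    have [measurable]: "random_variable borel (?Y u)" "random_variable borel (?Y t)"
      using F u U by (auto intro!: measurable_field)
    \<comment> \<open>Telescoping through the argument pairs \<open>(u, u)\<close>,
      \<open>(u, t)\<close> and \<open>(t, t)\<close>. Series are subtracted where they converge,
      hence an almost sure identity.\<close>
    have "AE \<omega> in M. ((\<Phi> u - \<Phi> t) / \<epsilon> powr H) * ?S \<omega> + (\<Phi> t / \<epsilon> powr H) * ?I \<omega> + \<Phi> t * ?J \<omega> = (?Y u \<omega> - ?Y t \<omega>) / \<epsilon> powr H"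
    proof -
      have s: "AE \<omega> in M. summable (\<lambda>i. \<gamma> i \<omega> * kernel (\<alpha> w) (f s w) (\<Gamma> i \<omega>, V i \<omega>))" if "s \<in> U" "w \<in> U" for s w
        using F[OF that] \<alpha>U[OF that(2)] cd by (intro AE_summable_field) auto
      from s[OF u(3) u(3)] s[OF u(3) U(2)] s[OF U(2) U(2)] show ?thesis
      proof eventually_elim
        case (elim \<omega>)
        have I: "?I \<omega> = ?S \<omega> - series (kernel (\<alpha> t) (f u t)) \<omega>"
          by (rule series_diff[OF elim(1,2)])
        have J: "?J \<omega> = (series (kernel (\<alpha> t) (f u t)) \<omega> - series (kernel (\<alpha> t) (f t t)) \<omega>) / \<epsilon> powr H"
        proof -
          have "?J \<omega> = (\<Sum>i. \<gamma> i \<omega> * (kernel (\<alpha> t) (f u t) (\<Gamma> i \<omega>, V i \<omega>) - kernel (\<alpha> t) (f t t) (\<Gamma> i \<omega>, V i \<omega>)) / \<epsilon> powr H)"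
            unfolding series_def kernel_divide kernel_diff by simp
          also have "\<dots> = (\<Sum>i. \<gamma> i \<omega> * (kernel (\<alpha> t) (f u t) (\<Gamma> i \<omega>, V i \<omega>) - kernel (\<alpha> t) (f t t) (\<Gamma> i \<omega>, V i \<omega>))) / \<epsilon> powr H"
            unfolding right_diff_distrib by (intro suminf_divide summable_diff elim)
          also have "(\<Sum>i. \<gamma> i \<omega> * (kernel (\<alpha> t) (f u t) (\<Gamma> i \<omega>, V i \<omega>) - kernel (\<alpha> t) (f t t) (\<Gamma> i \<omega>, V i \<omega>))) =
              series (kernel (\<alpha> t) (f u t)) \<omega> - series (kernel (\<alpha> t) (f t t)) \<omega>"
            using series_diff[OF elim(2,3)] unfolding series_def .
          finally show ?thesis .
        qed
        show ?case
          unfolding field_sigma_finite_eq_series \<Phi>_def[symmetric] I J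
          using \<epsilon>H by (simp add: field_simps)
      qed
    qed
    then show "tail_bounded M (\<lambda>\<omega>. (?Y (t + \<epsilon>) \<omega> - ?Y t \<omega>) / \<epsilon> powr H) C q"
      unfolding u_def[symmetric] by (intro tail_bounded_cong_AE[OF sum]) measurable
  qed
  then show ?thesis using q(2) by blast
qed

end

section \<open>Reduction of the finite measure conditions to a constant weight\<close>

lemma nn_integral_leI:
  assumes "\<And>g. g \<in> borel_measurable M \<Longrightarrow> (\<And>x. g x \<le> P x) \<Longrightarrow> (\<integral>\<^sup>+x. g x \<partial>M) \<le> K"
  shows "(\<integral>\<^sup>+x. P x \<partial>M) \<le> K"
  unfolding nn_integral_def[of M P]
proof (rule SUP_least)
  fix g assume "g \<in> {g. simple_function M g \<and> g \<le> P}"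
  then show "integral\<^sup>S M g \<le> K"
    using assms[of g] by (auto simp: nn_integral_eq_simple_integral le_fun_def borel_measurable_simple_function)
qed

text \<open>\<open>P\<close> may be nonmeasurable, so the density formula is applied to measurable
  minorants of the left integrand. The factor \<open>k * r\<close> collects the weight
  \<open>k\<close> and the inverse of the density.\<close>

lemma nn_integral_density_const_le:
  assumes r: "0 < r" and k: "0 < k"
  shows "(\<integral>\<^sup>+x. P x * ennreal k \<partial>m) \<le> ennreal (k * r) * (\<integral>\<^sup>+x. P x \<partial>density m (\<lambda>_. ennreal (1 / r)))"
proof (rule nn_integral_leI)
  fix g assume [measurable]: "g \<in> borel_measurable m" and le: "\<And>x. g x \<le> P x * ennreal k"
  have inv: "ennreal k * ennreal (1 / k) = 1" "ennreal (k * r) * (ennreal (1 / r) * ennreal (1 / k)) = 1"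
    using r k by (simp_all add: ennreal_mult[symmetric])
  have "(\<integral>\<^sup>+x. g x \<partial>m) = ennreal (k * r) * (ennreal (1 / r) * ennreal (1 / k)) * (\<integral>\<^sup>+x. g x \<partial>m)"
    unfolding inv by simp
  also have "\<dots> = ennreal (k * r) * (\<integral>\<^sup>+x. ennreal (1 / r) * (ennreal (1 / k) * g x) \<partial>m)"
    by (simp add: nn_integral_cmult mult.assoc)
  also have "(\<integral>\<^sup>+x. ennreal (1 / r) * (ennreal (1 / k) * g x) \<partial>m) = (\<integral>\<^sup>+x. ennreal (1 / k) * g x \<partial>density m (\<lambda>_. ennreal (1 / r)))"
    by (rule nn_integral_density[symmetric]) measurable
  also have "\<dots> \<le> (\<integral>\<^sup>+x. P x \<partial>density m (\<lambda>_. ennreal (1 / r)))"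
  proof (rule nn_integral_mono)
    fix x
    have "ennreal (1 / k) * g x \<le> ennreal (1 / k) * (P x * ennreal k)" using le by (rule mult_left_mono) simp
    also have "\<dots> = (ennreal k * ennreal (1 / k)) * P x" by (simp only: mult_ac)
    finally show "ennreal (1 / k) * g x \<le> P x" unfolding inv by simp
  qed
  finally show "(\<integral>\<^sup>+x. g x \<partial>m) \<le> ennreal (k * r) * (\<integral>\<^sup>+x. P x \<partial>density m (\<lambda>_. ennreal (1 / r)))"
    by (simp add: mult_left_mono)
qed

lemma ennreal_powr_le_mult:
  assumes "x \<le> ennreal L * y" "0 < L" "0 \<le> p"
  shows "ennreal_powr x p \<le> ennreal_powr y p * ennreal (L powr p)"
proof (cases "y = \<infinity>")
  case False
  then obtain v where v: "y = ennreal v" "0 \<le> v" by (cases y) auto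
  then have "x \<le> ennreal (L * v)" using assms by (simp add: ennreal_mult)
  then obtain w where w: "x = ennreal w" "0 \<le> w" "w \<le> L * v" using v assms by (cases x) (auto simp: top_unique)
  have "w powr p \<le> (L * v) powr p" using w assms by (intro powr_mono2) auto
  then show ?thesis
    using v w assms by (simp add: ennreal_powr_def ennreal_mult[symmetric] powr_mult mult.commute)
qed (use assms in \<open>simp add: ennreal_powr_def ennreal_top_mult\<close>)

text \<open>Two functions are allowed so that, besides \<open>g' = g\<close> with
  \<open>L = 1\<close>, the lemma covers the logarithmic condition: for a constant weight
  \<open>ln r\<close> is a constant, and \<open>L\<close> bounds its powers.\<close>

lemma sup_cond_sigma_finite_const:
  assumes sc: "sup_cond_finite U \<alpha> c d (density m (\<lambda>_. ennreal (1 / r))) g" and r: "0 < r" and dc: "0 < c" "c \<le> d"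
    and L: "0 < L" and le: "\<And>s w x. s \<in> U \<Longrightarrow> w \<in> U \<Longrightarrow> \<bar>g' s w x\<bar> powr \<alpha> w \<le> L * \<bar>g s w x\<bar> powr \<alpha> w"
  shows "sup_cond_sigma_finite U \<alpha> c d m (\<lambda>_. r) g'"
proof -
  let ?mh = "density m (\<lambda>_. ennreal (1 / r))"
  let ?S = "\<lambda>g s x. SUP w\<in>U. ennreal (\<bar>g s w x\<bar> powr \<alpha> w)"
  let ?N = "\<lambda>\<delta>. SUP s\<in>U. \<integral>\<^sup>+x. ennreal_powr (?S g s x) (1 + \<delta>) \<partial>?mh"
  obtain \<delta> where \<delta>: "d / c - 1 < \<delta>" "?N \<delta> < \<infinity>"
    using sc unfolding sup_cond_finite_def by blast
  have "1 \<le> d / c" using dc by simp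
  then have \<delta>0: "0 < \<delta>" using \<delta> by simp
  let ?k = "L powr (1 + \<delta>) * r powr \<delta>"
  have "(\<integral>\<^sup>+x. ennreal_powr (?S g' s x) (1 + \<delta>) * ennreal (r powr \<delta>) \<partial>m)
      \<le> ennreal (?k * r) * ?N \<delta>" if s: "s \<in> U" for s
  proof -
    have "(\<integral>\<^sup>+x. ennreal_powr (?S g' s x) (1 + \<delta>) * ennreal (r powr \<delta>) \<partial>m) \<le>
        (\<integral>\<^sup>+x. ennreal_powr (?S g s x) (1 + \<delta>) * ennreal ?k \<partial>m)"
    proof (rule nn_integral_mono)
      fix x
      have "?S g' s x \<le> ennreal L * ?S g s x"
      proof (rule SUP_least)
        fix w assume w: "w \<in> U"
        have "ennreal (\<bar>g' s w x\<bar> powr \<alpha> w) \<le> ennreal L * ennreal (\<bar>g s w x\<bar> powr \<alpha> w)"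
          using le[OF s w] L by (simp add: ennreal_mult[symmetric] ennreal_leI)
        also have "\<dots> \<le> ennreal L * ?S g s x" using w by (intro mult_left_mono SUP_upper) auto
        finally show "ennreal (\<bar>g' s w x\<bar> powr \<alpha> w) \<le> ennreal L * ?S g s x" .
      qed
      then have "ennreal_powr (?S g' s x) (1 + \<delta>) * ennreal (r powr \<delta>) \<le>
          ennreal_powr (?S g s x) (1 + \<delta>) * ennreal (L powr (1 + \<delta>)) * ennreal (r powr \<delta>)"
        using L \<delta>0 by (intro mult_right_mono ennreal_powr_le_mult) auto
      then show "ennreal_powr (?S g' s x) (1 + \<delta>) * ennreal (r powr \<delta>) \<le> ennreal_powr (?S g s x) (1 + \<delta>) * ennreal ?k"
        by (simp add: ennreal_mult mult.assoc)
    qed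
    also have "\<dots> \<le> ennreal (?k * r) * (\<integral>\<^sup>+x. ennreal_powr (?S g s x) (1 + \<delta>) \<partial>?mh)"
      using r L by (intro nn_integral_density_const_le) auto
    also have "\<dots> \<le> ennreal (?k * r) * ?N \<delta>"
      using s by (intro mult_left_mono SUP_upper) auto
    finally show ?thesis .
  qed
  then have "(SUP s\<in>U. \<integral>\<^sup>+x. ennreal_powr (?S g' s x) (1 + \<delta>) * ennreal (r powr \<delta>) \<partial>m)
      \<le> ennreal (?k * r) * ?N \<delta>"
    by (rule SUP_least)
  also have "\<dots> < \<infinity>" using \<delta>(2) by (simp add: ennreal_mult_less_top)
  finally show ?thesis using \<delta>(1) unfolding sup_cond_sigma_finite_def by blast
qed

section \<open>Convergence of moments of the increments\<close>

lemma scale_measure_eq_density_const: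
  assumes "finite_measure m" "emeasure m (space m) \<noteq> 0"
  shows "scale_measure (1 / emeasure m (space m)) m = density m (\<lambda>_. ennreal (1 / measure m (space m)))"
    and "0 < measure m (space m)"
proof -
  interpret finite_measure m by fact
  show pos: "0 < measure m (space m)"
    using assms(2) by (simp add: emeasure_eq_measure zero_less_measure_iff)
  have "1 / emeasure m (space m) = ennreal (1 / measure m (space m))"
    using pos divide_ennreal[of 1 "measure m (space m)"] by (simp add: emeasure_eq_measure)
  then show "scale_measure (1 / emeasure m (space m)) m = density m (\<lambda>_. ennreal (1 / measure m (space m)))"
    by (intro measure_eqI) (simp_all add: emeasure_density nn_integral_cmult_indicator)
qed

text \<open>The constant \<open>measure m (space m) powr (1 / \<alpha> u)\<close> is pulled out of
  the series where the series converges, which is almost surely.\<close>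

lemma (in stable_kernel) AE_field_finite_eq:
  assumes \<rho>: "\<rho> = (\<lambda>_. measure m (space m))" "0 < measure m (space m)"
    and f: "f s u \<in> F_space (\<alpha> u) m" and a: "0 < \<alpha> u" "\<alpha> u < 2"
  shows "AE \<omega> in M. field_sigma_finite \<rho> \<alpha> b f \<Gamma> V \<gamma> s u \<omega> = field_finite m \<alpha> b f \<Gamma> V \<gamma> s u \<omega>"
  using AE_summable_field[where f=f and s=s and u=u and \<alpha>=\<alpha>, OF f a]
proof eventually_elim
  case (elim \<omega>)
  let ?r = "measure m (space m) powr (1 / \<alpha> u)"
  have r: "?r \<noteq> 0" using \<rho> by simp
  have eq: "\<gamma> i \<omega> * kernel (\<alpha> u) (f s u) (\<Gamma> i \<omega>, V i \<omega>) = ?r * (\<gamma> i \<omega> * \<Gamma> i \<omega> powr (- 1 / \<alpha> u) * f s u (V i \<omega>))" for i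
    using fun_cong[OF \<rho>(1)] by (simp add: kernel_def)
  have "summable (\<lambda>i. \<gamma> i \<omega> * \<Gamma> i \<omega> powr (- 1 / \<alpha> u) * f s u (V i \<omega>))"
    using elim r unfolding eq summable_cmult_iff by blast
  then have "series (kernel (\<alpha> u) (f s u)) \<omega> = ?r * (\<Sum>i. \<gamma> i \<omega> * \<Gamma> i \<omega> powr (- 1 / \<alpha> u) * f s u (V i \<omega>))"
    unfolding series_def eq by (rule suminf_mult)
  then show ?case
    by (simp add: field_sigma_finite_eq_series field_finite_def)
qed

lemma measurable_field_finite:
  assumes "lepage_inputs M mhat \<Gamma> V \<gamma>" and sets: "sets mhat = sets m" and f: "f s u \<in> F_space (\<alpha> u) m"
  shows "field_finite m \<alpha> b f \<Gamma> V \<gamma> s u \<in> borel_measurable M"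
proof -
  interpret lepage M mhat \<Gamma> V \<gamma> by unfold_locales fact
  have [measurable]: "f s u \<in> borel_measurable mhat"
    using f unfolding measurable_cong_sets[OF sets refl] by (simp add: F_space_def)
  show ?thesis unfolding field_finite_def[abs_def] by measurable
qed

text \<open>One-point marginal: the test function looks only at coordinate 0 of the padded vector of
  length 1.\<close>

lemma fdd_tendsto_one:
  fixes g :: "real \<Rightarrow> real"
  assumes fdd: "fdd_tendsto M Z M' Z' F" and g: "continuous_on UNIV g" "bounded (range g)"
  shows "((\<lambda>r. \<integral>\<omega>. g (Z r s \<omega>) \<partial>M) \<longlongrightarrow> (\<integral>\<omega>. g (Z' s \<omega>) \<partial>M')) F"
proof -
  let ?g = "\<lambda>z :: nat \<Rightarrow> real. g (z 0)"
  have "continuous_on UNIV ?g"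
    by (rule continuous_on_compose2[OF g(1)]) (auto intro: continuous_on_product_coordinates)
  moreover have "bounded (range ?g)" by (rule bounded_subset[OF g(2)]) auto
  ultimately show ?thesis
    using fdd[unfolded fdd_tendsto_def, rule_format, of ?g 1 "\<lambda>_. s"] by simp
qed

text \<open>The integrability claims make the Bochner integrals genuine expectations, since a
  nonintegrable function has integral 0. The quotient form of the limit is meaningful for every
  local form; the ratio form presupposes a nonzero limit moment, that is, \<open>Y' 1\<close> not
  almost surely zero.\<close>

theorem theorem1:
  fixes M :: "'w measure" and m mhat :: "'e measure" and \<rho> :: "'e \<Rightarrow> real"
    and U :: "real set" and t c d \<eta> h_minus h_plus :: real
    and \<alpha> b h :: "real \<Rightarrow> real"
    and f :: "real \<Rightarrow> real \<Rightarrow> 'e \<Rightarrow> real"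
    and \<Gamma> \<gamma> :: "nat \<Rightarrow> 'w \<Rightarrow> real" and V :: "nat \<Rightarrow> 'w \<Rightarrow> 'e"
    and X :: "real \<Rightarrow> real \<Rightarrow> 'w \<Rightarrow> real" and Y :: "real \<Rightarrow> 'w \<Rightarrow> real"
    and MX :: "'p measure" and X' :: "real \<Rightarrow> 'p \<Rightarrow> real"
    and MY :: "'q measure" and Y' :: "real \<Rightarrow> 'q \<Rightarrow> real"
  assumes U: "open U" "is_interval U" "t \<in> U"
    and cd: "0 < c" "c \<le> d" "d < 2"
    and \<alpha>: "\<alpha> C1_differentiable_on U" "\<alpha> ` U \<subseteq> {c..d}"
    and b: "b C1_differentiable_on U" "bounded (b ` U)"
    and f: "\<forall>s\<in>U. \<forall>u\<in>U. f s u \<in> F_space (\<alpha> u) m"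
    and inputs: "lepage_inputs M mhat \<Gamma> V \<gamma>"
    and cond1: "\<forall>s\<in>U. AE x in m. \<forall>v\<in>U. (\<lambda>w. f s w x) differentiable (at v)"
    and field_and_cond2:
      "(finite_measure m \<and> emeasure m (space m) \<noteq> 0 \<and>
        mhat = scale_measure (1 / emeasure m (space m)) m \<and>
        X = field_finite m \<alpha> b f \<Gamma> V \<gamma> \<and>
        sup_cond_finite U \<alpha> c d mhat f \<and>
        sup_cond_finite U \<alpha> c d mhat (\<lambda>s w x. deriv (\<lambda>v. f s v x) w))
       \<or>
       (sigma_finite_measure m \<and> \<rho> \<in> borel_measurable m \<and> (\<forall>x\<in>space m. 0 < \<rho> x) \<and>
        mhat = density m (\<lambda>x. ennreal (1 / \<rho> x)) \<and> prob_space mhat \<and>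
        X = field_sigma_finite \<rho> \<alpha> b f \<Gamma> V \<gamma> \<and>
        sup_cond_sigma_finite U \<alpha> c d m \<rho> f \<and>
        sup_cond_sigma_finite U \<alpha> c d m \<rho> (\<lambda>s w x. deriv (\<lambda>v. f s v x) w) \<and>
        sup_cond_sigma_finite U \<alpha> c d m \<rho> (\<lambda>s w x. f s w x * ln (\<rho> x)))"
    and Y: "Y = (\<lambda>s. X s s)"
    and \<eta>: "0 < \<eta>" "\<eta> < c"
    and h: "h C1_differentiable_on U" "h ` U \<subseteq> {h_minus<..<h_plus}"
      "{h_minus<..<h_plus} \<subseteq> {0<..<1}"
    and cond3: "localisable_with M (\<lambda>s. X s t) t (h t) MX X'"
    and cond4: "\<exists>\<epsilon>0>0. \<exists>K>0. \<forall>r. 0 < r \<and> r < \<epsilon>0 \<longrightarrow>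
      ennreal (1 / r powr (h t * \<alpha> t)) *
        (\<integral>\<^sup>+x. ennreal (\<bar>f (t + r) t x - f t t x\<bar> powr \<alpha> t) \<partial>m) \<le> ennreal K"
    and local_form_Y: "localisable_with M Y t (h t) MY Y'"
  shows
    "(\<forall>\<^sub>F \<epsilon> in at_right 0. integrable M (\<lambda>\<omega>. \<bar>Y (t + \<epsilon>) \<omega> - Y t \<omega>\<bar> powr \<eta>)) \<and>
     integrable MY (\<lambda>\<omega>. \<bar>Y' 1 \<omega>\<bar> powr \<eta>) \<and>
     ((\<lambda>\<epsilon>. (\<integral>\<omega>. \<bar>Y (t + \<epsilon>) \<omega> - Y t \<omega>\<bar> powr \<eta> \<partial>M) / \<epsilon> powr (\<eta> * h t))
        \<longlongrightarrow> (\<integral>\<omega>. \<bar>Y' 1 \<omega>\<bar> powr \<eta> \<partial>MY)) (at_right 0) \<and>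
     (\<not> (AE \<omega> in MY. Y' 1 \<omega> = 0) \<longrightarrow>
        (\<lambda>\<epsilon>. \<integral>\<omega>. \<bar>Y (t + \<epsilon>) \<omega> - Y t \<omega>\<bar> powr \<eta> \<partial>M)
          \<sim>[at_right 0]
        (\<lambda>\<epsilon>. \<epsilon> powr (\<eta> * h t) * (\<integral>\<omega>. \<bar>Y' 1 \<omega>\<bar> powr \<eta> \<partial>MY)))"
proof -
  \<comment> \<open>Both cases of the field are merged into one tail statement about
    \<open>Y\<close>, from which the moment argument proceeds.\<close>
  obtain C q where q: "\<eta> < q" and tail: "\<forall>\<^sub>F \<epsilon> in at_right 0. tail_bounded M (\<lambda>\<omega>. (Y (t + \<epsilon>) \<omega> - Y t \<omega>) / \<epsilon> powr h t) C q"
    and Ym: "\<And>s. s \<in> U \<Longrightarrow> Y s \<in> borel_measurable M"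
  proof -
    have "h t \<in> {0<..<1}" using h(2,3) U(3) by blast
    then have ht: "0 < h t" "h t < 1" by auto
    have \<alpha>U: "0 < \<alpha> w" "\<alpha> w < 2" if "w \<in> U" for w using \<alpha>(2) that cd by (auto simp: image_subset_iff intro: less_le_trans le_less_trans)
    have F: "f s w \<in> F_space (\<alpha> w) m" if "s \<in> U" "w \<in> U" for s w using f that by blast
    have Ueps: "\<forall>\<^sub>F \<epsilon> in at_right 0. t + \<epsilon> \<in> U"
      using eventually_at_right_shift[OF eventually_nhds_in_open[OF U(1,3)]] .
    show thesis
      using field_and_cond2
    proof (elim disjE conjE)
      assume fin: "finite_measure m" "emeasure m (space m) \<noteq> 0" "mhat = scale_measure (1 / emeasure m (space m)) m"
        and X: "X = field_finite m \<alpha> b f \<Gamma> V \<gamma>"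
        and sc: "sup_cond_finite U \<alpha> c d mhat f" "sup_cond_finite U \<alpha> c d mhat (\<lambda>s w x. deriv (\<lambda>v. f s v x) w)"
      define r where "r = measure m (space m)"
      have r: "0 < r" and mhat: "mhat = density m (\<lambda>_. ennreal (1 / r))"
        using scale_measure_eq_density_const[OF fin(1,2)] fin(3) by (simp_all add: r_def)
      interpret stable_kernel M mhat \<Gamma> V \<gamma> m "\<lambda>_. r"
        by unfold_locales (use inputs r mhat in auto)
      \<comment> \<open>As \<open>\<alpha> w \<le> d\<close>, this bounds
        \<open>\<bar>ln r\<bar> powr \<alpha> w\<close> for all \<open>w\<close> in
        \<open>U\<close>; the maximum with 1 makes the power monotone in the exponent.\<close>
      define L where "L = max 1 \<bar>ln r\<bar> powr d"
      have L: "0 < L" by (simp add: L_def)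
      have le: "\<bar>f s w x * ln r\<bar> powr \<alpha> w \<le> L * \<bar>f s w x\<bar> powr \<alpha> w" if "w \<in> U" for s w x
      proof -
        have "\<bar>ln r\<bar> powr \<alpha> w \<le> max 1 \<bar>ln r\<bar> powr \<alpha> w" using \<alpha>U[OF that] by (intro powr_mono2) auto
        also have "\<dots> \<le> L" unfolding L_def using \<alpha>(2) that by (intro powr_mono) (auto simp: image_subset_iff)
        finally show ?thesis by (simp add: abs_mult powr_mult mult.commute mult_right_mono)
      qed
      have cond2: "sup_cond_sigma_finite U \<alpha> c d m (\<lambda>_. r) f"
          "sup_cond_sigma_finite U \<alpha> c d m (\<lambda>_. r) (\<lambda>s w x. deriv (\<lambda>v. f s v x) w)"
          "sup_cond_sigma_finite U \<alpha> c d m (\<lambda>_. r) (\<lambda>s w x. f s w x * ln r)"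
        using sc[unfolded mhat] r cd L le
        by (auto intro: sup_cond_sigma_finite_const[where L=1] sup_cond_sigma_finite_const[where L=L and g=f])
      let ?F = "\<lambda>s. field_sigma_finite (\<lambda>_. r) \<alpha> b f \<Gamma> V \<gamma> s s"
      obtain C q where "\<eta> < q" and C: "\<forall>\<^sub>F \<epsilon> in at_right 0. tail_bounded M
        (\<lambda>\<omega>. (?F (t + \<epsilon>) \<omega> -
             ?F t \<omega>) / \<epsilon> powr h t) C q"
        using diagonal_increment_tail[OF U(1,3) cd \<alpha> b(1) f cond1 cond2 \<eta> ht cond4] by blast
      have meas: "Y s \<in> borel_measurable M" if "s \<in> U" for s
        unfolding Y X by (rule measurable_field_finite[where f=f and s=s and u=s and \<alpha>=\<alpha>, OF inputs sets_mhat F[OF that that]])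
      have eq: "AE \<omega> in M. ?F s \<omega> = Y s \<omega>" if "s \<in> U" for s
        unfolding Y X
        by (rule AE_field_finite_eq[where f=f and s=s and u=s and \<alpha>=\<alpha>, OF _ _ F[OF that that] \<alpha>U[OF that]]) (use r in \<open>simp_all add: r_def\<close>)
      have "\<forall>\<^sub>F \<epsilon> in at_right 0. tail_bounded M (\<lambda>\<omega>. (Y (t + \<epsilon>) \<omega> - Y t \<omega>) / \<epsilon> powr h t) C q"
        using C Ueps
      proof eventually_elim
        case (elim \<epsilon>)
        note [measurable] = meas[OF elim(2)] meas[OF U(3)]
        show ?case
        proof (rule tail_bounded_cong_AE[OF elim(1)])
          show "AE \<omega> in M. (?F (t + \<epsilon>) \<omega> -
             ?F t \<omega>) / \<epsilon> powr h t = (Y (t + \<epsilon>) \<omega> - Y t \<omega>) / \<epsilon> powr h t"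
            using eq[OF elim(2)] eq[OF U(3)] by eventually_elim simp
        qed measurable
      qed
      from that[OF \<open>\<eta> < q\<close> this meas] show thesis .
    next
      assume "\<rho> \<in> borel_measurable m" "\<forall>x\<in>space m. 0 < \<rho> x" "mhat = density m (\<lambda>x. ennreal (1 / \<rho> x))"
        and X: "X = field_sigma_finite \<rho> \<alpha> b f \<Gamma> V \<gamma>"
        and sc: "sup_cond_sigma_finite U \<alpha> c d m \<rho> f"
          "sup_cond_sigma_finite U \<alpha> c d m \<rho> (\<lambda>s w x. deriv (\<lambda>v. f s v x) w)"
          "sup_cond_sigma_finite U \<alpha> c d m \<rho> (\<lambda>s w x. f s w x * ln (\<rho> x))"
      then interpret stable_kernel M mhat \<Gamma> V \<gamma> m \<rho>
        by unfold_locales (use inputs in auto)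
      obtain C q where C: "\<eta> < q" "\<forall>\<^sub>F \<epsilon> in at_right 0. tail_bounded M
        (\<lambda>\<omega>. (field_sigma_finite \<rho> \<alpha> b f \<Gamma> V \<gamma> (t + \<epsilon>) (t + \<epsilon>) \<omega> -
             field_sigma_finite \<rho> \<alpha> b f \<Gamma> V \<gamma> t t \<omega>) / \<epsilon> powr h t) C q"
        using diagonal_increment_tail[OF U(1,3) cd \<alpha> b(1) f cond1 sc \<eta> ht cond4] by blast
      have "Y s \<in> borel_measurable M" if "s \<in> U" for s
        unfolding Y X by (rule measurable_field[where f=f and s=s and u=s and \<alpha>=\<alpha>, OF F[OF that that]])
      with that C show thesis unfolding Y X by blast
    qed
  qed
  have M: "prob_space M" using inputs by (simp add: lepage_inputs_def)
  have loc: "prob_space MY" "Y' 1 \<in> borel_measurable MY"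
      "fdd_tendsto M (\<lambda>r s \<omega>. (Y (t + r * s) \<omega> - Y t \<omega>) / r powr h t) MY Y' (at_right 0)"
    using local_form_Y by (auto simp: localisable_with_def)
  let ?Z = "\<lambda>\<epsilon> \<omega>. (Y (t + \<epsilon>) \<omega> - Y t \<omega>) / \<epsilon> powr h t"
  let ?E = "\<integral>\<omega>. \<bar>Y' 1 \<omega>\<bar> powr \<eta> \<partial>MY"
  \<comment> \<open>At time 1 the increment over \<open>r * s\<close> is the increment over
    \<open>r\<close>.\<close>
  have weak: "((\<lambda>r. \<integral>\<omega>. g (?Z r \<omega>) \<partial>M) \<longlongrightarrow> (\<integral>\<omega>. g (Y' 1 \<omega>) \<partial>MY)) (at_right 0)"
    if "continuous_on UNIV g" "bounded (range g)" for g :: "real \<Rightarrow> real"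
    using fdd_tendsto_one[OF loc(3) that, of 1] by simp
  note moments = moment_convergence_of_tail[OF M loc(1,2) trivial_limit_at_right_real tail \<eta>(1) q]
  have conv: "\<forall>\<^sub>F \<epsilon> in at_right 0. integrable M (\<lambda>\<omega>. \<bar>?Z \<epsilon> \<omega>\<bar> powr \<eta>)"
      "integrable MY (\<lambda>\<omega>. \<bar>Y' 1 \<omega>\<bar> powr \<eta>)"
      "((\<lambda>\<epsilon>. \<integral>\<omega>. \<bar>?Z \<epsilon> \<omega>\<bar> powr \<eta> \<partial>M) \<longlongrightarrow> ?E) (at_right 0)"
    by (rule moments(1)[OF weak] moments(2)[OF weak] moments(3)[OF weak]; assumption)+
  have Z: "\<bar>Y (t + \<epsilon>) \<omega> - Y t \<omega>\<bar> powr \<eta> = \<epsilon> powr (\<eta> * h t) * \<bar>?Z \<epsilon> \<omega>\<bar> powr \<eta>" if "0 < \<epsilon>" for \<epsilon> \<omega>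
    using that by (simp add: abs_divide powr_divide powr_powr mult.commute)
  have pos: "\<forall>\<^sub>F \<epsilon> in at_right (0::real). 0 < \<epsilon>" by (rule eventually_at_right_less)
  have int: "\<forall>\<^sub>F \<epsilon> in at_right 0. integrable M (\<lambda>\<omega>. \<bar>Y (t + \<epsilon>) \<omega> - Y t \<omega>\<bar> powr \<eta>)"
    using conv(1) pos by eventually_elim (simp add: Z)
  have lim: "((\<lambda>\<epsilon>. (\<integral>\<omega>. \<bar>Y (t + \<epsilon>) \<omega> - Y t \<omega>\<bar> powr \<eta> \<partial>M) / \<epsilon> powr (\<eta> * h t)) \<longlongrightarrow> ?E) (at_right 0)"
  proof (rule Lim_transform_eventually[OF conv(3)])
    show "\<forall>\<^sub>F \<epsilon> in at_right 0. (\<integral>\<omega>. \<bar>?Z \<epsilon> \<omega>\<bar> powr \<eta> \<partial>M) = (\<integral>\<omega>. \<bar>Y (t + \<epsilon>) \<omega> - Y t \<omega>\<bar> powr \<eta> \<partial>M) / \<epsilon> powr (\<eta> * h t)"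
      using pos by eventually_elim (simp add: Z)
  qed
  have asy: "(\<lambda>\<epsilon>. \<integral>\<omega>. \<bar>Y (t + \<epsilon>) \<omega> - Y t \<omega>\<bar> powr \<eta> \<partial>M) \<sim>[at_right 0] (\<lambda>\<epsilon>. \<epsilon> powr (\<eta> * h t) * ?E)"
    if nt: "\<not> (AE \<omega> in MY. Y' 1 \<omega> = 0)"
  proof (rule asymp_equivI')
    \<comment> \<open>A nonnegative integrable function with integral zero vanishes almost
      everywhere, so nontriviality of \<open>Y' 1\<close> permits the division by
      \<open>?E\<close>.\<close>
    have "?E \<noteq> 0"
      using nt by (subst integral_nonneg_eq_0_iff_AE[OF conv(2)]) auto
    then have "((\<lambda>\<epsilon>. (\<integral>\<omega>. \<bar>Y (t + \<epsilon>) \<omega> - Y t \<omega>\<bar> powr \<eta> \<partial>M) / \<epsilon> powr (\<eta> * h t) / ?E) \<longlongrightarrow> ?E / ?E) (at_right 0)"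
      by (intro tendsto_divide lim tendsto_const)
    then show "((\<lambda>\<epsilon>. (\<integral>\<omega>. \<bar>Y (t + \<epsilon>) \<omega> - Y t \<omega>\<bar> powr \<eta> \<partial>M) / (\<epsilon> powr (\<eta> * h t) * ?E)) \<longlongrightarrow> 1) (at_right 0)"
      using \<open>?E \<noteq> 0\<close> by (simp add: divide_divide_eq_left)
  qed
  show ?thesis using int conv(2) lim asy by blast
qed

end
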